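(* Let $G$ be a finite solvable group and suppose given integers $n(H,\phi)$ for all pairs $(H,\phi)$ with $H$ a subgroup of $G$ and $\phi$ a character of $H$, satisfying: (ACH1) $n(H,\phi_1+\phi_2)=n(H,\phi_1)+n(H,\phi_2)$ for all characters $\phi_1,\phi_2$ of $H$; (ACH2) $n(G,\mathrm{Ind}_H^G\phi)=n(H,\phi)$ for every subgroup $H$ and every character $\phi$ of $H$; (ACH3) $n(H,\phi)\ge0$ for every subgroup $H$ and every one-dimensional character $\phi$ of $H$. Let $\chi_0$ be a one-dimensional character of $G$. Then \[\sum_{\chi\in\mathrm{Irr}(G)\setminus\{\chi_0\}}n(G,\chi)^2\le\big(n(G,\mathrm{Reg}_G)-n(G,\chi_0)\big)^2.\]
   Context: $\mathrm{Irr}(G)$ is the set of irreducible complex characters of $G$ and $\mathrm{Reg}_G=\sum_{\chi\in\mathrm{Irr}(G)}\chi(1)\chi$ is the regular character. $\mathrm{Ind}_H^G$ denotes induction of characters. *)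

theory Defs
  imports "HOL-Algebra.Solvable_Groups" "Jordan_Normal_Form.Matrix"
begin

text \<open>Characters of finite groups, built from complex matrix representations.
  Groups are HOL-Algebra groups; a subgroup is given by its carrier set H.
  A (class) function on G is represented as a function on the element type that
  vanishes outside the subgroup it lives on.\<close>

definition mat_trace :: "complex mat \<Rightarrow> complex" where
  "mat_trace A = (\<Sum>i<dim_row A. A $$ (i, i))"

definition is_rep :: "('a, 'b) monoid_scheme \<Rightarrow> 'a set \<Rightarrow> nat \<Rightarrow> ('a \<Rightarrow> complex mat) \<Rightarrow> bool" where
  "is_rep G H n \<rho> \<longleftrightarrow>
     (\<forall>h\<in>H. \<rho> h \<in> carrier_mat n n) \<and>
     \<rho> \<one>\<^bsub>G\<^esub> = 1\<^sub>m n \<and>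
     (\<forall>h\<in>H. \<forall>k\<in>H. \<rho> (h \<otimes>\<^bsub>G\<^esub> k) = \<rho> h * \<rho> k)"

definition affords :: "('a, 'b) monoid_scheme \<Rightarrow> 'a set \<Rightarrow> nat \<Rightarrow> ('a \<Rightarrow> complex mat) \<Rightarrow> ('a \<Rightarrow> complex) \<Rightarrow> bool" where
  "affords G H n \<rho> \<chi> \<longleftrightarrow> is_rep G H n \<rho> \<and> (\<forall>g. \<chi> g = (if g \<in> H then mat_trace (\<rho> g) else 0))"

definition is_character :: "('a, 'b) monoid_scheme \<Rightarrow> 'a set \<Rightarrow> ('a \<Rightarrow> complex) \<Rightarrow> bool" where
  "is_character G H \<chi> \<longleftrightarrow> (\<exists>n \<rho>. affords G H n \<rho> \<chi>)"

definition is_linear_character :: "('a, 'b) monoid_scheme \<Rightarrow> 'a set \<Rightarrow> ('a \<Rightarrow> complex) \<Rightarrow> bool" where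
  "is_linear_character G H \<chi> \<longleftrightarrow> (\<exists>\<rho>. affords G H 1 \<rho> \<chi>)"

definition irreducible_rep :: "('a, 'b) monoid_scheme \<Rightarrow> 'a set \<Rightarrow> nat \<Rightarrow> ('a \<Rightarrow> complex mat) \<Rightarrow> bool" where
  "irreducible_rep G H n \<rho> \<longleftrightarrow> is_rep G H n \<rho> \<and> n > 0 \<and>
     (\<forall>W. W \<subseteq> carrier_vec n \<and> 0\<^sub>v n \<in> W \<and>
          (\<forall>v\<in>W. \<forall>w\<in>W. v + w \<in> W) \<and> (\<forall>c. \<forall>v\<in>W. c \<cdot>\<^sub>v v \<in> W) \<and>
          (\<forall>h\<in>H. \<forall>v\<in>W. \<rho> h *\<^sub>v v \<in> W)
        \<longrightarrow> W = {0\<^sub>v n} \<or> W = carrier_vec n)"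

definition Irr :: "('a, 'b) monoid_scheme \<Rightarrow> ('a \<Rightarrow> complex) set" where
  "Irr G = {\<chi>. \<exists>n \<rho>. irreducible_rep G (carrier G) n \<rho> \<and> affords G (carrier G) n \<rho> \<chi>}"

definition Reg :: "('a, 'b) monoid_scheme \<Rightarrow> 'a \<Rightarrow> complex" where
  "Reg G = (\<lambda>g. \<Sum>\<chi>\<in>Irr G. \<chi> \<one>\<^bsub>G\<^esub> * \<chi> g)"

text \<open>Induction from H to G: Ind phi (g) = 1/|H| * sum_{x in G} phi(x g x^-1),
  phi being extended by 0 outside H (which our characters already are).\<close>
definition Ind :: "('a, 'b) monoid_scheme \<Rightarrow> 'a set \<Rightarrow> ('a \<Rightarrow> complex) \<Rightarrow> 'a \<Rightarrow> complex" where
  "Ind G H \<phi> = (\<lambda>g. if g \<in> carrier G then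
      (1 / of_nat (card H)) * (\<Sum>x\<in>carrier G. \<phi> (x \<otimes>\<^bsub>G\<^esub> g \<otimes>\<^bsub>G\<^esub> inv\<^bsub>G\<^esub> x))
    else 0)"

end

theory Submission
  imports Defs "Jordan_Normal_Form.Spectral_Radius" "HOL-Algebra.Multiplicative_Group" "HOL-Algebra.Zassenhaus"
begin

text \<open>Let \<open>\<Theta> = \<Sum>\<chi>. n(G, \<chi>) \<chi>\<close>, summed over the irreducible \<open>\<chi> \<noteq> \<chi>\<^sub>0\<close>.
  By orthonormality the left-hand side is the mean of \<open>\<Theta>(g) \<Theta>(g\<^sup>-\<^sup>1)\<close> over \<open>G\<close>, and
  \<open>\<Theta>(1) = n(G, Reg) - n(G, \<chi>\<^sub>0)\<close>, so it suffices that \<open>|\<Theta>(g)| \<le> \<Theta>(1)\<close> for every \<open>g\<close>.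
  This holds if the restriction of \<open>\<Theta>\<close> to \<open>C = \<langle>g\<rangle>\<close> is a nonnegative combination of linear
  characters. By Frobenius reciprocity the coefficient of \<open>\<phi>\<close> is \<open>n(C, \<phi>)\<close>, minus
  \<open>n(G, \<chi>\<^sub>0)\<close> if \<open>\<phi>\<close> is the restriction of \<open>\<chi>\<^sub>0\<close>; hence what is needed is
  \<open>n(G, \<chi>\<^sub>0) \<le> n(C, \<chi>\<^sub>0)\<close>. With \<open>D\<^sub>i\<close> the derived series, this is shown along the chain of subgroups
  \<open>D\<^sub>i C\<close>. In a step from \<open>M\<close> to \<open>L = N M\<close>, where \<open>N\<close> is normal and \<open>N / (M \<inter> N)\<close> is abelian,
  Fourier analysis on \<open>N / (M \<inter> N)\<close> writes \<open>Ind \<chi>\<^sub>0\<close> from \<open>M\<close> as \<open>Ind \<chi>\<^sub>0\<close> from \<open>L\<close> plus a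
  nonnegative rational combination of characters induced from linear ones, on which \<open>n\<close> is nonnegative.\<close>

section \<open>Traces and splittings of complex matrices\<close>

text \<open>The obstacle is that nothing is known about the sign of \<open>n\<close> beyond linear
  characters and, through ACH2, characters induced from them. So
  \<open>n(G, \<chi>\<^sub>0) \<le> n(C, \<chi>\<^sub>0)\<close> does not follow from
  \<open>\<chi>\<^sub>0\<close> being a constituent of its induced restriction: what remains must be
  exhibited as a combination of monomial characters. This can be done by an explicit formula when a
  single abelian section separates the two subgroups, and solvability supplies a chain of such
  steps. In a step, the indicator function of M \<inter> N on N is an average of characters of N /
  (M \<inter> N); averaging over conjugation by N kills the contribution of each such character
  except on its stabiliser, which is where the inducing subgroups come from. Denominators are
  cleared before \<open>n\<close> is applied, since \<open>n\<close> is additive and integer valued.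
  If \<open>n\<close> is read as the order of vanishing of Artin L-functions at a point, the
  restriction inequality is a twisted form of the Uchida-van der Waall theorem on quotients of
  Dedekind zeta functions in solvable extensions.\<close>

lemma mat_trace_mult:
  assumes "A \<in> carrier_mat n m" "B \<in> carrier_mat m n"
  shows "mat_trace (A * B) = (\<Sum>i<n. \<Sum>j<m. A $$ (i, j) * B $$ (j, i))"
  using assms by (auto simp: mat_trace_def scalar_prod_def atLeast0LessThan intro!: sum.cong)

lemma mat_trace_comm:
  assumes "A \<in> carrier_mat n m" "B \<in> carrier_mat m n"
  shows "mat_trace (A * B) = mat_trace (B * A)"
  unfolding mat_trace_mult[OF assms] mat_trace_mult[OF assms(2,1)]
  by (subst sum.swap) (simp add: mult.commute)

lemma mat_trace_one [simp]: "mat_trace (1\<^sub>m n) = of_nat n"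
  by (simp add: mat_trace_def)

lemma mat_trace_add:
  assumes "A \<in> carrier_mat n n" "B \<in> carrier_mat n n"
  shows "mat_trace (A + B) = mat_trace A + mat_trace B"
  using assms by (simp add: mat_trace_def sum.distrib)

lemma mat_trace_smult:
  assumes "A \<in> carrier_mat n n"
  shows "mat_trace (c \<cdot>\<^sub>m A) = c * mat_trace A"
  using assms by (simp add: mat_trace_def sum_distrib_left)

lemma eq_matI_mult_vec:
  fixes A B :: "'a :: comm_ring_1 mat"
  assumes A: "A \<in> carrier_mat n m" and B: "B \<in> carrier_mat n m"
    and eq: "\<And>v. v \<in> carrier_vec m \<Longrightarrow> A *\<^sub>v v = B *\<^sub>v v"
  shows "A = B"
proof (rule eq_matI)
  fix i j assume ij: "i < dim_row B" "j < dim_col B"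
  have "(A *\<^sub>v unit_vec m j) $ i = (B *\<^sub>v unit_vec m j) $ i"
    using eq by simp
  then show "A $$ (i, j) = B $$ (i, j)"
    using A B ij by simp
qed (use A B in auto)

text \<open>Padding both matrices with zeros to size k makes the left inverse two-sided, yet for n <
  k the padded \<open>P\<close> has a zero row. The bound makes a maximal choice possible in
  \<open>vec_subspace_retraction\<close>.\<close>

lemma left_inverse_dim_le:
  fixes P P' :: "'a :: field mat"
  assumes P: "P \<in> carrier_mat n k" and P': "P' \<in> carrier_mat k n" and eq: "P' * P = 1\<^sub>m k"
  shows "k \<le> n"
proof (rule ccontr)
  assume "\<not> k \<le> n"
  then have nk: "n < k" by simp
  define A where "A = mat k k (\<lambda>(i, j). if j < n then P' $$ (i, j) else 0)"
  define B where "B = mat k k (\<lambda>(i, j). if i < n then P $$ (i, j) else 0)"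
  have AB: "A \<in> carrier_mat k k" "B \<in> carrier_mat k k" by (simp_all add: A_def B_def)
  have "A * B = P' * P"
  proof (rule eq_matI)
    fix i j assume "i < dim_row (P' * P)" "j < dim_col (P' * P)"
    then have ij: "i < k" "j < k" using P P' by auto
    have "(A * B) $$ (i, j) = (\<Sum>l = 0..<k. A $$ (i, l) * B $$ (l, j))"
      using ij AB by (simp add: scalar_prod_def)
    also have "\<dots> = (\<Sum>l = 0..<n. P' $$ (i, l) * P $$ (l, j))"
      using nk ij by (intro sum.mono_neutral_cong_right) (auto simp: A_def B_def)
    finally show "(A * B) $$ (i, j) = (P' * P) $$ (i, j)"
      using ij P P' by (simp add: scalar_prod_def)
  qed (use P P' AB in auto)
  then have "B * A = 1\<^sub>m k"
    using mat_mult_left_right_inverse[OF AB] eq by simp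
  then have "(B * A) $$ (n, n) = 1" using nk by simp
  moreover have "(B * A) $$ (n, n) = 0"
    using nk AB by (simp add: scalar_prod_def B_def)
  ultimately show False by simp
qed

section \<open>Subspaces described by coordinate matrices and their left inverses\<close>

lemma retraction_mult_vec:
  fixes P P' :: "'a :: comm_ring_1 mat"
  assumes P: "P \<in> carrier_mat n k" and P': "P' \<in> carrier_mat k n" and eq: "P' * P = 1\<^sub>m k"
    and v: "v \<in> carrier_vec k"
  shows "P' *\<^sub>v (P *\<^sub>v v) = v"
  using assoc_mult_mat_vec[OF P' P v] eq v by simp

text \<open>The clauses are those that \<open>irreducible_rep\<close> imposes on \<open>W\<close>,
  apart from invariance, so both unfold to the same conditions.\<close>

definition vec_subspace :: "nat \<Rightarrow> complex vec set \<Rightarrow> bool" where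
  "vec_subspace n W \<longleftrightarrow> W \<subseteq> carrier_vec n \<and> 0\<^sub>v n \<in> W \<and>
     (\<forall>v\<in>W. \<forall>w\<in>W. v + w \<in> W) \<and> (\<forall>c. \<forall>v\<in>W. c \<cdot>\<^sub>v v \<in> W)"

lemma mult_mat_vec_zero:
  assumes "A \<in> carrier_mat n m"
  shows "A *\<^sub>v 0\<^sub>v m = (0\<^sub>v n :: complex vec)"
  using assms by (intro eq_vecI) (auto simp: scalar_prod_def)

lemma vec_subspace_kernel:
  assumes "A \<in> carrier_mat n m"
  shows "vec_subspace m {v \<in> carrier_vec m. A *\<^sub>v v = 0\<^sub>v n}"
  using assms by (auto simp: vec_subspace_def mult_add_distrib_mat_vec[OF assms] mult_mat_vec[OF assms] mult_mat_vec_zero[OF assms])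

lemma vec_subspace_image:
  assumes A: "A \<in> carrier_mat n m"
  shows "vec_subspace n ((\<lambda>v. A *\<^sub>v v) ` carrier_vec m)"
  unfolding vec_subspace_def
proof (intro conjI ballI allI)
  have "0\<^sub>v n = A *\<^sub>v 0\<^sub>v m" using mult_mat_vec_zero[OF A] by simp
  then show "0\<^sub>v n \<in> (*\<^sub>v) A ` carrier_vec m" by (rule image_eqI) simp
next
  fix v w assume "v \<in> (*\<^sub>v) A ` carrier_vec m" "w \<in> (*\<^sub>v) A ` carrier_vec m"
  then obtain v' w' where "v' \<in> carrier_vec m" "w' \<in> carrier_vec m" "v = A *\<^sub>v v'" "w = A *\<^sub>v w'"
    by auto
  then have "v + w = A *\<^sub>v (v' + w')" "v' + w' \<in> carrier_vec m"
    by (auto simp: mult_add_distrib_mat_vec[OF A])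
  then show "v + w \<in> (*\<^sub>v) A ` carrier_vec m" by (rule image_eqI)
next
  fix c v assume "v \<in> (*\<^sub>v) A ` carrier_vec m"
  then obtain v' where "v' \<in> carrier_vec m" "v = A *\<^sub>v v'" by auto
  then have "c \<cdot>\<^sub>v v = A *\<^sub>v (c \<cdot>\<^sub>v v')" "c \<cdot>\<^sub>v v' \<in> carrier_vec m"
    by (auto simp: mult_mat_vec[OF A])
  then show "c \<cdot>\<^sub>v v \<in> (*\<^sub>v) A ` carrier_vec m" by (rule image_eqI)
qed (use A in auto)

text \<open>The vector u = w - P P' w is a nonzero element of \<open>W\<close> killed by P', so it
  can be appended to \<open>P\<close> as a new column; P' then needs one more row that kills
  \<open>P\<close> and sends u to 1.\<close>

lemma extend_partial_retraction:
  assumes W: "vec_subspace n W"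
    and P: "P \<in> carrier_mat n k" and P': "P' \<in> carrier_mat k n" and PP: "P' * P = 1\<^sub>m k"
    and PW: "\<And>v. v \<in> carrier_vec k \<Longrightarrow> P *\<^sub>v v \<in> W"
    and w: "w \<in> W" "P *\<^sub>v (P' *\<^sub>v w) \<noteq> w"
  obtains R R' where "R \<in> carrier_mat n (Suc k)" "R' \<in> carrier_mat (Suc k) n"
    "R' * R = 1\<^sub>m (Suc k)" "\<And>v. v \<in> carrier_vec (Suc k) \<Longrightarrow> R *\<^sub>v v \<in> W"
proof -
  have wn: "w \<in> carrier_vec n" using W w by (auto simp: vec_subspace_def)
  define u where "u = w + (-1) \<cdot>\<^sub>v (P *\<^sub>v (P' *\<^sub>v w))"
  have un: "u \<in> carrier_vec n" using wn P P' by (auto simp: u_def)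
  have uW: "u \<in> W" using W w PW P' wn by (auto simp: u_def vec_subspace_def)
  have "u \<noteq> 0\<^sub>v n"
  proof
    assume "u = 0\<^sub>v n"
    have "P *\<^sub>v (P' *\<^sub>v w) = w"
    proof (rule eq_vecI)
      fix i assume i: "i < dim_vec w"
      have "u $ i = 0" using \<open>u = 0\<^sub>v n\<close> i wn by simp
      then show "(P *\<^sub>v (P' *\<^sub>v w)) $ i = w $ i"
        using i wn P by (simp add: u_def)
    qed (use P wn in auto)
    with w show False by simp
  qed
  then obtain i where i: "i < n" "u $ i \<noteq> 0" using un by (metis eq_vecI carrier_vecD index_zero_vec)
  have P'u: "P' *\<^sub>v u = 0\<^sub>v k"
  proof -
    have "P' *\<^sub>v (P *\<^sub>v (P' *\<^sub>v w)) = P' *\<^sub>v w"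
      using retraction_mult_vec[OF P P' PP] P' wn by auto
    then show ?thesis using wn P P'
      by (auto simp: u_def mult_add_distrib_mat_vec[OF P' wn] mult_mat_vec[OF P'])
  qed
  define F where "F = P * P'"
  have F: "F \<in> carrier_mat n n" using P P' by (simp add: F_def)
  \<comment> \<open>Row i of the complementary projection 1 - F, scaled by a nonzero entry of u: it
    kills \<open>P\<close> because F P = P, and maps u to 1 because F u = 0.\<close>
  define r where "r = (\<lambda>j. (1\<^sub>m n $$ (i, j) - F $$ (i, j)) / u $ i)"
  have FP: "F * P = P" using P P' PP by (simp add: F_def assoc_mult_mat[OF P P' P])
  have Fu: "F *\<^sub>v u = 0\<^sub>v n" using P P' P'u un by (simp add: F_def mult_mat_vec_zero[OF P])
  have rP: "(\<Sum>l = 0..<n. r l * P $$ (l, j)) = 0" if j: "j < k" for j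
  proof -
    have "(\<Sum>l = 0..<n. r l * P $$ (l, j)) =
        ((\<Sum>l = 0..<n. 1\<^sub>m n $$ (i, l) * P $$ (l, j)) - (\<Sum>l = 0..<n. F $$ (i, l) * P $$ (l, j))) / u $ i"
      by (simp add: r_def sum_subtractf[symmetric] sum_divide_distrib algebra_simps)
    also have "(\<Sum>l = 0..<n. F $$ (i, l) * P $$ (l, j)) = (F * P) $$ (i, j)"
      using F P i j by (simp add: scalar_prod_def)
    also have "(\<Sum>l = 0..<n. 1\<^sub>m n $$ (i, l) * P $$ (l, j)) = (\<Sum>l = 0..<n. if l = i then P $$ (l, j) else 0)"
      using i by (intro sum.cong) auto
    also have "\<dots> = P $$ (i, j)" using i by simp
    finally show ?thesis using FP by simp
  qed
  have ru: "(\<Sum>l = 0..<n. r l * u $ l) = 1"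
  proof -
    have "(\<Sum>l = 0..<n. r l * u $ l) =
        ((\<Sum>l = 0..<n. 1\<^sub>m n $$ (i, l) * u $ l) - (\<Sum>l = 0..<n. F $$ (i, l) * u $ l)) / u $ i"
      by (simp add: r_def sum_subtractf[symmetric] sum_divide_distrib algebra_simps)
    also have "(\<Sum>l = 0..<n. F $$ (i, l) * u $ l) = (F *\<^sub>v u) $ i"
      using F un i by (simp add: scalar_prod_def)
    also have "(\<Sum>l = 0..<n. 1\<^sub>m n $$ (i, l) * u $ l) = (\<Sum>l = 0..<n. if l = i then u $ l else 0)"
      using i by (intro sum.cong) auto
    also have "\<dots> = u $ i" using i by simp
    finally show ?thesis using Fu i by simp
  qed
  define R where "R = mat n (Suc k) (\<lambda>(a, b). if b < k then P $$ (a, b) else u $ a)"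
  define R' where "R' = mat (Suc k) n (\<lambda>(a, b). if a < k then P' $$ (a, b) else r b)"
  have RR: "R \<in> carrier_mat n (Suc k)" "R' \<in> carrier_mat (Suc k) n" by (simp_all add: R_def R'_def)
  have "R' * R = 1\<^sub>m (Suc k)"
  proof (rule eq_matI)
    fix a b assume "a < dim_row (1\<^sub>m (Suc k) :: complex mat)" "b < dim_col (1\<^sub>m (Suc k) :: complex mat)"
    then have ab: "a < Suc k" "b < Suc k" by auto
    have e: "(R' * R) $$ (a, b) = (\<Sum>l = 0..<n. R' $$ (a, l) * R $$ (l, b))"
      using ab RR by (simp add: scalar_prod_def)
    consider "a < k" "b < k" | "a < k" "b = k" | "a = k" "b < k" | "a = k" "b = k"
      using ab by linarith
    then show "(R' * R) $$ (a, b) = 1\<^sub>m (Suc k) $$ (a, b)"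
    proof cases
      case 1
      then have "(\<Sum>l = 0..<n. R' $$ (a, l) * R $$ (l, b)) = (P' * P) $$ (a, b)"
        using P P' by (simp add: R_def R'_def scalar_prod_def)
      then show ?thesis using e 1 PP by simp
    next
      case 2
      then have "(\<Sum>l = 0..<n. R' $$ (a, l) * R $$ (l, b)) = (P' *\<^sub>v u) $ a"
        using P P' un by (simp add: R_def R'_def scalar_prod_def)
      then show ?thesis using e 2 P'u by simp
    next
      case 3
      then show ?thesis using e rP[of b] by (simp add: R_def R'_def)
    next
      case 4
      then show ?thesis using e ru by (simp add: R_def R'_def)
    qed
  qed (use RR in auto)
  moreover have "R *\<^sub>v v \<in> W" if v: "v \<in> carrier_vec (Suc k)" for v
  proof -
    define v' where "v' = vec k (\<lambda>i. v $ i)"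
    have v': "v' \<in> carrier_vec k" by (simp add: v'_def)
    have "R *\<^sub>v v = P *\<^sub>v v' + v $ k \<cdot>\<^sub>v u"
    proof (rule eq_vecI)
      fix j assume "j < dim_vec (P *\<^sub>v v' + v $ k \<cdot>\<^sub>v u)"
      then have j: "j < n" using un by simp
      have "(R *\<^sub>v v) $ j = (\<Sum>l = 0..<Suc k. R $$ (j, l) * v $ l)"
        using j v RR by (simp add: scalar_prod_def del: sum.op_ivl_Suc)
      also have "\<dots> = (\<Sum>l = 0..<k. P $$ (j, l) * v $ l) + v $ k * u $ j"
        using j by (simp add: R_def)
      finally show "(R *\<^sub>v v) $ j = (P *\<^sub>v v' + v $ k \<cdot>\<^sub>v u) $ j"
        using j P un by (simp add: v'_def scalar_prod_def)
    qed (use RR un P in auto)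
    then show ?thesis using PW[OF v'] uW W by (simp add: vec_subspace_def)
  qed
  ultimately show ?thesis by (intro that[OF RR])
qed

text \<open>The columns of \<open>P\<close> form a basis of \<open>W\<close> and P' reads off
  coordinates. A system with the largest possible number of columns already spans \<open>W\<close>,
  since otherwise \<open>extend_partial_retraction\<close> would enlarge it.\<close>

lemma vec_subspace_retraction:
  assumes W: "vec_subspace n W"
  shows "\<exists>k P P'. P \<in> carrier_mat n k \<and> P' \<in> carrier_mat k n \<and> P' * P = 1\<^sub>m k \<and>
    (\<forall>v\<in>carrier_vec k. P *\<^sub>v v \<in> W) \<and> (\<forall>w\<in>W. P *\<^sub>v (P' *\<^sub>v w) = w)"
proof -
  define ok where "ok = (\<lambda>k. \<exists>P P'. P \<in> carrier_mat n k \<and> P' \<in> carrier_mat k n \<and> P' * P = 1\<^sub>m k \<and>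
     (\<forall>v\<in>carrier_vec k. P *\<^sub>v v \<in> W))"
  have "ok 0"
    unfolding ok_def
  proof (intro exI conjI ballI)
    show "0\<^sub>m n 0 \<in> carrier_mat n 0" "0\<^sub>m 0 n \<in> carrier_mat 0 n" by auto
    show "0\<^sub>m 0 n * 0\<^sub>m n 0 = (1\<^sub>m 0 :: complex mat)" by auto
    fix v :: "complex vec" assume "v \<in> carrier_vec 0"
    then have "0\<^sub>m n 0 *\<^sub>v v = 0\<^sub>v n" by (intro eq_vecI) (auto simp: scalar_prod_def)
    then show "0\<^sub>m n 0 *\<^sub>v v \<in> W" using W by (simp add: vec_subspace_def)
  qed
  moreover have bound: "k \<le> n" if "ok k" for k
    using that left_inverse_dim_le unfolding ok_def by blast
  ultimately obtain k where k: "ok k" and max: "\<And>j. ok j \<Longrightarrow> j \<le> k"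
    using Nat.ex_has_greatest_nat[of ok 0 n] by blast
  then obtain P P' where P: "P \<in> carrier_mat n k" "P' \<in> carrier_mat k n" "P' * P = 1\<^sub>m k"
    "\<And>v. v \<in> carrier_vec k \<Longrightarrow> P *\<^sub>v v \<in> W" unfolding ok_def by blast
  have "P *\<^sub>v (P' *\<^sub>v w) = w" if w: "w \<in> W" for w
  proof (rule ccontr)
    assume "P *\<^sub>v (P' *\<^sub>v w) \<noteq> w"
    then have "ok (Suc k)"
      using extend_partial_retraction[OF W P w] unfolding ok_def by metis
    then show False using max by fastforce
  qed
  with P show ?thesis by blast
qed

text \<open>The image of the projection E = 1 - P P' is a linear complement of \<open>W\<close>, and
  a basis of it completes the one of \<open>W\<close>. The \<open>Q\<close> so obtained gives
  coordinates on the quotient by \<open>W\<close>.\<close>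

lemma vec_subspace_splitting:
  assumes W: "vec_subspace n W"
  shows "\<exists>k j P P' Q Q'. P \<in> carrier_mat n k \<and> P' \<in> carrier_mat k n \<and>
    Q \<in> carrier_mat j n \<and> Q' \<in> carrier_mat n j \<and>
    P' * P = 1\<^sub>m k \<and> Q * Q' = 1\<^sub>m j \<and> P * P' + Q' * Q = 1\<^sub>m n \<and>
    (\<forall>v\<in>carrier_vec k. P *\<^sub>v v \<in> W) \<and> (\<forall>w\<in>W. P *\<^sub>v (P' *\<^sub>v w) = w) \<and> (\<forall>w\<in>W. Q *\<^sub>v w = 0\<^sub>v j)"
proof -
  obtain k P P' where P: "P \<in> carrier_mat n k" and P': "P' \<in> carrier_mat k n" and PP: "P' * P = 1\<^sub>m k"
    and PW: "\<And>v. v \<in> carrier_vec k \<Longrightarrow> P *\<^sub>v v \<in> W" "\<And>w. w \<in> W \<Longrightarrow> P *\<^sub>v (P' *\<^sub>v w) = w"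
    using vec_subspace_retraction[OF W] by blast
  define E where "E = 1\<^sub>m n - P * P'"
  have E: "E \<in> carrier_mat n n" using P P' by (simp add: E_def minus_carrier_mat)
  have Ev: "E *\<^sub>v v = v - P *\<^sub>v (P' *\<^sub>v v)" if "v \<in> carrier_vec n" for v
    using that P P' by (simp add: E_def minus_mult_distrib_mat_vec[of _ n n])
  have PPE: "P' *\<^sub>v (E *\<^sub>v v) = 0\<^sub>v k" if v: "v \<in> carrier_vec n" for v
  proof -
    have "P' *\<^sub>v (P *\<^sub>v (P' *\<^sub>v v)) = P' *\<^sub>v v"
      using retraction_mult_vec[OF P P' PP] P' v by auto
    then show ?thesis using v P P' by (simp add: Ev mult_minus_distrib_mat_vec[OF P' v])
  qed
  have EE: "E *\<^sub>v (E *\<^sub>v v) = E *\<^sub>v v" if v: "v \<in> carrier_vec n" for v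
  proof -
    have "E *\<^sub>v v \<in> carrier_vec n" using E by (meson mult_mat_vec_carrier v)
    then have "E *\<^sub>v (E *\<^sub>v v) = E *\<^sub>v v - P *\<^sub>v 0\<^sub>v k" using Ev PPE[OF v] by simp
    also have "\<dots> = E *\<^sub>v v" using E P v by (simp add: mult_mat_vec_zero[OF P])
    finally show ?thesis .
  qed
  define U where "U = (\<lambda>v. E *\<^sub>v v) ` carrier_vec n"
  have "vec_subspace n U" unfolding U_def by (rule vec_subspace_image[OF E])
  from vec_subspace_retraction[OF this]
  obtain j Q' Q0 where Q': "Q' \<in> carrier_mat n j" and Q0: "Q0 \<in> carrier_mat j n" and QQ: "Q0 * Q' = 1\<^sub>m j"
    and QU: "\<And>v. v \<in> carrier_vec j \<Longrightarrow> Q' *\<^sub>v v \<in> U" "\<And>w. w \<in> U \<Longrightarrow> Q' *\<^sub>v (Q0 *\<^sub>v w) = w"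
    by blast
  \<comment> \<open>\<open>Q0\<close> inverts Q' on the complement but may be nonzero on
    \<open>W\<close>; composing with the projection \<open>E\<close> makes it vanish there.\<close>
  define Q where "Q = Q0 * E"
  have Q: "Q \<in> carrier_mat j n" using Q0 E by (simp add: Q_def)
  have EQ: "E * Q' = Q'"
  proof (rule eq_matI_mult_vec)
    fix v :: "complex vec" assume v: "v \<in> carrier_vec j"
    then obtain u where "u \<in> carrier_vec n" "Q' *\<^sub>v v = E *\<^sub>v u" using QU(1) by (auto simp: U_def)
    then show "(E * Q') *\<^sub>v v = Q' *\<^sub>v v" using EE E Q' v by simp
  qed (use E Q' in auto)
  have "Q * Q' = 1\<^sub>m j" using EQ QQ Q0 E Q' by (simp add: Q_def)
  moreover have "P * P' + Q' * Q = 1\<^sub>m n"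
  proof -
    have "Q' * Q = E"
    proof (rule eq_matI_mult_vec)
      fix v :: "complex vec" assume v: "v \<in> carrier_vec n"
      then have "Q' *\<^sub>v (Q0 *\<^sub>v (E *\<^sub>v v)) = E *\<^sub>v v" using QU(2) by (auto simp: U_def)
      moreover have "E *\<^sub>v v \<in> carrier_vec n" using E v by auto
      ultimately show "(Q' * Q) *\<^sub>v v = E *\<^sub>v v"
        using v Q' Q0 E Q assoc_mult_mat_vec[OF Q' Q v] assoc_mult_mat_vec[OF Q0 E v] by (simp add: Q_def)
    qed (use E Q Q' in auto)
    moreover have "P * P' + E = 1\<^sub>m n" using P P' by (intro eq_matI) (auto simp: E_def)
    ultimately show ?thesis by simp
  qed
  moreover have "Q *\<^sub>v w = 0\<^sub>v j" if w: "w \<in> W" for w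
  proof -
    have wn: "w \<in> carrier_vec n" using W w by (auto simp: vec_subspace_def)
    have "E *\<^sub>v w = 0\<^sub>v n" using Ev[OF wn] PW(2)[OF w] wn by simp
    then show ?thesis using assoc_mult_mat_vec[OF Q0 E wn] by (simp add: Q_def mult_mat_vec_zero[OF Q0])
  qed
  ultimately show ?thesis using P P' Q Q' PP PW
    by (intro exI[of _ k] exI[of _ j] exI[of _ P] exI[of _ P'] exI[of _ Q] exI[of _ Q'] conjI ballI)
qed

section \<open>Decomposition into irreducible characters\<close>

lemma zero_mat_mult_vec:
  assumes "v \<in> carrier_vec m"
  shows "0\<^sub>m n m *\<^sub>v v = (0\<^sub>v n :: complex vec)"
  using assms by (intro eq_vecI) (auto simp: scalar_prod_def)

text \<open>Traces only see the diagonal blocks, so a block triangular form suffices and no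
  invariant complement is needed.\<close>

lemma is_rep_split:
  assumes rep: "is_rep G H n \<rho>"
    and one: "\<one>\<^bsub>G\<^esub> \<in> H" and closed: "\<And>g h. g \<in> H \<Longrightarrow> h \<in> H \<Longrightarrow> g \<otimes>\<^bsub>G\<^esub> h \<in> H"
    and W: "vec_subspace n W" "W \<noteq> {0\<^sub>v n}" "W \<noteq> carrier_vec n"
    and inv: "\<And>h w. h \<in> H \<Longrightarrow> w \<in> W \<Longrightarrow> \<rho> h *\<^sub>v w \<in> W"
  shows "\<exists>k j \<alpha> \<delta>. k < n \<and> j < n \<and> is_rep G H k \<alpha> \<and> is_rep G H j \<delta> \<and>
    (\<forall>h\<in>H. mat_trace (\<rho> h) = mat_trace (\<alpha> h) + mat_trace (\<delta> h))"
proof -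
  from vec_subspace_splitting[OF W(1)]
  obtain k j P P' Q Q' where P: "P \<in> carrier_mat n k" and P': "P' \<in> carrier_mat k n"
    and Q: "Q \<in> carrier_mat j n" and Q': "Q' \<in> carrier_mat n j"
    and PP: "P' * P = 1\<^sub>m k" and QQ: "Q * Q' = 1\<^sub>m j" and PQ: "P * P' + Q' * Q = 1\<^sub>m n"
    and PW: "\<And>v. v \<in> carrier_vec k \<Longrightarrow> P *\<^sub>v v \<in> W" and P'W: "\<And>w. w \<in> W \<Longrightarrow> P *\<^sub>v (P' *\<^sub>v w) = w"
    and QW: "\<And>w. w \<in> W \<Longrightarrow> Q *\<^sub>v w = 0\<^sub>v j"
    by blast
  have \<rho>c: "\<rho> h \<in> carrier_mat n n" if "h \<in> H" for h
    using rep that by (auto simp: is_rep_def)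
  have Wn: "W \<subseteq> carrier_vec n" and W0: "0\<^sub>v n \<in> W" using W by (auto simp: vec_subspace_def)
  have QP: "Q * (\<rho> h * P) = 0\<^sub>m j k" if h: "h \<in> H" for h
  proof (rule eq_matI_mult_vec)
    fix v :: "complex vec" assume v: "v \<in> carrier_vec k"
    have hP: "\<rho> h * P \<in> carrier_mat n k" using \<rho>c[OF h] P by simp
    have "(Q * (\<rho> h * P)) *\<^sub>v v = Q *\<^sub>v (\<rho> h *\<^sub>v (P *\<^sub>v v))"
      using assoc_mult_mat_vec[OF Q hP v] assoc_mult_mat_vec[OF \<rho>c[OF h] P v] by simp
    also have "\<dots> = 0\<^sub>v j" using QW inv h PW[OF v] by blast
    finally show "(Q * (\<rho> h * P)) *\<^sub>v v = 0\<^sub>m j k *\<^sub>v v" using v by (simp add: zero_mat_mult_vec)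
  qed (use Q \<rho>c[OF h] P in auto)
  have PPP: "P * (P' * (\<rho> h * P)) = \<rho> h * P" if h: "h \<in> H" for h
  proof (rule eq_matI_mult_vec)
    fix v :: "complex vec" assume v: "v \<in> carrier_vec k"
    have hP: "\<rho> h * P \<in> carrier_mat n k" using \<rho>c[OF h] P by simp
    have "(P * (P' * (\<rho> h * P))) *\<^sub>v v = P *\<^sub>v (P' *\<^sub>v (\<rho> h *\<^sub>v (P *\<^sub>v v)))"
      using assoc_mult_mat_vec[OF P _ v, of "P' * (\<rho> h * P)"] P' hP assoc_mult_mat_vec[OF P' hP v]
        assoc_mult_mat_vec[OF \<rho>c[OF h] P v] by simp
    also have "\<dots> = \<rho> h *\<^sub>v (P *\<^sub>v v)" using P'W inv h PW[OF v] by blast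
    finally show "(P * (P' * (\<rho> h * P))) *\<^sub>v v = (\<rho> h * P) *\<^sub>v v"
      using assoc_mult_mat_vec[OF \<rho>c[OF h] P v] by simp
  qed (use P' \<rho>c[OF h] P in auto)
  \<comment> \<open>Insert 1 = P P' + Q' Q and use that the off-diagonal block
    \<open>Q * (\<rho> h * P)\<close> vanishes. This is why the quotient action below is
    multiplicative.\<close>
  have Qsplit: "Q * \<rho> h * Q' * Q = Q * \<rho> h" if h: "h \<in> H" for h
  proof -
    have Qh: "Q * \<rho> h \<in> carrier_mat j n" using Q \<rho>c[OF h] by simp
    have "Q * \<rho> h = Q * \<rho> h * (P * P' + Q' * Q)" unfolding PQ using right_mult_one_mat[OF Qh] by simp
    also have "\<dots> = Q * \<rho> h * (P * P') + Q * \<rho> h * (Q' * Q)"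
      using Qh P P' Q Q' by (intro mult_add_distrib_mat[of _ j n _ n]) auto
    also have "Q * \<rho> h * (P * P') = Q * \<rho> h * P * P'"
      using Qh P P' by (intro assoc_mult_mat[symmetric, of _ j n _ k _ n]) auto
    also have "Q * \<rho> h * P = Q * (\<rho> h * P)"
      using Q P \<rho>c[OF h] by (intro assoc_mult_mat[of _ j n _ n _ k]) auto
    also have "\<dots> * P' = 0\<^sub>m j n" using QP[OF h] P' by simp
    finally have "Q * \<rho> h = 0\<^sub>m j n + Q * \<rho> h * (Q' * Q)" .
    then show ?thesis using Qh Q Q' by (simp add: assoc_mult_mat[of _ j n _ j _ n])
  qed
  \<comment> \<open>\<open>\<alpha>\<close> is the action on \<open>W\<close> and
    \<open>\<delta>\<close> the action on the quotient by \<open>W\<close>, in the chosen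
    coordinates.\<close>
  define \<alpha> where "\<alpha> = (\<lambda>h. P' * (\<rho> h * P))"
  define \<delta> where "\<delta> = (\<lambda>h. Q * \<rho> h * Q')"
  \<comment> \<open>The dimensions add up because the trace of an identity matrix is its size and
    the complex numbers have characteristic 0.\<close>
  have kj: "k + j = n"
  proof -
    have "complex_of_nat n = mat_trace (P * P' + Q' * Q)" using PQ by simp
    also have "\<dots> = mat_trace (P * P') + mat_trace (Q' * Q)"
      using P P' Q Q' by (intro mat_trace_add[of _ n]) auto
    also have "\<dots> = of_nat (k + j)"
      using mat_trace_comm[OF P P'] mat_trace_comm[OF Q' Q] PP QQ by simp
    finally show ?thesis using of_nat_eq_iff by metis
  qed
  have "k \<noteq> 0"
  proof
    assume "k = 0"
    have "w = 0\<^sub>v n" if w: "w \<in> W" for w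
    proof -
      have "P' *\<^sub>v w \<in> carrier_vec 0" using P' w Wn \<open>k = 0\<close> by auto
      then have "P *\<^sub>v (P' *\<^sub>v w) = 0\<^sub>v n" using P P' \<open>k = 0\<close>
        by (intro eq_vecI) (auto simp: scalar_prod_def)
      then show ?thesis using P'W[OF w] by simp
    qed
    then have "W = {0\<^sub>v n}" using W0 by blast
    then show False using W(2) by simp
  qed
  have "j \<noteq> 0"
  proof
    assume "j = 0"
    have "carrier_vec n \<subseteq> W"
    proof
      fix v :: "complex vec" assume v: "v \<in> carrier_vec n"
      have "Q' * Q = 0\<^sub>m n n" using Q Q' \<open>j = 0\<close> by (intro eq_matI) (auto simp: scalar_prod_def)
      then have "P * P' = 1\<^sub>m n" using PQ P P' by simp
      then have "P *\<^sub>v (P' *\<^sub>v v) = v" using assoc_mult_mat_vec[OF P P' v] v by simp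
      moreover have "P' *\<^sub>v v \<in> carrier_vec k" using P' v by simp
      ultimately show "v \<in> W" using PW by metis
    qed
    then show False using W(3) Wn by simp
  qed
  have rep': "\<rho> \<one>\<^bsub>G\<^esub> = 1\<^sub>m n" "\<And>g h. g \<in> H \<Longrightarrow> h \<in> H \<Longrightarrow> \<rho> (g \<otimes>\<^bsub>G\<^esub> h) = \<rho> g * \<rho> h"
    using rep by (auto simp: is_rep_def)
  have "is_rep G H k \<alpha>"
    unfolding is_rep_def
  proof (intro conjI ballI)
    show "\<alpha> h \<in> carrier_mat k k" if "h \<in> H" for h using P P' \<rho>c[OF that] by (simp add: \<alpha>_def)
    show "\<alpha> \<one>\<^bsub>G\<^esub> = 1\<^sub>m k" using rep' P PP by (simp add: \<alpha>_def)
    fix g h assume g: "g \<in> H" and h: "h \<in> H"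
    have "\<alpha> g * \<alpha> h = (P' * (\<rho> g * P)) * (P' * (\<rho> h * P))" by (simp add: \<alpha>_def)
    also have "\<dots> = P' * (\<rho> g * (P * (P' * (\<rho> h * P))))"
    proof -
      have A: "P' * (\<rho> h * P) \<in> carrier_mat k k" using P P' \<rho>c[OF h] by simp
      have "(P' * (\<rho> g * P)) * (P' * (\<rho> h * P)) = P' * ((\<rho> g * P) * (P' * (\<rho> h * P)))"
        using A P P' \<rho>c[OF g] by (intro assoc_mult_mat[of _ k n _ k _ k]) auto
      also have "(\<rho> g * P) * (P' * (\<rho> h * P)) = \<rho> g * (P * (P' * (\<rho> h * P)))"
        using A P P' \<rho>c[OF g] by (intro assoc_mult_mat[of _ n n _ k _ k]) auto
      finally show ?thesis .
    qed
    also have "\<dots> = P' * (\<rho> g * (\<rho> h * P))" using PPP[OF h] by simp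
    also have "\<rho> g * (\<rho> h * P) = \<rho> g * \<rho> h * P"
      using P \<rho>c[OF g] \<rho>c[OF h] by (intro assoc_mult_mat[symmetric, of _ n n _ n _ k]) auto
    finally show "\<alpha> (g \<otimes>\<^bsub>G\<^esub> h) = \<alpha> g * \<alpha> h" using rep'(2)[OF g h] by (simp add: \<alpha>_def)
  qed
  moreover have "is_rep G H j \<delta>"
    unfolding is_rep_def
  proof (intro conjI ballI)
    show "\<delta> h \<in> carrier_mat j j" if "h \<in> H" for h using Q Q' \<rho>c[OF that] by (simp add: \<delta>_def)
    show "\<delta> \<one>\<^bsub>G\<^esub> = 1\<^sub>m j" using rep' Q QQ by (simp add: \<delta>_def)
    fix g h assume g: "g \<in> H" and h: "h \<in> H"
    have "\<delta> g * \<delta> h = (Q * \<rho> g * Q') * (Q * (\<rho> h * Q'))"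
      using Q Q' \<rho>c[OF h] by (simp add: \<delta>_def assoc_mult_mat[of _ j n _ n _ j])
    also have "\<dots> = (Q * \<rho> g * Q' * Q) * (\<rho> h * Q')"
      using Q Q' \<rho>c[OF g] \<rho>c[OF h] by (intro assoc_mult_mat[symmetric, of _ j j _ n _ j]) auto
    also have "\<dots> = Q * \<rho> g * (\<rho> h * Q')" using Qsplit[OF g] by simp
    also have "\<dots> = Q * \<rho> g * \<rho> h * Q'"
      using Q Q' \<rho>c[OF g] \<rho>c[OF h] by (intro assoc_mult_mat[symmetric, of _ j n _ n _ j]) auto
    also have "Q * \<rho> g * \<rho> h = Q * (\<rho> g * \<rho> h)"
      using Q Q' \<rho>c[OF g] \<rho>c[OF h] by (intro assoc_mult_mat[of _ j n _ n _ n]) auto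
    finally show "\<delta> (g \<otimes>\<^bsub>G\<^esub> h) = \<delta> g * \<delta> h" using rep'(2)[OF g h] by (simp add: \<delta>_def)
  qed
  moreover have "mat_trace (\<rho> h) = mat_trace (\<alpha> h) + mat_trace (\<delta> h)" if h: "h \<in> H" for h
  proof -
    note R = \<rho>c[OF h]
    have "\<rho> h = \<rho> h * (P * P' + Q' * Q)" unfolding PQ using right_mult_one_mat[OF R] by simp
    also have "\<dots> = \<rho> h * (P * P') + \<rho> h * (Q' * Q)"
      using R P P' Q Q' by (intro mult_add_distrib_mat[of _ n n _ n]) auto
    finally have "mat_trace (\<rho> h) = mat_trace (\<rho> h * (P * P') + \<rho> h * (Q' * Q))" by simp
    also have "\<dots> = mat_trace (\<rho> h * (P * P')) + mat_trace (\<rho> h * (Q' * Q))"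
      using R P P' Q Q' by (intro mat_trace_add[of _ n]) auto
    also have "\<rho> h * (P * P') = (\<rho> h * P) * P'"
      using R P P' by (intro assoc_mult_mat[symmetric, of _ n n _ k _ n]) auto
    also have "mat_trace ((\<rho> h * P) * P') = mat_trace (\<alpha> h)"
      unfolding \<alpha>_def using R P P' by (intro mat_trace_comm[of _ n k]) auto
    also have "\<rho> h * (Q' * Q) = (\<rho> h * Q') * Q"
      using R Q Q' by (intro assoc_mult_mat[symmetric, of _ n n _ j _ n]) auto
    also have "mat_trace ((\<rho> h * Q') * Q) = mat_trace (Q * (\<rho> h * Q'))"
      using R Q Q' by (intro mat_trace_comm[of _ n j]) auto
    also have "Q * (\<rho> h * Q') = \<delta> h"
      unfolding \<delta>_def using R Q Q' by (intro assoc_mult_mat[symmetric, of _ j n _ n _ j]) auto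
    finally show ?thesis .
  qed
  moreover have "k < n" "j < n" using kj \<open>k \<noteq> 0\<close> \<open>j \<noteq> 0\<close> by auto
  ultimately show ?thesis
    by (intro exI[of _ k] exI[of _ j] exI[of _ \<alpha>] exI[of _ \<delta>]) simp
qed

text \<open>Strong induction on the degree, splitting off an invariant subspace. Constituents are
  collected in a list because finiteness of \<open>Irr G\<close> is only derived later, from this
  lemma applied to the regular character.\<close>

lemma (in group) affords_sum_Irr:
  assumes "affords G (carrier G) n \<rho> \<chi>"
  shows "\<exists>xs. set xs \<subseteq> Irr G \<and> \<chi> = (\<lambda>g. \<Sum>\<psi>\<leftarrow>xs. \<psi> g)"
  using assms
proof (induction n arbitrary: \<rho> \<chi> rule: less_induct)
  case (less n)
  have rep: "is_rep G (carrier G) n \<rho>" and \<chi>: "\<And>g. \<chi> g = (if g \<in> carrier G then mat_trace (\<rho> g) else 0)"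
    using less.prems by (auto simp: affords_def)
  consider "n = 0" | "irreducible_rep G (carrier G) n \<rho>" | "n > 0" "\<not> irreducible_rep G (carrier G) n \<rho>"
    by auto
  then show ?case
  proof cases
    case 1
    have "\<chi> g = 0" for g
    proof (cases "g \<in> carrier G")
      case True
      then have "\<rho> g \<in> carrier_mat 0 0" using rep 1 by (auto simp: is_rep_def)
      then show ?thesis using \<chi> by (auto simp: mat_trace_def)
    qed (use \<chi> in auto)
    then show ?thesis by (intro exI[of _ "[]"]) auto
  next
    case 2
    then have "\<chi> \<in> Irr G" using less.prems by (auto simp: Irr_def)
    then show ?thesis by (intro exI[of _ "[\<chi>]"]) auto
  next
    case 3
    then obtain W where W: "W \<subseteq> carrier_vec n \<and> 0\<^sub>v n \<in> W \<and>
          (\<forall>v\<in>W. \<forall>w\<in>W. v + w \<in> W) \<and> (\<forall>c. \<forall>v\<in>W. c \<cdot>\<^sub>v v \<in> W) \<and>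
          (\<forall>h\<in>carrier G. \<forall>v\<in>W. \<rho> h *\<^sub>v v \<in> W)" "W \<noteq> {0\<^sub>v n}" "W \<noteq> carrier_vec n"
      using rep unfolding irreducible_rep_def by blast
    then have "vec_subspace n W" by (simp add: vec_subspace_def)
    then obtain k j \<alpha> \<delta> where kj: "k < n" "j < n" and reps: "is_rep G (carrier G) k \<alpha>" "is_rep G (carrier G) j \<delta>"
      and tr: "\<forall>h\<in>carrier G. mat_trace (\<rho> h) = mat_trace (\<alpha> h) + mat_trace (\<delta> h)"
      using is_rep_split[OF rep one_closed m_closed _ W(2,3)] W(1) by blast
    obtain xs where xs: "set xs \<subseteq> Irr G"
      "(\<lambda>g. if g \<in> carrier G then mat_trace (\<alpha> g) else 0) = (\<lambda>g. \<Sum>\<psi>\<leftarrow>xs. \<psi> g)"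
      using less.IH[OF kj(1), of \<alpha> "\<lambda>g. if g \<in> carrier G then mat_trace (\<alpha> g) else 0"] reps
      by (auto simp: affords_def)
    obtain ys where ys: "set ys \<subseteq> Irr G"
      "(\<lambda>g. if g \<in> carrier G then mat_trace (\<delta> g) else 0) = (\<lambda>g. \<Sum>\<psi>\<leftarrow>ys. \<psi> g)"
      using less.IH[OF kj(2), of \<delta> "\<lambda>g. if g \<in> carrier G then mat_trace (\<delta> g) else 0"] reps
      by (auto simp: affords_def)
    have "\<chi> g = (\<Sum>\<psi>\<leftarrow>xs @ ys. \<psi> g)" for g
      using fun_cong[OF xs(2), of g] fun_cong[OF ys(2), of g] tr \<chi>[of g] by (auto split: if_splits)
    then show ?thesis using xs(1) ys(1) by (intro exI[of _ "xs @ ys"]) auto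
  qed
qed

section \<open>Schur's lemma and orthogonality\<close>

lemma irreducible_rep_subspace:
  assumes "irreducible_rep G H n \<rho>" "vec_subspace n W"
    "\<And>h w. h \<in> H \<Longrightarrow> w \<in> W \<Longrightarrow> \<rho> h *\<^sub>v w \<in> W"
  shows "W = {0\<^sub>v n} \<or> W = carrier_vec n"
  using assms unfolding irreducible_rep_def vec_subspace_def by blast

text \<open>Schur's lemma: the kernel and the image of \<open>X\<close> are invariant, so
  irreducibility makes \<open>X\<close> injective and surjective. The columns of the inverse are
  preimages of the unit vectors.\<close>

lemma intertwiner_invertible:
  assumes \<rho>: "irreducible_rep G H n \<rho>" and \<sigma>: "irreducible_rep G H m \<sigma>"
    and X: "X \<in> carrier_mat n m" "X \<noteq> 0\<^sub>m n m"
    and comm: "\<And>h. h \<in> H \<Longrightarrow> \<rho> h * X = X * \<sigma> h"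
  shows "\<exists>Y\<in>carrier_mat m n. X * Y = 1\<^sub>m n \<and> Y * X = 1\<^sub>m m"
proof -
  have \<rho>c: "\<rho> h \<in> carrier_mat n n" and \<sigma>c: "\<sigma> h \<in> carrier_mat m m" if "h \<in> H" for h
    using \<rho> \<sigma> that by (auto simp: irreducible_rep_def is_rep_def)
  have commv: "\<rho> h *\<^sub>v (X *\<^sub>v v) = X *\<^sub>v (\<sigma> h *\<^sub>v v)" if "h \<in> H" "v \<in> carrier_vec m" for h v
    using assoc_mult_mat_vec[OF \<rho>c X(1)] assoc_mult_mat_vec[OF X(1) \<sigma>c] comm that by metis
  define K where "K = {v \<in> carrier_vec m. X *\<^sub>v v = 0\<^sub>v n}"
  have "K = {0\<^sub>v m} \<or> K = carrier_vec m"
  proof (rule irreducible_rep_subspace[OF \<sigma>])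
    show "vec_subspace m K" unfolding K_def by (rule vec_subspace_kernel[OF X(1)])
    fix h w assume h: "h \<in> H" and w: "w \<in> K"
    then have "X *\<^sub>v (\<sigma> h *\<^sub>v w) = 0\<^sub>v n"
      using commv[OF h, of w] mult_mat_vec_zero[OF \<rho>c[OF h]] by (simp add: K_def)
    then show "\<sigma> h *\<^sub>v w \<in> K" using \<sigma>c[OF h] w by (simp add: K_def)
  qed
  moreover have "K \<noteq> carrier_vec m"
  proof
    assume K: "K = carrier_vec m"
    have "X = 0\<^sub>m n m"
    proof (rule eq_matI_mult_vec[OF X(1)])
      fix v :: "complex vec" assume v: "v \<in> carrier_vec m"
      then have "v \<in> K" using K by simp
      then show "X *\<^sub>v v = 0\<^sub>m n m *\<^sub>v v" using v by (simp add: zero_mat_mult_vec K_def)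
    qed simp
    with X show False by simp
  qed
  ultimately have K0: "K = {0\<^sub>v m}" by simp
  define U where "U = (\<lambda>v. X *\<^sub>v v) ` carrier_vec m"
  have "U = {0\<^sub>v n} \<or> U = carrier_vec n"
  proof (rule irreducible_rep_subspace[OF \<rho>])
    show "vec_subspace n U" unfolding U_def by (rule vec_subspace_image[OF X(1)])
    fix h w assume h: "h \<in> H" and w: "w \<in> U"
    then obtain v where v: "v \<in> carrier_vec m" "w = X *\<^sub>v v" by (auto simp: U_def)
    then have "\<rho> h *\<^sub>v w = X *\<^sub>v (\<sigma> h *\<^sub>v v)" using commv h by simp
    moreover have "\<sigma> h *\<^sub>v v \<in> carrier_vec m" using \<sigma>c[OF h] v by simp
    ultimately show "\<rho> h *\<^sub>v w \<in> U" unfolding U_def by (rule image_eqI)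
  qed
  moreover have "U \<noteq> {0\<^sub>v n}"
  proof
    assume U: "U = {0\<^sub>v n}"
    have "X = 0\<^sub>m n m"
    proof (rule eq_matI_mult_vec[OF X(1)])
      fix v :: "complex vec" assume v: "v \<in> carrier_vec m"
      then have "X *\<^sub>v v \<in> U" by (simp add: U_def)
      then show "X *\<^sub>v v = 0\<^sub>m n m *\<^sub>v v" using v U by (simp add: zero_mat_mult_vec)
    qed simp
    with X show False by simp
  qed
  ultimately have U: "U = carrier_vec n" by simp
  have "\<exists>y\<in>carrier_vec m. X *\<^sub>v y = unit_vec n i" if "i < n" for i
  proof -
    have "unit_vec n i \<in> U" using U by simp
    then show ?thesis unfolding U_def by force
  qed
  then obtain y where y: "\<And>i. i < n \<Longrightarrow> y i \<in> carrier_vec m" "\<And>i. i < n \<Longrightarrow> X *\<^sub>v y i = unit_vec n i"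
    by metis
  define Y where "Y = mat m n (\<lambda>(a, b). y b $ a)"
  have Y: "Y \<in> carrier_mat m n" by (simp add: Y_def)
  have XY: "X * Y = 1\<^sub>m n"
  proof (rule eq_matI)
    fix i j assume "i < dim_row (1\<^sub>m n :: complex mat)" "j < dim_col (1\<^sub>m n :: complex mat)"
    then have ij: "i < n" "j < n" by auto
    have "col Y j = y j" using ij y(1)[OF ij(2)] by (intro eq_vecI) (auto simp: Y_def)
    then have "(X * Y) $$ (i, j) = (X *\<^sub>v y j) $ i" using ij X Y by simp
    then show "(X * Y) $$ (i, j) = 1\<^sub>m n $$ (i, j)" using y(2)[OF ij(2)] ij by simp
  qed (use X Y in auto)
  have "Y * X = 1\<^sub>m m"
  proof (rule eq_matI_mult_vec)
    fix v :: "complex vec" assume v: "v \<in> carrier_vec m"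
    have Xv: "X *\<^sub>v v \<in> carrier_vec n" using X v by simp
    define u where "u = Y *\<^sub>v (X *\<^sub>v v) - v"
    have YXv: "Y *\<^sub>v (X *\<^sub>v v) \<in> carrier_vec m" using Y Xv by simp
    have "X *\<^sub>v (Y *\<^sub>v (X *\<^sub>v v)) = X *\<^sub>v v"
      using assoc_mult_mat_vec[OF X(1) Y Xv] XY Xv by simp
    then have "X *\<^sub>v u = 0\<^sub>v n"
      using mult_minus_distrib_mat_vec[OF X(1) YXv v] Xv by (simp add: u_def)
    then have "u \<in> K" using v YXv by (simp add: K_def u_def)
    then have u0: "u = 0\<^sub>v m" using K0 by simp
    have "Y *\<^sub>v (X *\<^sub>v v) = v"
    proof (rule eq_vecI)
      fix i assume i: "i < dim_vec v"
      have "u $ i = 0" using u0 i v by simp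
      then show "(Y *\<^sub>v (X *\<^sub>v v)) $ i = v $ i" using i v YXv unfolding u_def by simp
    qed (use v Y in auto)
    then show "(Y * X) *\<^sub>v v = 1\<^sub>m m *\<^sub>v v" using assoc_mult_mat_vec[OF Y X(1) v] v by simp
  qed (use X Y in auto)
  with XY Y show ?thesis by blast
qed

lemma intertwiner_trace_eq:
  assumes \<rho>: "irreducible_rep G H n \<rho>" and \<sigma>: "irreducible_rep G H m \<sigma>"
    and X: "X \<in> carrier_mat n m" "X \<noteq> 0\<^sub>m n m"
    and comm: "\<And>h. h \<in> H \<Longrightarrow> \<rho> h * X = X * \<sigma> h"
    and h: "h \<in> H"
  shows "mat_trace (\<rho> h) = mat_trace (\<sigma> h)"
proof -
  obtain Y where Y: "Y \<in> carrier_mat m n" and XY: "X * Y = 1\<^sub>m n" and YX: "Y * X = 1\<^sub>m m"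
    using intertwiner_invertible[OF \<rho> \<sigma> X comm] by blast
  have \<rho>c: "\<rho> h \<in> carrier_mat n n" and \<sigma>c: "\<sigma> h \<in> carrier_mat m m"
    using \<rho> \<sigma> h by (auto simp: irreducible_rep_def is_rep_def)
  have "\<rho> h = \<rho> h * (X * Y)" unfolding XY using right_mult_one_mat[OF \<rho>c] by simp
  also have "\<dots> = \<rho> h * X * Y" using \<rho>c X Y by (intro assoc_mult_mat[symmetric, of _ n n _ m _ n]) auto
  also have "\<dots> = X * \<sigma> h * Y" using comm[OF h] by simp
  finally have "mat_trace (\<rho> h) = mat_trace (X * \<sigma> h * Y)" by simp
  also have "\<dots> = mat_trace (Y * (X * \<sigma> h))" using X Y \<sigma>c by (intro mat_trace_comm[of _ n m]) auto
  also have "Y * (X * \<sigma> h) = Y * X * \<sigma> h" using X Y \<sigma>c by (intro assoc_mult_mat[symmetric, of _ m n _ m _ m]) auto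
  also have "\<dots> = \<sigma> h" unfolding YX using \<sigma>c by simp
  finally show ?thesis .
qed

text \<open>An eigenvalue exists over the complex numbers because n > 0; its eigenspace is invariant
  and nonzero, hence the whole space.\<close>

lemma irreducible_rep_commuting_scalar:
  assumes \<rho>: "irreducible_rep G H n \<rho>" and X: "X \<in> carrier_mat n n"
    and comm: "\<And>h. h \<in> H \<Longrightarrow> \<rho> h * X = X * \<rho> h"
  shows "\<exists>c. X = c \<cdot>\<^sub>m 1\<^sub>m n"
proof -
  have n: "n > 0" using \<rho> by (simp add: irreducible_rep_def)
  have \<rho>c: "\<rho> h \<in> carrier_mat n n" if "h \<in> H" for h
    using \<rho> that by (auto simp: irreducible_rep_def is_rep_def)
  obtain c v where "eigenvector X v c"
    using spectrum_non_empty[OF X n] by (auto simp: spectrum_def eigenvalue_def)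
  then have v: "v \<in> carrier_vec n" "v \<noteq> 0\<^sub>v n" "X *\<^sub>v v = c \<cdot>\<^sub>v v"
    using X by (auto simp: eigenvector_def)
  define W where "W = {w \<in> carrier_vec n. X *\<^sub>v w = c \<cdot>\<^sub>v w}"
  have "W = {0\<^sub>v n} \<or> W = carrier_vec n"
  proof (rule irreducible_rep_subspace[OF \<rho>])
    show "vec_subspace n W"
      by (auto simp: vec_subspace_def W_def mult_mat_vec_zero[OF X] mult_mat_vec[OF X]
          mult_add_distrib_mat_vec[OF X] smult_add_distrib_vec[of _ n] smult_smult_assoc mult.commute)
    fix h w assume h: "h \<in> H" and w: "w \<in> W"
    then have wn: "w \<in> carrier_vec n" and Xw: "X *\<^sub>v w = c \<cdot>\<^sub>v w" by (auto simp: W_def)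
    have "X *\<^sub>v (\<rho> h *\<^sub>v w) = \<rho> h *\<^sub>v (X *\<^sub>v w)"
      using assoc_mult_mat_vec[OF X \<rho>c[OF h] wn] assoc_mult_mat_vec[OF \<rho>c[OF h] X wn] comm[OF h] by simp
    also have "\<dots> = c \<cdot>\<^sub>v (\<rho> h *\<^sub>v w)" using Xw mult_mat_vec[OF \<rho>c[OF h] wn] by simp
    finally show "\<rho> h *\<^sub>v w \<in> W" using \<rho>c[OF h] wn by (simp add: W_def)
  qed
  moreover have "v \<in> W" using v by (simp add: W_def)
  ultimately have W: "W = carrier_vec n" using v by auto
  have "X = c \<cdot>\<^sub>m 1\<^sub>m n"
  proof (rule eq_matI_mult_vec[OF X])
    fix w :: "complex vec" assume w: "w \<in> carrier_vec n"
    then have "w \<in> W" using W by simp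
    then have "X *\<^sub>v w = c \<cdot>\<^sub>v w" by (simp add: W_def)
    moreover have "(c \<cdot>\<^sub>m 1\<^sub>m n) *\<^sub>v w = c \<cdot>\<^sub>v w"
    proof (rule eq_vecI)
      fix i assume "i < dim_vec (c \<cdot>\<^sub>v w)"
      then have i: "i < n" using w by simp
      have "((c \<cdot>\<^sub>m 1\<^sub>m n) *\<^sub>v w) $ i = (\<Sum>l = 0..<n. (c \<cdot>\<^sub>m 1\<^sub>m n) $$ (i, l) * w $ l)"
        using i w by (auto simp: scalar_prod_def intro!: sum.cong)
      also have "\<dots> = (\<Sum>l = 0..<n. if l = i then c * w $ l else 0)"
        using i by (intro sum.cong) auto
      also have "\<dots> = (c \<cdot>\<^sub>v w) $ i" using i w by simp
      finally show "((c \<cdot>\<^sub>m 1\<^sub>m n) *\<^sub>v w) $ i = (c \<cdot>\<^sub>v w) $ i" .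
    qed (use w in auto)
    ultimately show "X *\<^sub>v w = (c \<cdot>\<^sub>m 1\<^sub>m n) *\<^sub>v w" by simp
  qed simp
  then show ?thesis by blast
qed

section \<open>Averaging over a finite group and the orthogonality relations\<close>

locale fin_group = group G for G (structure) +
  assumes fin [simp]: "finite (carrier G)"
begin

lemma card_pos: "card (carrier G) > 0"
  using fin one_closed card_gt_0_iff by blast

lemma carrier_nonempty [simp]: "carrier G \<noteq> {}"
  using one_closed by blast

lemma sum_left_translate:
  assumes "h \<in> carrier G"
  shows "(\<Sum>g\<in>carrier G. f (h \<otimes> g)) = (\<Sum>g\<in>carrier G. f g)"
  using assms by (intro sum.reindex_bij_witness[of _ "\<lambda>g. inv h \<otimes> g" "\<lambda>g. h \<otimes> g"])
    (auto simp flip: m_assoc)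

lemma sum_right_translate:
  assumes "h \<in> carrier G"
  shows "(\<Sum>g\<in>carrier G. f (g \<otimes> h)) = (\<Sum>g\<in>carrier G. f g)"
  using assms by (intro sum.reindex_bij_witness[of _ "\<lambda>g. g \<otimes> inv h" "\<lambda>g. g \<otimes> h"])
    (auto simp: m_assoc)

lemma sum_conjugate:
  assumes h: "h \<in> carrier G"
  shows "(\<Sum>g\<in>carrier G. f (h \<otimes> g \<otimes> inv h)) = (\<Sum>g\<in>carrier G. f g)"
  using sum_left_translate[OF h, of "\<lambda>g. f (g \<otimes> inv h)"] sum_right_translate[of "inv h" f] h by simp

text \<open>Using \<open>h (inv g)\<close> in place of the complex conjugate of \<open>h g\<close> makes unitarity of
  representations unnecessary.\<close>

definition cform :: "('a \<Rightarrow> complex) \<Rightarrow> ('a \<Rightarrow> complex) \<Rightarrow> complex" where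
  "cform f h = (\<Sum>g\<in>carrier G. f g * h (inv g)) / of_nat (card (carrier G))"

lemma character_conjugate:
  assumes "is_character G (carrier G) \<chi>" and g: "g \<in> carrier G" and x: "x \<in> carrier G"
  shows "\<chi> (x \<otimes> g \<otimes> inv x) = \<chi> g"
proof -
  obtain n \<rho> where rep: "is_rep G (carrier G) n \<rho>"
    and \<chi>: "\<And>g. \<chi> g = (if g \<in> carrier G then mat_trace (\<rho> g) else 0)"
    using assms(1) by (auto simp: is_character_def affords_def)
  have c: "\<rho> h \<in> carrier_mat n n" if "h \<in> carrier G" for h using rep that by (auto simp: is_rep_def)
  have m: "\<rho> (h \<otimes> k) = \<rho> h * \<rho> k" if "h \<in> carrier G" "k \<in> carrier G" for h k
    using rep that by (auto simp: is_rep_def)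
  have "mat_trace (\<rho> (x \<otimes> g \<otimes> inv x)) = mat_trace (\<rho> (x \<otimes> g) * \<rho> (inv x))" using m g x by simp
  also have "\<dots> = mat_trace (\<rho> (inv x) * \<rho> (x \<otimes> g))" using c g x by (intro mat_trace_comm[of _ n n]) auto
  also have "\<rho> (inv x) * \<rho> (x \<otimes> g) = \<rho> g" using m[of "inv x" "x \<otimes> g"] g x by (simp flip: m_assoc)
  finally show ?thesis using \<chi> g x by simp
qed

lemma Irr_is_character: "\<chi> \<in> Irr G \<Longrightarrow> is_character G (carrier G) \<chi>"
  by (auto simp: Irr_def is_character_def)

text \<open>\<open>M\<close> is the sum of \<rho>(g) E \<sigma>(g^-1) over the group, with E the
  matrix unit at (i, k). Replacing g by h g in the sum moves \<rho>(h) on the left to \<sigma>(h) on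
  the right.\<close>

lemma coefficient_sum_intertwines:
  assumes \<rho>: "is_rep G (carrier G) n \<rho>" and \<sigma>: "is_rep G (carrier G) m \<sigma>"
    and i: "i < n" and k: "k < m" and h: "h \<in> carrier G"
  defines "M \<equiv> mat n m (\<lambda>(a, b). \<Sum>g\<in>carrier G. \<rho> g $$ (a, i) * \<sigma> (inv g) $$ (k, b))"
  shows "\<rho> h * M = M * \<sigma> h"
proof (rule eq_matI)
  have c: "\<rho> g \<in> carrier_mat n n" "\<sigma> g \<in> carrier_mat m m" if "g \<in> carrier G" for g
    using \<rho> \<sigma> that by (auto simp: is_rep_def)
  have mul: "\<rho> (g \<otimes> g') = \<rho> g * \<rho> g'" "\<sigma> (g \<otimes> g') = \<sigma> g * \<sigma> g'"
    if "g \<in> carrier G" "g' \<in> carrier G" for g g'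
    using \<rho> \<sigma> that by (auto simp: is_rep_def)
  have M: "M \<in> carrier_mat n m" by (simp add: M_def)
  fix a b assume "a < dim_row (M * \<sigma> h)" "b < dim_col (M * \<sigma> h)"
  then have ab: "a < n" "b < m" using M c[OF h] by auto
  have "(\<rho> h * M) $$ (a, b) = (\<Sum>l = 0..<n. \<rho> h $$ (a, l) * (\<Sum>g\<in>carrier G. \<rho> g $$ (l, i) * \<sigma> (inv g) $$ (k, b)))"
    using ab c[OF h] M by (auto simp: scalar_prod_def M_def intro!: sum.cong)
  also have "\<dots> = (\<Sum>g\<in>carrier G. (\<Sum>l = 0..<n. \<rho> h $$ (a, l) * \<rho> g $$ (l, i)) * \<sigma> (inv g) $$ (k, b))"
    unfolding sum_distrib_left sum_distrib_right by (subst sum.swap) (simp add: mult.assoc)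
  also have "\<dots> = (\<Sum>g\<in>carrier G. \<rho> (h \<otimes> g) $$ (a, i) * \<sigma> (inv g) $$ (k, b))"
  proof (intro sum.cong refl)
    fix g assume g: "g \<in> carrier G"
    then show "(\<Sum>l = 0..<n. \<rho> h $$ (a, l) * \<rho> g $$ (l, i)) * \<sigma> (inv g) $$ (k, b) =
        \<rho> (h \<otimes> g) $$ (a, i) * \<sigma> (inv g) $$ (k, b)"
      using ab i h c(1)[OF h] c(1)[OF g] by (simp add: mul scalar_prod_def)
  qed
  also have "\<dots> = (\<Sum>g\<in>carrier G. \<rho> (h \<otimes> g) $$ (a, i) * \<sigma> (inv (h \<otimes> g) \<otimes> h) $$ (k, b))"
    using h by (intro sum.cong refl) (simp add: inv_mult_group m_assoc)
  also have "\<dots> = (\<Sum>g\<in>carrier G. \<rho> g $$ (a, i) * \<sigma> (inv g \<otimes> h) $$ (k, b))"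
    using sum_left_translate[OF h, of "\<lambda>g. \<rho> g $$ (a, i) * \<sigma> (inv g \<otimes> h) $$ (k, b)"] by simp
  also have "\<dots> = (\<Sum>g\<in>carrier G. \<rho> g $$ (a, i) * (\<Sum>l = 0..<m. \<sigma> (inv g) $$ (k, l) * \<sigma> h $$ (l, b)))"
  proof (intro sum.cong refl)
    fix g assume g: "g \<in> carrier G"
    then show "\<rho> g $$ (a, i) * \<sigma> (inv g \<otimes> h) $$ (k, b) =
        \<rho> g $$ (a, i) * (\<Sum>l = 0..<m. \<sigma> (inv g) $$ (k, l) * \<sigma> h $$ (l, b))"
      using ab k h c(2)[OF h] c(2)[of "inv g"] by (simp add: mul scalar_prod_def)
  qed
  also have "\<dots> = (\<Sum>l = 0..<m. (\<Sum>g\<in>carrier G. \<rho> g $$ (a, i) * \<sigma> (inv g) $$ (k, l)) * \<sigma> h $$ (l, b))"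
    unfolding sum_distrib_left sum_distrib_right by (subst sum.swap) (simp add: mult.assoc)
  also have "\<dots> = (M * \<sigma> h) $$ (a, b)"
    using ab c[OF h] M by (auto simp: scalar_prod_def M_def intro!: sum.cong)
  finally show "(\<rho> h * M) $$ (a, b) = (M * \<sigma> h) $$ (a, b)" .
qed (use \<rho> \<sigma> h in \<open>auto simp: is_rep_def M_def\<close>)

text \<open>Each innermost sum is the (i, k) entry of the matrix \<open>M\<close> of
  \<open>coefficient_sum_intertwines\<close>, to which Schur's lemma applies.\<close>

lemma cform_trace_expand:
  assumes \<rho>: "affords G (carrier G) n \<rho> \<chi>" and \<sigma>: "affords G (carrier G) m \<sigma> \<psi>"
  shows "(\<Sum>g\<in>carrier G. \<chi> g * \<psi> (inv g)) =
    (\<Sum>i<n. \<Sum>k<m. \<Sum>g\<in>carrier G. \<rho> g $$ (i, i) * \<sigma> (inv g) $$ (k, k))"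
proof -
  have "(\<Sum>g\<in>carrier G. \<chi> g * \<psi> (inv g)) =
     (\<Sum>g\<in>carrier G. (\<Sum>i<n. \<rho> g $$ (i, i)) * (\<Sum>k<m. \<sigma> (inv g) $$ (k, k)))"
  proof (intro sum.cong refl)
    fix g assume g: "g \<in> carrier G"
    then have "\<rho> g \<in> carrier_mat n n" "\<sigma> (inv g) \<in> carrier_mat m m"
      using \<rho> \<sigma> by (auto simp: affords_def is_rep_def)
    then show "\<chi> g * \<psi> (inv g) = (\<Sum>i<n. \<rho> g $$ (i, i)) * (\<Sum>k<m. \<sigma> (inv g) $$ (k, k))"
      using \<rho> \<sigma> g by (simp add: affords_def mat_trace_def)
  qed
  also have "\<dots> = (\<Sum>g\<in>carrier G. \<Sum>i<n. \<Sum>k<m. \<rho> g $$ (i, i) * \<sigma> (inv g) $$ (k, k))"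
    by (simp add: sum_product)
  also have "\<dots> = (\<Sum>i<n. \<Sum>g\<in>carrier G. \<Sum>k<m. \<rho> g $$ (i, i) * \<sigma> (inv g) $$ (k, k))"
    by (rule sum.swap)
  also have "\<dots> = (\<Sum>i<n. \<Sum>k<m. \<Sum>g\<in>carrier G. \<rho> g $$ (i, i) * \<sigma> (inv g) $$ (k, k))"
    by (intro sum.cong refl sum.swap)
  finally show ?thesis .
qed

text \<open>A nonzero averaged matrix unit would be an intertwiner between the two representations
  and force their traces to agree.\<close>

lemma Irr_orthogonal:
  assumes "\<chi> \<in> Irr G" "\<psi> \<in> Irr G" and ne: "\<chi> \<noteq> \<psi>"
  shows "cform \<chi> \<psi> = 0"
proof -
  obtain n \<rho> where \<rho>: "irreducible_rep G (carrier G) n \<rho>" "affords G (carrier G) n \<rho> \<chi>"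
    using assms(1) by (auto simp: Irr_def)
  obtain m \<sigma> where \<sigma>: "irreducible_rep G (carrier G) m \<sigma>" "affords G (carrier G) m \<sigma> \<psi>"
    using assms(2) by (auto simp: Irr_def)
  have reps: "is_rep G (carrier G) n \<rho>" "is_rep G (carrier G) m \<sigma>" using \<rho> \<sigma> by (auto simp: affords_def)
  have "(\<Sum>g\<in>carrier G. \<rho> g $$ (i, i) * \<sigma> (inv g) $$ (k, k)) = 0" if ik: "i < n" "k < m" for i k
  proof -
    define M where "M = mat n m (\<lambda>(a, b). \<Sum>g\<in>carrier G. \<rho> g $$ (a, i) * \<sigma> (inv g) $$ (k, b))"
    have "M = 0\<^sub>m n m"
    proof (rule ccontr)
      assume nz: "M \<noteq> 0\<^sub>m n m"
      have "mat_trace (\<rho> h) = mat_trace (\<sigma> h)" if h: "h \<in> carrier G" for h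
        by (rule intertwiner_trace_eq[OF \<rho>(1) \<sigma>(1) _ nz _ h])
          (use coefficient_sum_intertwines[OF reps ik] in \<open>simp_all add: M_def\<close>)
      then have "\<chi> = \<psi>" using \<rho>(2) \<sigma>(2) by (intro ext) (simp add: affords_def)
      with ne show False by simp
    qed
    then have "M $$ (i, k) = 0" using ik by simp
    then show ?thesis using ik by (simp add: M_def)
  qed
  then show ?thesis unfolding cform_def cform_trace_expand[OF \<rho>(2) \<sigma>(2)] by simp
qed

text \<open>Here the averaged matrix unit is a scalar d, and its trace determines d: cyclicity turns
  each summand into an entry of \<rho>(g^-1) \<rho>(g) = 1, so d n is the group order if i = k and 0
  otherwise.\<close>

lemma Irr_norm_one:
  assumes "\<chi> \<in> Irr G"
  shows "cform \<chi> \<chi> = 1"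
proof -
  obtain n \<rho> where \<rho>: "irreducible_rep G (carrier G) n \<rho>" "affords G (carrier G) n \<rho> \<chi>"
    using assms(1) by (auto simp: Irr_def)
  have rep: "is_rep G (carrier G) n \<rho>" using \<rho> by (auto simp: affords_def)
  have n: "n > 0" using \<rho> by (simp add: irreducible_rep_def)
  have c: "\<rho> g \<in> carrier_mat n n" if "g \<in> carrier G" for g using rep that by (auto simp: is_rep_def)
  have "(\<Sum>g\<in>carrier G. \<rho> g $$ (i, i) * \<rho> (inv g) $$ (k, k)) =
      (if k = i then of_nat (card (carrier G)) / of_nat n else 0)" if ik: "i < n" "k < n" for i k
  proof -
    define M where "M = mat n n (\<lambda>(a, b). \<Sum>g\<in>carrier G. \<rho> g $$ (a, i) * \<rho> (inv g) $$ (k, b))"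
    have "\<exists>d. M = d \<cdot>\<^sub>m 1\<^sub>m n"
      by (rule irreducible_rep_commuting_scalar[OF \<rho>(1)])
        (use coefficient_sum_intertwines[OF rep rep ik] in \<open>simp_all add: M_def\<close>)
    then obtain d where d: "M = d \<cdot>\<^sub>m 1\<^sub>m n" by blast
    have "d * of_nat n = mat_trace M" unfolding d by (simp add: mat_trace_smult[of _ n])
    also have "\<dots> = (\<Sum>a<n. \<Sum>g\<in>carrier G. \<rho> g $$ (a, i) * \<rho> (inv g) $$ (k, a))"
      by (simp add: M_def mat_trace_def)
    also have "\<dots> = (\<Sum>g\<in>carrier G. \<Sum>a<n. \<rho> (inv g) $$ (k, a) * \<rho> g $$ (a, i))"
      by (subst sum.swap) (simp add: mult.commute)
    also have "\<dots> = (\<Sum>g\<in>carrier G. 1\<^sub>m n $$ (k, i))"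
    proof (intro sum.cong refl)
      fix g assume g: "g \<in> carrier G"
      have "(\<Sum>a<n. \<rho> (inv g) $$ (k, a) * \<rho> g $$ (a, i)) = (\<rho> (inv g) * \<rho> g) $$ (k, i)"
        using c[OF g] c[of "inv g"] g ik by (simp add: scalar_prod_def atLeast0LessThan)
      also have "\<rho> (inv g) * \<rho> g = \<rho> (inv g \<otimes> g)" using rep g unfolding is_rep_def by (metis inv_closed)
      also have "inv g \<otimes> g = \<one>" using g by simp
      also have "\<rho> \<one> = 1\<^sub>m n" using rep by (simp add: is_rep_def)
      finally show "(\<Sum>a<n. \<rho> (inv g) $$ (k, a) * \<rho> g $$ (a, i)) = 1\<^sub>m n $$ (k, i)" .
    qed
    finally have dn: "d * of_nat n = (if k = i then of_nat (card (carrier G)) else 0)" using ik by simp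
    have "(\<Sum>g\<in>carrier G. \<rho> g $$ (i, i) * \<rho> (inv g) $$ (k, k)) = M $$ (i, k)" using ik by (simp add: M_def)
    also have "\<dots> = (if k = i then d else 0)" unfolding d using ik by simp
    also have "\<dots> = (if k = i then of_nat (card (carrier G)) / of_nat n else 0)"
      using dn n by (auto simp: field_simps)
    finally show ?thesis .
  qed
  then have "(\<Sum>g\<in>carrier G. \<chi> g * \<chi> (inv g)) =
      (\<Sum>i<n. \<Sum>k<n. if k = i then of_nat (card (carrier G)) / of_nat n else 0)"
    unfolding cform_trace_expand[OF \<rho>(2) \<rho>(2)] by simp
  also have "\<dots> = of_nat (card (carrier G))" using n by simp
  finally show ?thesis unfolding cform_def by simp
qed

lemma Irr_orthonormal:
  assumes "\<chi> \<in> Irr G" "\<psi> \<in> Irr G"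
  shows "cform \<chi> \<psi> = (if \<chi> = \<psi> then 1 else 0)"
  using assms Irr_orthogonal Irr_norm_one by auto

end

section \<open>Linear and induced characters\<close>

lemma (in group) inv_mult_cancel:
  assumes "x \<in> carrier G" "y \<in> carrier G"
  shows "inv x \<otimes> (x \<otimes> y) = y" "x \<otimes> (inv x \<otimes> y) = y"
  using assms by (simp_all flip: m_assoc)

text \<open>The scalar form of \<open>is_linear_character\<close>, with the same convention of
  vanishing outside \<open>H\<close>; \<open>is_linear_character_iff\<close> relates the
  two.\<close>

definition lin_char :: "('a, 'b) monoid_scheme \<Rightarrow> 'a set \<Rightarrow> ('a \<Rightarrow> complex) \<Rightarrow> bool" where
  "lin_char G H \<phi> \<longleftrightarrow> \<phi> \<one>\<^bsub>G\<^esub> = 1 \<and> (\<forall>h\<in>H. \<forall>k\<in>H. \<phi> (h \<otimes>\<^bsub>G\<^esub> k) = \<phi> h * \<phi> k) \<and> (\<forall>g. g \<notin> H \<longrightarrow> \<phi> g = 0)"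

lemma affords_linear:
  assumes "lin_char G H \<phi>"
  shows "affords G H 1 (\<lambda>h. mat 1 1 (\<lambda>_. \<phi> h)) \<phi>"
  unfolding affords_def is_rep_def
proof (intro conjI ballI allI)
  show "mat 1 1 (\<lambda>_. \<phi> \<one>\<^bsub>G\<^esub>) = 1\<^sub>m 1" using assms by (intro eq_matI) (auto simp: lin_char_def)
  show "mat 1 1 (\<lambda>_. \<phi> (h \<otimes>\<^bsub>G\<^esub> k)) = mat 1 1 (\<lambda>_. \<phi> h) * mat 1 1 (\<lambda>_. \<phi> k)" if "h \<in> H" "k \<in> H" for h k
    using assms that by (intro eq_matI) (auto simp: lin_char_def scalar_prod_def)
qed (use assms in \<open>auto simp: lin_char_def mat_trace_def\<close>)

lemma is_linear_character_iff:
  assumes one: "\<one>\<^bsub>G\<^esub> \<in> H" and closed: "\<And>g h. g \<in> H \<Longrightarrow> h \<in> H \<Longrightarrow> g \<otimes>\<^bsub>G\<^esub> h \<in> H"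
  shows "is_linear_character G H \<phi> \<longleftrightarrow> lin_char G H \<phi>"
proof
  assume "is_linear_character G H \<phi>"
  then obtain \<rho> where rep: "is_rep G H 1 \<rho>" and \<phi>: "\<And>g. \<phi> g = (if g \<in> H then mat_trace (\<rho> g) else 0)"
    by (auto simp: is_linear_character_def affords_def)
  have c: "\<rho> h \<in> carrier_mat 1 1" if "h \<in> H" for h using rep that by (auto simp: is_rep_def)
  have \<phi>': "\<phi> h = \<rho> h $$ (0, 0)" if "h \<in> H" for h using \<phi> that c[OF that] by (simp add: mat_trace_def)
  have "\<phi> \<one>\<^bsub>G\<^esub> = 1" using \<phi>'[OF one] rep by (simp add: is_rep_def)
  moreover have "\<phi> (h \<otimes>\<^bsub>G\<^esub> k) = \<phi> h * \<phi> k" if "h \<in> H" "k \<in> H" for h k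
  proof -
    have "\<phi> (h \<otimes>\<^bsub>G\<^esub> k) = (\<rho> h * \<rho> k) $$ (0, 0)"
      using \<phi>'[OF closed[OF that]] rep that by (simp add: is_rep_def)
    also have "\<dots> = \<rho> h $$ (0, 0) * \<rho> k $$ (0, 0)"
      using c[OF that(1)] c[OF that(2)] by (auto simp: scalar_prod_def)
    finally show ?thesis using \<phi>' that by simp
  qed
  ultimately show "lin_char G H \<phi>" using \<phi> by (simp add: lin_char_def)
qed (use affords_linear in \<open>auto simp: is_linear_character_def\<close>)

lemma lin_char_is_character: "lin_char G H \<phi> \<Longrightarrow> is_character G H \<phi>"
  using affords_linear unfolding is_character_def by blast

lemma lin_char_in_Irr:
  assumes "lin_char G (carrier G) \<phi>"
  shows "\<phi> \<in> Irr G"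
proof -
  have "irreducible_rep G (carrier G) 1 (\<lambda>h. mat 1 1 (\<lambda>_. \<phi> h))"
    unfolding irreducible_rep_def
  proof (intro conjI allI impI)
    show "is_rep G (carrier G) 1 (\<lambda>h. mat 1 1 (\<lambda>_. \<phi> h))"
      using affords_linear[OF assms] by (simp add: affords_def)
    fix W :: "complex vec set"
    assume W: "W \<subseteq> carrier_vec 1 \<and> 0\<^sub>v 1 \<in> W \<and> (\<forall>v\<in>W. \<forall>w\<in>W. v + w \<in> W) \<and> (\<forall>c. \<forall>v\<in>W. c \<cdot>\<^sub>v v \<in> W) \<and>
      (\<forall>h\<in>carrier G. \<forall>v\<in>W. mat 1 1 (\<lambda>_. \<phi> h) *\<^sub>v v \<in> W)"
    show "W = {0\<^sub>v 1} \<or> W = carrier_vec 1"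
    proof (rule disjCI)
      assume "W \<noteq> carrier_vec 1"
      then obtain v where v: "v \<in> carrier_vec 1" "v \<notin> W" using W by blast
      have "w = 0\<^sub>v 1" if w: "w \<in> W" for w
      proof (rule ccontr)
        assume "w \<noteq> 0\<^sub>v 1"
        moreover have w1: "w \<in> carrier_vec 1" using W w by blast
        ultimately have "w $ 0 \<noteq> 0" by (metis carrier_vecD eq_vecI index_zero_vec less_one)
        then have "v = (v $ 0 / w $ 0) \<cdot>\<^sub>v w" using v w1 by (intro eq_vecI) auto
        then show False using W w v by metis
      qed
      then show "W = {0\<^sub>v 1}" using W by blast
    qed
  qed simp
  then show ?thesis using affords_linear[OF assms] unfolding Irr_def by blast
qed

text \<open>For h in \<open>H\<close> the elements h y and y lie in \<open>H\<close> together or not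
  at all, so extension by zero keeps this multiplicativity even for y outside \<open>H\<close>.
  Matrices of induced representations have entries at such y.\<close>

lemma (in group) lin_char_mult_left:
  assumes "lin_char G H \<phi>" "subgroup H G" "h \<in> H" "y \<in> carrier G"
  shows "\<phi> (h \<otimes> y) = \<phi> h * \<phi> y"
proof (cases "y \<in> H")
  case False
  then have "h \<otimes> y \<notin> H"
    using assms(2-4) by (metis inv_closed inv_solve_left m_closed subgroup.m_closed subgroup.m_inv_closed subgroup.mem_carrier)
  then show ?thesis using False assms by (auto simp: lin_char_def)
qed (use assms in \<open>auto simp: lin_char_def\<close>)

lemma (in group) lin_char_mult_right:
  assumes "lin_char G H \<phi>" "subgroup H G" "h \<in> H" "y \<in> carrier G"
  shows "\<phi> (y \<otimes> h) = \<phi> y * \<phi> h"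
proof (cases "y \<in> H")
  case False
  then have "y \<otimes> h \<notin> H"
    using assms(2-4) by (metis inv_closed inv_solve_right m_closed subgroup.m_closed subgroup.m_inv_closed subgroup.mem_carrier)
  then show ?thesis using False assms by (auto simp: lin_char_def)
qed (use assms in \<open>auto simp: lin_char_def\<close>)

lemma (in group) lin_char_inv:
  assumes "lin_char G H \<phi>" "subgroup H G" "h \<in> H"
  shows "\<phi> (inv h) * \<phi> h = 1" "\<phi> h * \<phi> (inv h) = 1"
proof -
  have "\<phi> (inv h) * \<phi> h = \<phi> (inv h \<otimes> h)"
    using assms subgroup.m_inv_closed[OF assms(2,3)] by (simp add: lin_char_def)
  also have "\<dots> = 1" using assms subgroup.mem_carrier[OF assms(2,3)] by (simp add: lin_char_def)
  finally show "\<phi> (inv h) * \<phi> h = 1" "\<phi> h * \<phi> (inv h) = 1" by (simp_all add: mult.commute)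
qed

lemma (in group) lin_char_conjugate:
  assumes "lin_char G H \<phi>" "subgroup H G" "h \<in> H" "y \<in> carrier G"
  shows "\<phi> (h \<otimes> y \<otimes> inv h) = \<phi> y"
proof -
  have "\<phi> (h \<otimes> y \<otimes> inv h) = \<phi> h * \<phi> y * \<phi> (inv h)"
    using assms lin_char_mult_right[OF assms(1,2), of "inv h" "h \<otimes> y"] lin_char_mult_left[OF assms]
    by (simp add: subgroup.m_inv_closed subgroup.mem_carrier)
  then show ?thesis using lin_char_inv(2)[OF assms(1-3)] by (simp add: mult.commute mult.left_commute)
qed

text \<open>Representatives are numbered so that they can index rows and columns of a matrix; the
  condition that g t^-1 lies in \<open>H\<close> says that g is in the right coset of t.\<close>

lemma (in group) right_transversal:
  assumes H: "subgroup H G" and fin: "finite (carrier G)"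
  shows "\<exists>(r::nat) t. (\<forall>i<r. t i \<in> carrier G) \<and> 
    (\<forall>g\<in>carrier G. \<exists>i<r. g \<otimes> inv (t i) \<in> H) \<and>
    (\<forall>g\<in>carrier G. \<forall>i<r. \<forall>j<r. g \<otimes> inv (t i) \<in> H \<longrightarrow> g \<otimes> inv (t j) \<in> H \<longrightarrow> i = j)"
proof -
  \<comment> \<open>The choice is applied to the coset, not to the element, so all elements of a
    coset share one representative.\<close>
  define rep where "rep = (\<lambda>g. SOME x. x \<in> H #> g)"
  have rep: "rep g \<in> H #> g" if "g \<in> carrier G" for g
    unfolding rep_def using rcos_self[OF that H] by (rule someI)
  have repc: "rep g \<in> carrier G" if "g \<in> carrier G" for g
    using rep[OF that] r_coset_subset_G[OF subgroup.subset[OF H] that] by blast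
  have coset: "H #> rep g = H #> g" if "g \<in> carrier G" for g
    using repr_independence[OF rep[OF that] that H] by simp
  have mem: "g \<otimes> inv t \<in> H \<longleftrightarrow> H #> g = H #> t" if "g \<in> carrier G" "t \<in> carrier G" for g t
  proof
    assume "g \<otimes> inv t \<in> H"
    then have "g \<in> H #> t" using subgroup.rcos_module[OF H is_group that(2,1)] by simp
    then show "H #> g = H #> t" using repr_independence[OF _ that(2) H] by simp
  next
    assume "H #> g = H #> t"
    then have "g \<in> H #> t" using rcos_self[OF that(1) H] by simp
    then show "g \<otimes> inv t \<in> H" using subgroup.rcos_module[OF H is_group that(2,1)] by simp
  qed
  have "finite (rep ` carrier G)" using fin by simp
  from ex_bij_betw_nat_finite[OF this]
  obtain t where t: "bij_betw t {0..<card (rep ` carrier G)} (rep ` carrier G)" ..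
  define r where "r = card (rep ` carrier G)"
  have t_img: "t i \<in> rep ` carrier G" if "i < r" for i
    using bij_betw_apply[OF t, of i] that by (simp add: r_def)
  have tc: "t i \<in> carrier G" if "i < r" for i
    using t_img[OF that] repc by (elim imageE) simp
  have eq: "(g \<otimes> inv (t i) \<in> H) = (t i = rep g)" if g: "g \<in> carrier G" and i: "i < r" for g i
  proof -
    obtain g' where g': "g' \<in> carrier G" "t i = rep g'"
      using t_img[OF i] by (elim imageE)
    have "(g \<otimes> inv (t i) \<in> H) = (H #> g = H #> t i)" using mem g tc[OF i] by simp
    also have "\<dots> = (H #> g = H #> g')" using g' coset by simp
    also have "\<dots> = (t i = rep g)"
    proof
      assume "H #> g = H #> g'" then show "t i = rep g" using g' by (simp add: rep_def)
    next
      assume "t i = rep g" then show "H #> g = H #> g'" using g' coset g by metis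
    qed
    finally show ?thesis .
  qed
  have "\<exists>i<r. g \<otimes> inv (t i) \<in> H" if g: "g \<in> carrier G" for g
  proof -
    have "rep g \<in> t ` {0..<r}" using t g by (simp add: bij_betw_def r_def)
    then obtain i where "i < r" "t i = rep g" by auto
    then show ?thesis using eq[OF g] by blast
  qed
  moreover have "i = j" if "g \<in> carrier G" "i < r" "j < r" "g \<otimes> inv (t i) \<in> H" "g \<otimes> inv (t j) \<in> H" for g i j
  proof -
    have "t i = t j" using eq that by simp
    then show ?thesis
      using inj_onD[OF bij_betw_imp_inj_on[OF t], of i j] that by (simp add: r_def)
  qed
  ultimately show ?thesis using tc by (intro exI[of _ r] exI[of _ t] conjI) auto
qed

text \<open>The monomial representation: with \<open>\<phi>\<close> zero outside \<open>H\<close>,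
  the matrix with entries \<phi>(t_i g t_j^-1) has exactly one nonzero entry in each row, at the
  coset containing t_i g.\<close>

lemma (in group) Ind_linear_is_character:
  assumes H: "subgroup H G" and fin: "finite (carrier G)" and \<phi>: "lin_char G H \<phi>"
  shows "is_character G (carrier G) (Ind G H \<phi>)"
proof -
  from right_transversal[OF H fin] obtain r :: nat and t where
    tr: "\<forall>i<r. t i \<in> carrier G" "\<forall>g\<in>carrier G. \<exists>i<r. g \<otimes> inv (t i) \<in> H"
      "\<forall>g\<in>carrier G. \<forall>i<r. \<forall>j<r. g \<otimes> inv (t i) \<in> H \<longrightarrow> g \<otimes> inv (t j) \<in> H \<longrightarrow> i = j"
    by (elim exE conjE)
  have t: "t i \<in> carrier G" if "i < r" for i using tr(1) that by simp
  have ex: "\<exists>i<r. g \<otimes> inv (t i) \<in> H" if "g \<in> carrier G" for g using tr(2) that by simp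
  have unique: "i = j" if "g \<in> carrier G" "i < r" "j < r" "g \<otimes> inv (t i) \<in> H" "g \<otimes> inv (t j) \<in> H" for g i j
    using tr(3) that by simp
  have out: "\<phi> g = 0" if "g \<notin> H" for g using \<phi> that by (simp add: lin_char_def)
  have Hc: "h \<in> carrier G" if "h \<in> H" for h using H that by (rule subgroup.mem_carrier)
  define \<rho> where "\<rho> = (\<lambda>g. mat r r (\<lambda>(i, j). \<phi> (t i \<otimes> g \<otimes> inv (t j))))"
  have "is_rep G (carrier G) r \<rho>"
    unfolding is_rep_def
  proof (intro conjI ballI)
    show "\<rho> h \<in> carrier_mat r r" for h by (simp add: \<rho>_def)
    show "\<rho> \<one> = 1\<^sub>m r"
    proof (rule eq_matI)
      fix i j assume "i < dim_row (1\<^sub>m r :: complex mat)" "j < dim_col (1\<^sub>m r :: complex mat)"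
      then have ij: "i < r" "j < r" by auto
      show "\<rho> \<one> $$ (i, j) = 1\<^sub>m r $$ (i, j)"
      proof (cases "i = j")
        case True
        then show ?thesis using ij t \<phi> by (simp add: \<rho>_def lin_char_def)
      next
        case False
        have "t i \<otimes> inv (t i) \<in> H" using t[OF ij(1)] subgroup.one_closed[OF H] by simp
        then have "t i \<otimes> inv (t j) \<notin> H" using unique[OF t[OF ij(1)] ij] False by blast
        then show ?thesis using ij t False by (simp add: \<rho>_def out)
      qed
    qed (auto simp: \<rho>_def)
    fix g h assume g: "g \<in> carrier G" and h: "h \<in> carrier G"
    show "\<rho> (g \<otimes> h) = \<rho> g * \<rho> h"
    proof (rule eq_matI)
      fix i k assume "i < dim_row (\<rho> g * \<rho> h)" "k < dim_col (\<rho> g * \<rho> h)"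
      then have ik: "i < r" "k < r" by (auto simp: \<rho>_def)
      have tg: "t i \<otimes> g \<in> carrier G" using t ik g by simp
      \<comment> \<open>Column j is the only one where row i of \<rho>(g) is nonzero, so the matrix
        product collapses to a single term.\<close>
      obtain j where j: "j < r" "t i \<otimes> g \<otimes> inv (t j) \<in> H" using ex[OF tg] by blast
      then have uniq: "\<And>l. l < r \<Longrightarrow> l \<noteq> j \<Longrightarrow> t i \<otimes> g \<otimes> inv (t l) \<notin> H"
        using unique[OF tg] by blast
      have "(\<rho> g * \<rho> h) $$ (i, k) = (\<Sum>l = 0..<r. \<phi> (t i \<otimes> g \<otimes> inv (t l)) * \<phi> (t l \<otimes> h \<otimes> inv (t k)))"
        using ik by (simp add: \<rho>_def scalar_prod_def)
      also have "\<dots> = (\<Sum>l = 0..<r. if l = j then \<phi> (t i \<otimes> g \<otimes> inv (t j)) * \<phi> (t j \<otimes> h \<otimes> inv (t k)) else 0)"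
        using uniq by (intro sum.cong refl) (auto simp: out)
      also have "\<dots> = \<phi> (t i \<otimes> g \<otimes> inv (t j)) * \<phi> (t j \<otimes> h \<otimes> inv (t k))" using j by simp
      also have "\<dots> = \<phi> ((t i \<otimes> g \<otimes> inv (t j)) \<otimes> (t j \<otimes> h \<otimes> inv (t k)))"
        using lin_char_mult_left[OF \<phi> H j(2)] t[OF j(1)] t[OF ik(2)] h by simp
      also have "(t i \<otimes> g \<otimes> inv (t j)) \<otimes> (t j \<otimes> h \<otimes> inv (t k)) = t i \<otimes> (g \<otimes> h) \<otimes> inv (t k)"
        using t[OF ik(1)] t[OF j(1)] t[OF ik(2)] g h by (simp add: m_assoc inv_mult_cancel)
      finally show "\<rho> (g \<otimes> h) $$ (i, k) = (\<rho> g * \<rho> h) $$ (i, k)" using ik by (simp add: \<rho>_def)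
    qed (auto simp: \<rho>_def)
  qed
  moreover have "Ind G H \<phi> g = mat_trace (\<rho> g)" if g: "g \<in> carrier G" for g
  proof -
    \<comment> \<open>Every x is uniquely h t_i with h in \<open>H\<close>. The summand of
      \<open>Ind\<close> is independent of h, which yields the factor \<open>card H\<close> that its
      normalisation cancels.\<close>
    have bij: "bij_betw (\<lambda>(i, h). h \<otimes> t i) ({..<r} \<times> H) (carrier G)"
      unfolding bij_betw_def
    proof
      have cancel: "h \<otimes> t i \<otimes> inv (t i) = h" if "h \<in> H" "i < r" for h i
        using t[OF that(2)] Hc[OF that(1)] by (simp add: m_assoc)
      show "inj_on (\<lambda>(i, h). h \<otimes> t i) ({..<r} \<times> H)"
      proof (rule inj_onI, clarsimp)
        fix i h j k assume a: "i < r" "h \<in> H" "j < r" "k \<in> H" "h \<otimes> t i = k \<otimes> t j"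
        have "h \<otimes> t i \<in> carrier G" using a t Hc by simp
        moreover have "h \<otimes> t i \<otimes> inv (t i) \<in> H" using cancel[OF a(2,1)] a(2) by simp
        moreover have "h \<otimes> t i \<otimes> inv (t j) \<in> H" unfolding a(5) using cancel[OF a(4,3)] a(4) by simp
        ultimately have "i = j" using unique a by blast
        then show "i = j \<and> h = k" using cancel a by metis
      qed
      show "(\<lambda>(i, h). h \<otimes> t i) ` ({..<r} \<times> H) = carrier G"
      proof
        show "(\<lambda>(i, h). h \<otimes> t i) ` ({..<r} \<times> H) \<subseteq> carrier G" using t Hc by auto
        show "carrier G \<subseteq> (\<lambda>(i, h). h \<otimes> t i) ` ({..<r} \<times> H)"
        proof
          fix x assume x: "x \<in> carrier G"
          then obtain i where i: "i < r" "x \<otimes> inv (t i) \<in> H" using ex by blast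
          then have "x = (x \<otimes> inv (t i)) \<otimes> t i" using x t by (simp add: m_assoc)
          then show "x \<in> (\<lambda>(i, h). h \<otimes> t i) ` ({..<r} \<times> H)"
            using i by (intro image_eqI[of _ _ "(i, x \<otimes> inv (t i))"]) auto
        qed
      qed
    qed
    have "(\<Sum>x\<in>carrier G. \<phi> (x \<otimes> g \<otimes> inv x)) = (\<Sum>(i, h)\<in>{..<r} \<times> H. \<phi> ((h \<otimes> t i) \<otimes> g \<otimes> inv (h \<otimes> t i)))"
      by (subst sum.reindex_bij_betw[OF bij, symmetric]) (simp add: case_prod_unfold)
    also have "\<dots> = (\<Sum>(i, h)\<in>{..<r} \<times> H. \<phi> (t i \<otimes> g \<otimes> inv (t i)))"
    proof (intro sum.cong refl, clarsimp)
      fix i h assume i: "i < r" and h: "h \<in> H"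
      have "(h \<otimes> t i) \<otimes> g \<otimes> inv (h \<otimes> t i) = h \<otimes> (t i \<otimes> g \<otimes> inv (t i)) \<otimes> inv h"
        using t[OF i] Hc[OF h] g by (simp add: m_assoc inv_mult_group)
      then show "\<phi> ((h \<otimes> t i) \<otimes> g \<otimes> inv (h \<otimes> t i)) = \<phi> (t i \<otimes> g \<otimes> inv (t i))"
        using lin_char_conjugate[OF \<phi> H h] t[OF i] g by simp
    qed
    also have "\<dots> = of_nat (card H) * (\<Sum>i<r. \<phi> (t i \<otimes> g \<otimes> inv (t i)))"
      by (simp flip: sum.cartesian_product add: sum_distrib_left)
    also have "(\<Sum>i<r. \<phi> (t i \<otimes> g \<otimes> inv (t i))) = mat_trace (\<rho> g)" by (simp add: \<rho>_def mat_trace_def)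
    finally show ?thesis
      using g subgroup.finite_imp_card_positive[OF H fin] by (simp add: Ind_def)
  qed
  moreover have "Ind G H \<phi> g = 0" if "g \<notin> carrier G" for g using that by (simp add: Ind_def)
  ultimately have "affords G (carrier G) r \<rho> (Ind G H \<phi>)" by (simp add: affords_def)
  then show ?thesis unfolding is_character_def by blast
qed

lemma sum_list_eq_sum_count:
  fixes f :: "'c \<Rightarrow> complex"
  assumes "set xs \<subseteq> A" "finite A"
  shows "(\<Sum>x\<leftarrow>xs. f x) = (\<Sum>x\<in>A. of_nat (count_list xs x) * f x)"
  using assms(1)
proof (induction xs)
  case (Cons y xs)
  have "(\<Sum>x\<in>A. of_nat (count_list (y # xs) x) * f x) =
      (\<Sum>x\<in>A. (if x = y then f x else 0) + of_nat (count_list xs x) * f x)"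
    by (intro sum.cong) (auto simp: algebra_simps)
  then show ?case using Cons assms(2) by (simp add: sum.distrib)
qed simp

section \<open>Multiplicities, the regular character, reciprocity and abelian groups\<close>

context fin_group
begin

lemma cform_add_left: "cform (\<lambda>g. f g + f' g) h = cform f h + cform f' h"
  by (simp add: cform_def sum.distrib ring_distribs add_divide_distrib)

lemma cform_mult_left: "cform (\<lambda>g. c * f g) h = c * cform f h"
  by (simp add: cform_def sum_distrib_left mult.assoc)

lemma cform_mult_right: "cform f (\<lambda>g. c * h g) = c * cform f h"
  by (simp add: cform_def sum_distrib_left mult.left_commute)

lemma cform_sum_left: "cform (\<lambda>g. \<Sum>i\<in>I. f i g) h = (\<Sum>i\<in>I. cform (f i) h)"
  unfolding cform_def sum_divide_distrib[symmetric] sum_distrib_right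
  by (subst sum.swap) simp

lemma cform_sum_right: "cform f (\<lambda>g. \<Sum>i\<in>I. h i g) = (\<Sum>i\<in>I. cform f (h i))"
  unfolding cform_def sum_divide_distrib[symmetric] sum_distrib_left
  by (subst sum.swap) simp

lemma cform_sum_list_Irr:
  assumes "set xs \<subseteq> Irr G" "\<psi> \<in> Irr G"
  shows "cform (\<lambda>g. \<Sum>\<chi>\<leftarrow>xs. \<chi> g) \<psi> = of_nat (count_list xs \<psi>)"
  using assms(1)
proof (induction xs)
  case Nil
  then show ?case by (simp add: cform_def)
next
  case (Cons \<chi> xs)
  then show ?case using assms(2) by (simp add: cform_add_left Irr_orthonormal)
qed

text \<open>It is induced from the trivial character of the trivial subgroup.\<close>

lemma regular_is_character:
  "is_character G (carrier G) (\<lambda>g. if g = \<one> then of_nat (card (carrier G)) else 0)"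
proof -
  define \<delta> where "\<delta> = (\<lambda>g. if g = \<one> then 1 else (0 :: complex))"
  have lin: "lin_char G {\<one>} \<delta>" by (simp add: lin_char_def \<delta>_def)
  have "Ind G {\<one>} \<delta> g = (if g = \<one> then of_nat (card (carrier G)) else 0)" for g
  proof (cases "g \<in> carrier G")
    case True
    have "\<delta> (x \<otimes> g \<otimes> inv x) = (if g = \<one> then 1 else 0)" if x: "x \<in> carrier G" for x
    proof -
      have "x \<otimes> g \<otimes> inv x = \<one> \<longleftrightarrow> g = \<one>"
        using True x inv_equality[of "x \<otimes> g" "inv x"] by (metis inv_closed inv_solve_right' l_cancel_one' l_one m_closed one_closed r_inv r_cancel_one)
      then show ?thesis by (simp add: \<delta>_def)
    qed
    then show ?thesis using True by (simp add: Ind_def)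
  qed (auto simp: Ind_def)
  then have "Ind G {\<one>} \<delta> = (\<lambda>g. if g = \<one> then of_nat (card (carrier G)) else 0)" by blast
  then show ?thesis using Ind_linear_is_character[OF triv_subgroup fin lin] by simp
qed

lemma Irr_one:
  assumes "\<chi> \<in> Irr G"
  obtains d :: nat where "\<chi> \<one> = of_nat d" "d > 0"
proof -
  obtain n \<rho> where \<rho>: "irreducible_rep G (carrier G) n \<rho>" "affords G (carrier G) n \<rho> \<chi>"
    using assms by (auto simp: Irr_def)
  then have "\<chi> \<one> = of_nat n" "n > 0" by (auto simp: affords_def is_rep_def irreducible_rep_def)
  then show ?thesis using that by blast
qed

lemma cform_regular:
  "cform (\<lambda>g. if g = \<one> then of_nat (card (carrier G)) else 0) h = h \<one>"
proof -
  have "(\<Sum>g\<in>carrier G. (if g = \<one> then of_nat (card (carrier G)) else 0) * h (inv g)) =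
      (\<Sum>g\<in>carrier G. if g = \<one> then of_nat (card (carrier G)) * h \<one> else 0)"
    by (intro sum.cong) auto
  then show ?thesis by (simp add: cform_def)
qed

text \<open>Every irreducible character occurs in the regular one with multiplicity equal to its
  degree, which is positive, and the latter is the sum of a finite list.\<close>

lemma finite_Irr [simp]: "finite (Irr G)"
proof -
  obtain n \<rho> where "affords G (carrier G) n \<rho> (\<lambda>g. if g = \<one> then of_nat (card (carrier G)) else 0)"
    using regular_is_character by (auto simp: is_character_def)
  from affords_sum_Irr[OF this] obtain xs where xs: "set xs \<subseteq> Irr G"
    "(\<lambda>g. if g = \<one> then of_nat (card (carrier G)) else 0) = (\<lambda>g. \<Sum>\<psi>\<leftarrow>xs. \<psi> g)" by blast
  have "Irr G \<subseteq> set xs"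
  proof
    fix \<chi> assume \<chi>: "\<chi> \<in> Irr G"
    have "of_nat (count_list xs \<chi>) = \<chi> \<one>"
      using cform_sum_list_Irr[OF xs(1) \<chi>] cform_regular[of \<chi>] unfolding xs(2) by simp
    also have "\<dots> \<noteq> 0" using Irr_one[OF \<chi>] by (metis of_nat_eq_0_iff less_irrefl)
    finally show "\<chi> \<in> set xs" by (metis count_notin of_nat_0)
  qed
  then show ?thesis using finite_subset by blast
qed

lemma character_expansion:
  assumes "is_character G (carrier G) \<chi>"
  obtains m :: "('a \<Rightarrow> complex) \<Rightarrow> nat" where "\<chi> = (\<lambda>g. \<Sum>\<psi>\<in>Irr G. of_nat (m \<psi>) * \<psi> g)"
    "\<And>\<psi>. \<psi> \<in> Irr G \<Longrightarrow> cform \<chi> \<psi> = of_nat (m \<psi>)"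
proof -
  obtain n \<rho> where "affords G (carrier G) n \<rho> \<chi>" using assms by (auto simp: is_character_def)
  from affords_sum_Irr[OF this] obtain xs where xs: "set xs \<subseteq> Irr G" "\<chi> = (\<lambda>g. \<Sum>\<psi>\<leftarrow>xs. \<psi> g)" by blast
  show ?thesis
  proof (rule that)
    show "\<chi> = (\<lambda>g. \<Sum>\<psi>\<in>Irr G. of_nat (count_list xs \<psi>) * \<psi> g)"
      unfolding xs(2) using sum_list_eq_sum_count[OF xs(1) finite_Irr] by simp
    show "cform \<chi> \<psi> = of_nat (count_list xs \<psi>)" if "\<psi> \<in> Irr G" for \<psi>
      unfolding xs(2) by (rule cform_sum_list_Irr[OF xs(1) that])
  qed
qed

text \<open>By \<open>cform_regular\<close> the coefficients of the regular character in the basis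
  of irreducibles are their values at the identity.\<close>

lemma sum_Irr_regular:
  "(\<Sum>\<chi>\<in>Irr G. \<chi> \<one> * \<chi> g) = (if g = \<one> then of_nat (card (carrier G)) else 0)"
proof -
  obtain m where m: "(\<lambda>g. if g = \<one> then of_nat (card (carrier G)) else 0) = (\<lambda>g. \<Sum>\<psi>\<in>Irr G. complex_of_nat (m \<psi>) * \<psi> g)"
    "\<And>\<psi>. \<psi> \<in> Irr G \<Longrightarrow> cform (\<lambda>g. if g = \<one> then of_nat (card (carrier G)) else 0) \<psi> = of_nat (m \<psi>)"
    using character_expansion[OF regular_is_character] by blast
  have "(\<Sum>\<chi>\<in>Irr G. \<chi> \<one> * \<chi> g) = (\<Sum>\<chi>\<in>Irr G. complex_of_nat (m \<chi>) * \<chi> g)"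
    using m(2) by (intro sum.cong refl) (simp add: cform_regular)
  then show ?thesis using fun_cong[OF m(1), of g] by simp
qed

text \<open>Since \<open>\<chi>\<close> is a class function, conjugating the summation variable
  makes the sums for all x equal. The right-hand side is the inner product on \<open>H\<close> of
  \<open>\<phi>\<close> with the restriction of \<open>\<chi>\<close>.\<close>

lemma frobenius_reciprocity:
  assumes H: "subgroup H G" and \<phi>: "lin_char G H \<phi>" and \<chi>: "is_character G (carrier G) \<chi>"
  shows "cform (Ind G H \<phi>) \<chi> = (\<Sum>h\<in>H. \<phi> h * \<chi> (inv h)) / of_nat (card H)"
proof -
  have "(\<Sum>g\<in>carrier G. Ind G H \<phi> g * \<chi> (inv g)) =
      (\<Sum>g\<in>carrier G. \<Sum>x\<in>carrier G. \<phi> (x \<otimes> g \<otimes> inv x) * \<chi> (inv g)) / of_nat (card H)"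
    by (simp add: Ind_def sum_distrib_right sum_divide_distrib)
  also have "(\<Sum>g\<in>carrier G. \<Sum>x\<in>carrier G. \<phi> (x \<otimes> g \<otimes> inv x) * \<chi> (inv g)) =
      (\<Sum>x\<in>carrier G. \<Sum>g\<in>carrier G. \<phi> (x \<otimes> g \<otimes> inv x) * \<chi> (inv g))" by (rule sum.swap)
  also have "\<dots> = (\<Sum>x\<in>carrier G. \<Sum>g\<in>carrier G. \<phi> g * \<chi> (inv g))"
  proof (rule sum.cong[OF refl])
    fix x assume x: "x \<in> carrier G"
    have "\<chi> (inv g) = \<chi> (inv (x \<otimes> g \<otimes> inv x))" if g: "g \<in> carrier G" for g
    proof -
      have "inv (x \<otimes> g \<otimes> inv x) = x \<otimes> inv g \<otimes> inv x" using x g by (simp add: inv_mult_group m_assoc)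
      then show ?thesis using character_conjugate[OF \<chi>, of "inv g" x] x g by simp
    qed
    then have "(\<Sum>g\<in>carrier G. \<phi> (x \<otimes> g \<otimes> inv x) * \<chi> (inv g)) =
      (\<Sum>g\<in>carrier G. \<phi> (x \<otimes> g \<otimes> inv x) * \<chi> (inv (x \<otimes> g \<otimes> inv x)))" by (intro sum.cong) auto
    also have "\<dots> = (\<Sum>g\<in>carrier G. \<phi> g * \<chi> (inv g))"
      using sum_conjugate[OF x, of "\<lambda>g. \<phi> g * \<chi> (inv g)"] by simp
    finally show "(\<Sum>g\<in>carrier G. \<phi> (x \<otimes> g \<otimes> inv x) * \<chi> (inv g)) = (\<Sum>g\<in>carrier G. \<phi> g * \<chi> (inv g))" .
  qed
  also have "\<dots> = of_nat (card (carrier G)) * (\<Sum>g\<in>carrier G. \<phi> g * \<chi> (inv g))" by simp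
  also have "(\<Sum>g\<in>carrier G. \<phi> g * \<chi> (inv g)) = (\<Sum>h\<in>H. \<phi> h * \<chi> (inv h))"
    using \<phi> subgroup.subset[OF H] by (intro sum.mono_neutral_right) (auto simp: lin_char_def)
  finally show ?thesis by (simp add: cform_def)
qed

text \<open>The value is a root of unity, as h to the power of the group order is the
  identity.\<close>

lemma lin_char_norm:
  assumes H: "subgroup H G" and \<phi>: "lin_char G H \<phi>" and h: "h \<in> H"
  shows "norm (\<phi> h) = 1"
proof -
  have hk: "h [^] (k :: nat) \<in> H \<and> \<phi> (h [^] k) = \<phi> h ^ k" for k
  proof (induction k)
    case 0
    then show ?case using \<phi> subgroup.one_closed[OF H] by (simp add: lin_char_def)
  next
    case (Suc k)
    then show ?case using \<phi> h subgroup.m_closed[OF H] by (simp add: lin_char_def)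
  qed
  have "\<phi> h ^ Coset.order G = 1"
    using hk[of "Coset.order G"] pow_order_eq_1[OF subgroup.mem_carrier[OF H h]] \<phi> by (simp add: lin_char_def)
  then have "norm (\<phi> h) ^ Coset.order G = 1" by (metis norm_one norm_power)
  moreover have "Coset.order G > 0" using card_pos by (simp add: Coset.order_def)
  ultimately show ?thesis using power_eq_1_iff[of "norm (\<phi> h)" "Coset.order G"] by simp
qed

text \<open>Every \<rho>(g) commutes with the representation and is therefore a scalar c(g). Then
  \<chi>(g) \<chi>(g^-1) = n^2 for all g, and the norm relation \<open>Irr_norm_one\<close> forces n
  = 1.\<close>

lemma Irr_commutative_linear:
  assumes comm: "\<And>x y. x \<in> carrier G \<Longrightarrow> y \<in> carrier G \<Longrightarrow> x \<otimes> y = y \<otimes> x"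
    and \<chi>: "\<chi> \<in> Irr G"
  shows "lin_char G (carrier G) \<chi>"
proof -
  obtain n \<rho> where irr: "irreducible_rep G (carrier G) n \<rho>" and aff: "affords G (carrier G) n \<rho> \<chi>"
    using \<chi> by (auto simp: Irr_def)
  have rep: "is_rep G (carrier G) n \<rho>" using aff by (simp add: affords_def)
  have rc: "\<rho> g \<in> carrier_mat n n" if "g \<in> carrier G" for g using rep that by (auto simp: is_rep_def)
  have mul: "\<rho> (g \<otimes> h) = \<rho> g * \<rho> h" if "g \<in> carrier G" "h \<in> carrier G" for g h
    using rep that by (auto simp: is_rep_def)
  have n: "n > 0" using irr by (simp add: irreducible_rep_def)
  have "\<exists>c. \<rho> g = c \<cdot>\<^sub>m 1\<^sub>m n" if g: "g \<in> carrier G" for g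
    using irreducible_rep_commuting_scalar[OF irr rc[OF g]] mul g comm by metis
  then obtain c where c: "\<And>g. g \<in> carrier G \<Longrightarrow> \<rho> g = c g \<cdot>\<^sub>m 1\<^sub>m n" by metis
  have \<chi>c: "\<chi> g = c g * of_nat n" if "g \<in> carrier G" for g
    using aff that c[OF that] by (simp add: affords_def mat_trace_smult[of _ n])
  have cinv: "c g * c (inv g) = 1" if g: "g \<in> carrier G" for g
  proof -
    have "\<rho> g * \<rho> (inv g) = 1\<^sub>m n" using mul[OF g, of "inv g"] rep g by (simp add: is_rep_def)
    then have "(\<rho> g * \<rho> (inv g)) $$ (0, 0) = 1" using n by simp
    moreover have "(\<rho> g * \<rho> (inv g)) = (c g * c (inv g)) \<cdot>\<^sub>m 1\<^sub>m n"
    proof -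
      have "\<rho> g * \<rho> (inv g) = (c g \<cdot>\<^sub>m 1\<^sub>m n) * \<rho> (inv g)" using c[OF g] by simp
      also have "\<dots> = c g \<cdot>\<^sub>m (1\<^sub>m n * \<rho> (inv g))"
        using rc[of "inv g"] g by (intro mult_smult_assoc_mat[of _ n n _ n]) auto
      also have "\<dots> = c g \<cdot>\<^sub>m (c (inv g) \<cdot>\<^sub>m 1\<^sub>m n)" using c[of "inv g"] g by simp
      also have "\<dots> = (c g * c (inv g)) \<cdot>\<^sub>m 1\<^sub>m n" by (intro eq_matI) auto
      finally show ?thesis .
    qed
    ultimately show ?thesis using n by simp
  qed
  have "(\<Sum>g\<in>carrier G. \<chi> g * \<chi> (inv g)) = (\<Sum>g\<in>carrier G. (of_nat n)\<^sup>2)"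
  proof (intro sum.cong refl)
    fix g assume g: "g \<in> carrier G"
    have "\<chi> g * \<chi> (inv g) = (c g * c (inv g)) * (of_nat n)\<^sup>2"
      using \<chi>c g by (simp add: power2_eq_square)
    then show "\<chi> g * \<chi> (inv g) = (of_nat n)\<^sup>2" using cinv[OF g] by simp
  qed
  then have "(of_nat n :: complex)\<^sup>2 = cform \<chi> \<chi>" by (simp add: cform_def)
  then have "(of_nat (n\<^sup>2) :: complex) = of_nat 1" using Irr_norm_one[OF \<chi>] by simp
  then have "n = 1" using of_nat_eq_iff[where 'a = complex] by (metis power2_eq_1_iff nat_1_eq_mult_iff power2_eq_square)
  then have "is_linear_character G (carrier G) \<chi>" using aff by (auto simp: is_linear_character_def)
  then show ?thesis using is_linear_character_iff by (metis m_closed one_closed)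
qed

lemma sum_Irr_commutative:
  assumes comm: "\<And>x y. x \<in> carrier G \<Longrightarrow> y \<in> carrier G \<Longrightarrow> x \<otimes> y = y \<otimes> x"
  shows "(\<Sum>\<chi>\<in>Irr G. \<chi> g) = (if g = \<one> then of_nat (card (carrier G)) else 0)"
proof -
  have "(\<Sum>\<chi>\<in>Irr G. \<chi> g) = (\<Sum>\<chi>\<in>Irr G. \<chi> \<one> * \<chi> g)"
    using Irr_commutative_linear[OF comm] by (intro sum.cong refl) (simp add: lin_char_def)
  then show ?thesis using sum_Irr_regular by simp
qed

text \<open>Fourier inversion for an arbitrary function on a finite abelian group: exchange the sums
  and apply the dual orthogonality \<open>sum_Irr_commutative\<close> at
  \<open>inv d \<otimes> c\<close>.\<close>

lemma commutative_expansion: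
  assumes comm: "\<And>x y. x \<in> carrier G \<Longrightarrow> y \<in> carrier G \<Longrightarrow> x \<otimes> y = y \<otimes> x"
    and c: "c \<in> carrier G"
  shows "f c = (\<Sum>\<phi>\<in>Irr G. cform f \<phi> * \<phi> c)"
proof -
  have "(\<Sum>\<phi>\<in>Irr G. cform f \<phi> * \<phi> c) =
      (\<Sum>\<phi>\<in>Irr G. \<Sum>d\<in>carrier G. f d * \<phi> (inv d) * \<phi> c) / of_nat (card (carrier G))"
    by (simp add: cform_def sum_distrib_right sum_divide_distrib)
  also have "(\<Sum>\<phi>\<in>Irr G. \<Sum>d\<in>carrier G. f d * \<phi> (inv d) * \<phi> c) =
      (\<Sum>d\<in>carrier G. \<Sum>\<phi>\<in>Irr G. f d * \<phi> (inv d) * \<phi> c)" by (rule sum.swap)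
  also have "\<dots> = (\<Sum>d\<in>carrier G. if d = c then f d * of_nat (card (carrier G)) else 0)"
  proof (intro sum.cong refl)
    fix d assume d: "d \<in> carrier G"
    have "(\<Sum>\<phi>\<in>Irr G. f d * \<phi> (inv d) * \<phi> c) = f d * (\<Sum>\<phi>\<in>Irr G. \<phi> (inv d \<otimes> c))"
      unfolding sum_distrib_left using Irr_commutative_linear[OF comm] d c
      by (intro sum.cong refl) (simp add: lin_char_def)
    also have "inv d \<otimes> c = \<one> \<longleftrightarrow> d = c" using c d by (metis inv_equality inv_inv l_inv inv_closed)
    then have "(\<Sum>\<phi>\<in>Irr G. \<phi> (inv d \<otimes> c)) = (if d = c then of_nat (card (carrier G)) else 0)"
      using sum_Irr_commutative[OF comm] by simp
    finally show "(\<Sum>\<phi>\<in>Irr G. f d * \<phi> (inv d) * \<phi> c) = (if d = c then f d * of_nat (card (carrier G)) else 0)"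
      by simp
  qed
  also have "\<dots> = f c * of_nat (card (carrier G))" using c by simp
  finally show ?thesis by simp
qed

end

section \<open>Inflated characters of an abelian section\<close>

context fin_group
begin

text \<open>\<open>X\<close> consists of the irreducible characters of the abelian quotient by
  \<open>K\<close>, pulled back to \<open>G\<close>. Their sum is the regular character of that
  quotient; the factor \<open>card K\<close> replaces the index by orders. The trivial character is
  recorded because it produces the term of interest in \<open>n_abelian_step\<close>.\<close>

lemma quotient_dual:
  assumes K: "subgroup K G"
    and comm: "\<And>x y. x \<in> carrier G \<Longrightarrow> y \<in> carrier G \<Longrightarrow> x \<otimes> y \<otimes> inv x \<otimes> inv y \<in> K"
  shows "\<exists>X. finite X \<and> (\<forall>\<psi>\<in>X. lin_char G (carrier G) \<psi> \<and> (\<forall>u\<in>K. \<psi> u = 1)) \<and>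
    (\<forall>u\<in>carrier G. (\<Sum>\<psi>\<in>X. \<psi> u) * of_nat (card K) = (if u \<in> K then of_nat (card (carrier G)) else 0)) \<and>
    (\<lambda>g. if g \<in> carrier G then 1 else 0) \<in> X"
proof -
  have Kc: "k \<in> carrier G" if "k \<in> K" for k using K that by (rule subgroup.mem_carrier)
  have "K \<lhd> G"
  proof (rule normal_invI[OF K])
    fix x k assume x: "x \<in> carrier G" and k: "k \<in> K"
    \<comment> \<open>Normality comes from the commutator hypothesis: the conjugate of k is a
      commutator times k.\<close>
    have "x \<otimes> k \<otimes> inv x = (x \<otimes> k \<otimes> inv x \<otimes> inv k) \<otimes> k" using x Kc[OF k] by (simp add: m_assoc)
    then show "x \<otimes> k \<otimes> inv x \<in> K" using subgroup.m_closed[OF K comm[OF x Kc[OF k]] k] by simp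
  qed
  then interpret K: normal K G .
  define Q where "Q = G Mod K"
  have Qc: "carrier Q = (\<lambda>x. K #> x) ` carrier G" by (auto simp: Q_def FactGroup_def RCOSETS_def)
  have Qm: "(K #> x) \<otimes>\<^bsub>Q\<^esub> (K #> y) = K #> (x \<otimes> y)" if "x \<in> carrier G" "y \<in> carrier G" for x y
    using K.rcos_sum[OF that] by (simp add: Q_def FactGroup_def)
  have Q1: "\<one>\<^bsub>Q\<^esub> = K" by (simp add: Q_def FactGroup_def)
  interpret Q: fin_group Q
  proof (intro fin_group.intro fin_group_axioms.intro)
    show "group Q" unfolding Q_def by (rule K.factorgroup_is_group)
    show "finite (carrier Q)" unfolding Qc by simp
  qed
  have eqK: "K #> u = K \<longleftrightarrow> u \<in> K" if "u \<in> carrier G" for u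
    using coset_join1[OF _ that K] coset_join2[OF that K] by blast
  have Qcomm: "a \<otimes>\<^bsub>Q\<^esub> b = b \<otimes>\<^bsub>Q\<^esub> a" if ab: "a \<in> carrier Q" "b \<in> carrier Q" for a b
  proof -
    obtain x where x: "x \<in> carrier G" "a = K #> x" using ab(1) unfolding Qc by (elim imageE)
    obtain y where y: "y \<in> carrier G" "b = K #> y" using ab(2) unfolding Qc by (elim imageE)
    note xy = x(1) y(1) x(2) y(2)
    have "x \<otimes> y \<otimes> inv (y \<otimes> x) \<in> K" using comm[OF xy(1,2)] xy by (simp add: inv_mult_group m_assoc)
    then have "x \<otimes> y \<in> K #> (y \<otimes> x)" using subgroup.rcos_module[OF K is_group] xy by simp
    then have "K #> (y \<otimes> x) = K #> (x \<otimes> y)" using repr_independence K xy by simp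
    then show ?thesis using Qm xy by simp
  qed
  define infl where "infl = (\<lambda>(\<theta> :: 'a set \<Rightarrow> complex) u. if u \<in> carrier G then \<theta> (K #> u) else 0)"
  define X where "X = infl ` Irr Q"
  have lin: "lin_char Q (carrier Q) \<theta>" if "\<theta> \<in> Irr Q" for \<theta> by (rule Q.Irr_commutative_linear[OF Qcomm that])
  have cos: "K #> u \<in> carrier Q" if "u \<in> carrier G" for u using that Qc by blast
  have inj: "inj_on infl (Irr Q)"
  proof (rule inj_onI)
    fix \<theta> \<theta>' assume *: "\<theta> \<in> Irr Q" "\<theta>' \<in> Irr Q" "infl \<theta> = infl \<theta>'"
    show "\<theta> = \<theta>'"
    proof
      fix a show "\<theta> a = \<theta>' a"
      proof (cases "a \<in> carrier Q")
        case True
        then obtain u where "u \<in> carrier G" "a = K #> u" unfolding Qc by (elim imageE)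
        then show ?thesis using fun_cong[OF *(3), of u] by (simp add: infl_def)
      next
        case False
        then show ?thesis using lin[OF *(1)] lin[OF *(2)] by (simp add: lin_char_def)
      qed
    qed
  qed
  have "lin_char G (carrier G) \<psi> \<and> (\<forall>u\<in>K. \<psi> u = 1)" if "\<psi> \<in> X" for \<psi>
  proof -
    obtain \<theta> where \<theta>: "\<theta> \<in> Irr Q" "\<psi> = infl \<theta>" using \<open>\<psi> \<in> X\<close> X_def by auto
    have one: "\<psi> u = 1" if "u \<in> K" for u
      using lin[OF \<theta>(1)] \<theta>(2) eqK[OF Kc] that Kc[OF that] by (simp add: infl_def lin_char_def Q1)
    have "\<psi> (g \<otimes> h) = \<psi> g * \<psi> h" if "g \<in> carrier G" "h \<in> carrier G" for g h
    proof -
      have "\<theta> ((K #> g) \<otimes>\<^bsub>Q\<^esub> (K #> h)) = \<theta> (K #> g) * \<theta> (K #> h)"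
        using lin[OF \<theta>(1)] cos[OF that(1)] cos[OF that(2)] by (simp add: lin_char_def)
      then show ?thesis using that Qm[OF that] by (simp add: \<theta>(2) infl_def)
    qed
    then show ?thesis using one subgroup.one_closed[OF K] \<theta>(2) by (simp add: lin_char_def infl_def)
  qed
  moreover have "(\<Sum>\<psi>\<in>X. \<psi> u) * of_nat (card K) = (if u \<in> K then of_nat (card (carrier G)) else 0)"
    if u: "u \<in> carrier G" for u
  proof -
    have "(\<Sum>\<psi>\<in>X. \<psi> u) = (\<Sum>\<theta>\<in>Irr Q. \<theta> (K #> u))"
      unfolding X_def by (subst sum.reindex[OF inj]) (simp add: infl_def u)
    also have "\<dots> = (if u \<in> K then of_nat (card (carrier Q)) else 0)"
      using Q.sum_Irr_commutative[OF Qcomm] eqK[OF u] by (simp add: Q1)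
    finally show ?thesis
      using lagrange[OF K] by (auto simp: Q_def FactGroup_def Coset.order_def simp flip: of_nat_mult)
  qed
  moreover have "(\<lambda>g. if g \<in> carrier G then 1 else 0) \<in> X"
  proof -
    have "lin_char Q (carrier Q) (\<lambda>a. if a \<in> carrier Q then 1 else 0)" by (simp add: lin_char_def)
    then have "(\<lambda>a. if a \<in> carrier Q then 1 else 0) \<in> Irr Q" by (rule lin_char_in_Irr)
    moreover have "infl (\<lambda>a. if a \<in> carrier Q then 1 else 0) = (\<lambda>g. if g \<in> carrier G then 1 else 0)"
      using cos by (auto simp: infl_def)
    ultimately show ?thesis unfolding X_def by (intro image_eqI[OF sym])
  qed
  moreover have "finite X" by (simp add: X_def)
  ultimately show ?thesis by (intro exI[of _ X]) simp
qed

lemma subgroup_fin_group: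
  assumes "subgroup H G"
  shows "fin_group (G\<lparr>carrier := H\<rparr>)"
proof (intro fin_group.intro fin_group_axioms.intro)
  show "group (G\<lparr>carrier := H\<rparr>)" using assms by (rule subgroup_imp_group)
  show "finite (carrier (G\<lparr>carrier := H\<rparr>))" using finite_subset[OF subgroup.subset[OF assms]] by simp
qed

lemma subgroup_quotient_dual:
  assumes N: "subgroup N G" and K: "subgroup K G" "K \<subseteq> N"
    and comm: "\<And>x y. x \<in> N \<Longrightarrow> y \<in> N \<Longrightarrow> x \<otimes> y \<otimes> inv x \<otimes> inv y \<in> K"
  shows "\<exists>X. finite X \<and> (\<forall>\<psi>\<in>X. lin_char G N \<psi> \<and> (\<forall>u\<in>K. \<psi> u = 1)) \<and>
    (\<forall>u\<in>N. (\<Sum>\<psi>\<in>X. \<psi> u) * of_nat (card K) = (if u \<in> K then of_nat (card N) else 0)) \<and>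
    (\<lambda>g. if g \<in> N then 1 else 0) \<in> X"
proof -
  interpret N: fin_group "G\<lparr>carrier := N\<rparr>" by (rule subgroup_fin_group[OF N])
  have K': "subgroup K (G\<lparr>carrier := N\<rparr>)" by (rule subgroup_incl[OF K(1) N K(2)])
  have comm': "x \<otimes>\<^bsub>G\<lparr>carrier := N\<rparr>\<^esub> y \<otimes>\<^bsub>G\<lparr>carrier := N\<rparr>\<^esub> inv\<^bsub>G\<lparr>carrier := N\<rparr>\<^esub> x
      \<otimes>\<^bsub>G\<lparr>carrier := N\<rparr>\<^esub> inv\<^bsub>G\<lparr>carrier := N\<rparr>\<^esub> y \<in> K"
    if "x \<in> carrier (G\<lparr>carrier := N\<rparr>)" "y \<in> carrier (G\<lparr>carrier := N\<rparr>)" for x y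
    using comm that by (simp add: m_inv_consistent[OF N])
  have lin: "lin_char (G\<lparr>carrier := N\<rparr>) N = lin_char G N" by (simp add: lin_char_def fun_eq_iff)
  have c: "carrier (G\<lparr>carrier := N\<rparr>) = N" by simp
  show ?thesis using N.quotient_dual[OF K' comm'] unfolding c lin .
qed

end

section \<open>Splitting an induced linear character along an abelian section\<close>

text \<open>\<open>X\<close> is the dual group of \<open>N / (M \<inter> N)\<close>, inflated to \<open>N\<close>; \<open>stab_char \<psi>\<close> below extends
  \<open>\<psi>\<close> to its stabiliser in \<open>N M\<close> so as to be trivial on the part in \<open>M\<close>.\<close>

locale abelian_step = fin_group G for G (structure) +
  fixes M N :: "'a set" and X :: "('a \<Rightarrow> complex) set"
  assumes M: "subgroup M G" and normN: "N \<lhd> G"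
    and X_lin: "\<And>\<psi>. \<psi> \<in> X \<Longrightarrow> lin_char G N \<psi>"
    and X_triv: "\<And>\<psi> u. \<psi> \<in> X \<Longrightarrow> u \<in> M \<inter> N \<Longrightarrow> \<psi> u = 1"
    and X_sum: "\<And>u. u \<in> N \<Longrightarrow> (\<Sum>\<psi>\<in>X. \<psi> u) * of_nat (card (M \<inter> N)) = (if u \<in> M \<inter> N then of_nat (card N) else 0)"
begin

lemma N: "subgroup N G"
  using normN by (rule normal_imp_subgroup)

abbreviation L where "L \<equiv> N <#> M"

lemma L: "subgroup L G"
  by (rule mult_norm_subgroup[OF normN M])

lemma Mc [simp]: "h \<in> M \<Longrightarrow> h \<in> carrier G" and Nc [simp]: "a \<in> N \<Longrightarrow> a \<in> carrier G"
  and Lc [simp]: "y \<in> L \<Longrightarrow> y \<in> carrier G"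
  using M N L by (auto dest: subgroup.mem_carrier)

lemma L_cases:
  assumes "y \<in> L"
  obtains a h where "a \<in> N" "h \<in> M" "y = a \<otimes> h"
  using assms by (auto simp: set_mult_def)

lemma L_I: "a \<in> N \<Longrightarrow> h \<in> M \<Longrightarrow> a \<otimes> h \<in> L"
  by (auto simp: set_mult_def)

lemma N_sub_L: "N \<subseteq> L"
  using L_I[OF _ subgroup.one_closed[OF M]] by force

lemma M_sub_L: "M \<subseteq> L"
  using L_I[OF subgroup.one_closed[OF N]] by force

lemma conjN: "x \<in> carrier G \<Longrightarrow> a \<in> N \<Longrightarrow> x \<otimes> a \<otimes> inv x \<in> N"
  using normN by (rule normal_invE(2))

definition stab :: "('a \<Rightarrow> complex) \<Rightarrow> 'a set" where
  "stab \<psi> = {g \<in> L. \<forall>m\<in>N. \<psi> (g \<otimes> m \<otimes> inv g) = \<psi> m}"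

text \<open>An arbitrary choice of \<open>M\<close>-component. Outside \<open>L\<close> the value is
  meaningless, but \<open>stab_char\<close> consults it only on \<open>stab \<psi>\<close>, which
  lies in \<open>L\<close>.\<close>

definition M_part :: "'a \<Rightarrow> 'a" where
  "M_part g = (SOME h. h \<in> M \<and> g \<otimes> inv h \<in> N)"

definition stab_char :: "('a \<Rightarrow> complex) \<Rightarrow> 'a \<Rightarrow> complex" where
  "stab_char \<psi> g = (if g \<in> stab \<psi> then \<psi> (g \<otimes> inv (M_part g)) else 0)"

text \<open>Independence of the factorisation: two \<open>N\<close>-components of the same element
  differ by a factor in M \<inter> N, where the characters in \<open>X\<close> are 1.\<close>

lemma stab_char_eq:
  assumes \<psi>: "\<psi> \<in> X" and a: "a \<in> N" and h: "h \<in> M" and st: "a \<otimes> h \<in> stab \<psi>"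
  shows "stab_char \<psi> (a \<otimes> h) = \<psi> a"
proof -
  define g where "g = a \<otimes> h"
  have gc: "g \<in> carrier G" using a h by (simp add: g_def)
  have gh: "g \<otimes> inv h = a" using a h by (simp add: g_def m_assoc)
  have "h \<in> M \<and> g \<otimes> inv h \<in> N" using a h gh by simp
  then have k: "M_part g \<in> M" "g \<otimes> inv (M_part g) \<in> N"
    unfolding M_part_def by (metis (mono_tags, lifting) someI)+
  define b where "b = g \<otimes> inv (M_part g)"
  have b: "b \<in> N" using k by (simp add: b_def)
  have "inv a \<otimes> b = h \<otimes> inv (M_part g)"
    using a h k by (simp add: b_def g_def m_assoc inv_mult_cancel)
  moreover have "h \<otimes> inv (M_part g) \<in> M" using h k M by (simp add: subgroup.m_closed subgroup.m_inv_closed)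
  moreover have "inv a \<otimes> b \<in> N" using a b N by (simp add: subgroup.m_closed subgroup.m_inv_closed)
  ultimately have "\<psi> (inv a \<otimes> b) = 1" using X_triv[OF \<psi>] by simp
  moreover have "b = a \<otimes> (inv a \<otimes> b)" using a b by (simp add: inv_mult_cancel)
  then have "\<psi> b = \<psi> a * \<psi> (inv a \<otimes> b)"
    using X_lin[OF \<psi>] a \<open>inv a \<otimes> b \<in> N\<close> unfolding lin_char_def by metis
  ultimately have "\<psi> b = \<psi> a" by simp
  then show ?thesis using st by (simp add: stab_char_def b_def g_def)
qed

text \<open>Conjugation by an element of \<open>N\<close> does not change a linear character of
  \<open>N\<close>, so only the \<open>M\<close>-component matters.\<close>

lemma stab_iff:
  assumes \<psi>: "\<psi> \<in> X" and a: "a \<in> N" and h: "h \<in> M"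
  shows "a \<otimes> h \<in> stab \<psi> \<longleftrightarrow> (\<forall>m\<in>N. \<psi> (h \<otimes> m \<otimes> inv h) = \<psi> m)"
proof -
  have "\<psi> ((a \<otimes> h) \<otimes> m \<otimes> inv (a \<otimes> h)) = \<psi> (h \<otimes> m \<otimes> inv h)" if m: "m \<in> N" for m
  proof -
    have "(a \<otimes> h) \<otimes> m \<otimes> inv (a \<otimes> h) = a \<otimes> (h \<otimes> m \<otimes> inv h) \<otimes> inv a"
      using a h m by (simp add: m_assoc inv_mult_group)
    then show ?thesis using lin_char_conjugate[OF X_lin[OF \<psi>] N a, of "h \<otimes> m \<otimes> inv h"] h m by simp
  qed
  then show ?thesis using L_I[OF a h] by (simp add: stab_def)
qed

lemma stab_subgroup:
  assumes \<psi>: "\<psi> \<in> X"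
  shows "subgroup (stab \<psi>) G"
proof (rule subgroupI)
  show "stab \<psi> \<subseteq> carrier G" by (auto simp: stab_def)
  have "\<one> \<in> stab \<psi>" using subgroup.one_closed[OF L] by (simp add: stab_def)
  then show "stab \<psi> \<noteq> {}" by blast
next
  fix g assume g: "g \<in> stab \<psi>"
  then have gL: "g \<in> L" by (simp add: stab_def)
  have "\<psi> (inv g \<otimes> m \<otimes> inv (inv g)) = \<psi> m" if m: "m \<in> N" for m
  proof -
    have m': "inv g \<otimes> m \<otimes> inv (inv g) \<in> N" using conjN[of "inv g" m] gL m by simp
    have "g \<otimes> (inv g \<otimes> m \<otimes> inv (inv g)) \<otimes> inv g = m" using gL m by (simp add: m_assoc inv_mult_cancel)
    then show ?thesis using g m' unfolding stab_def by (metis (mono_tags, lifting) mem_Collect_eq)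
  qed
  then show "inv g \<in> stab \<psi>" using subgroup.m_inv_closed[OF L gL] by (simp add: stab_def)
next
  fix g h assume g: "g \<in> stab \<psi>" and h: "h \<in> stab \<psi>"
  then have gL: "g \<in> L" and hL: "h \<in> L" by (auto simp: stab_def)
  have "\<psi> (g \<otimes> h \<otimes> m \<otimes> inv (g \<otimes> h)) = \<psi> m" if m: "m \<in> N" for m
  proof -
    have "g \<otimes> h \<otimes> m \<otimes> inv (g \<otimes> h) = g \<otimes> (h \<otimes> m \<otimes> inv h) \<otimes> inv g"
      using gL hL m by (simp add: m_assoc inv_mult_group)
    then show ?thesis using g h m conjN[of h m] hL by (simp add: stab_def)
  qed
  then show "g \<otimes> h \<in> stab \<psi>" using subgroup.m_closed[OF L gL hL] by (simp add: stab_def)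
qed

text \<open>In the product (a h)(a' h') the \<open>N\<close>-component is a times the conjugate of
  a' by h, and h stabilises \<psi>, so the conjugate can be replaced by a'.\<close>

lemma stab_char_lin_char:
  assumes \<psi>: "\<psi> \<in> X"
  shows "lin_char G (stab \<psi>) (stab_char \<psi>)"
  unfolding lin_char_def
proof (intro conjI ballI allI impI)
  note lin = X_lin[OF \<psi>]
  have "stab_char \<psi> (\<one> \<otimes> \<one>) = \<psi> \<one>"
    using subgroup.one_closed[OF stab_subgroup[OF \<psi>]] subgroup.one_closed[OF M] subgroup.one_closed[OF N]
    by (intro stab_char_eq[OF \<psi>]) auto
  then show "stab_char \<psi> \<one> = 1" using lin by (simp add: lin_char_def)
  fix g g' assume g: "g \<in> stab \<psi>" and g': "g' \<in> stab \<psi>"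
  obtain a h where ah: "a \<in> N" "h \<in> M" "g = a \<otimes> h" using g L_cases[of g] by (auto simp: stab_def)
  obtain a' h' where ah': "a' \<in> N" "h' \<in> M" "g' = a' \<otimes> h'" using g' L_cases[of g'] by (auto simp: stab_def)
  have c: "h \<otimes> a' \<otimes> inv h \<in> N" using conjN[of h a'] ah ah' by simp
  have gg: "g \<otimes> g' = (a \<otimes> (h \<otimes> a' \<otimes> inv h)) \<otimes> (h \<otimes> h')"
    using ah ah' by (simp add: m_assoc inv_mult_cancel)
  have "stab_char \<psi> (g \<otimes> g') = \<psi> (a \<otimes> (h \<otimes> a' \<otimes> inv h))"
    unfolding gg
  proof (rule stab_char_eq[OF \<psi>])
    show "a \<otimes> (h \<otimes> a' \<otimes> inv h) \<in> N" using ah c N by (simp add: subgroup.m_closed)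
    show "h \<otimes> h' \<in> M" using ah ah' M by (simp add: subgroup.m_closed)
    show "a \<otimes> (h \<otimes> a' \<otimes> inv h) \<otimes> (h \<otimes> h') \<in> stab \<psi>"
      unfolding gg[symmetric] by (rule subgroup.m_closed[OF stab_subgroup[OF \<psi>] g g'])
  qed
  also have "\<dots> = \<psi> a * \<psi> (h \<otimes> a' \<otimes> inv h)" using lin ah(1) c by (simp add: lin_char_def)
  also have "\<psi> (h \<otimes> a' \<otimes> inv h) = \<psi> a'" using stab_iff[OF \<psi> ah(1,2)] g ah ah' by simp
  also have "\<psi> a = stab_char \<psi> g" using stab_char_eq[OF \<psi> ah(1,2)] g ah by simp
  also have "\<psi> a' = stab_char \<psi> g'" using stab_char_eq[OF \<psi> ah'(1,2)] g' ah' by simp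
  finally show "stab_char \<psi> (g \<otimes> g') = stab_char \<psi> g * stab_char \<psi> g'" .
qed (auto simp: stab_char_def)

text \<open>Each summand is \<psi>(a) \<eta>(m), where \<eta>(m) is the quotient of \<psi>(m) by
  \<psi>(h m h^-1). This \<eta> is a linear character of \<open>N\<close>, trivial exactly when a h
  stabilises \<psi>; otherwise its sum over \<open>N\<close> vanishes.\<close>

lemma twisted_sum:
  assumes \<psi>: "\<psi> \<in> X" and a: "a \<in> N" and h: "h \<in> M"
  shows "(\<Sum>m\<in>N. \<psi> (m \<otimes> a \<otimes> (h \<otimes> inv m \<otimes> inv h))) = of_nat (card N) * stab_char \<psi> (a \<otimes> h)"
proof -
  note lin = X_lin[OF \<psi>]
  have invN: "inv m \<in> N" if "m \<in> N" for m using N that by (rule subgroup.m_inv_closed)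
  have cN: "h \<otimes> m \<otimes> inv h \<in> N" if "m \<in> N" for m using conjN[of h m] h that by simp
  have mul: "\<psi> (x \<otimes> y) = \<psi> x * \<psi> y" if "x \<in> N" "y \<in> N" for x y using lin that by (simp add: lin_char_def)
  define \<eta> where "\<eta> = (\<lambda>m. \<psi> m * \<psi> (h \<otimes> inv m \<otimes> inv h))"
  have e: "\<psi> (m \<otimes> a \<otimes> (h \<otimes> inv m \<otimes> inv h)) = \<psi> a * \<eta> m" if m: "m \<in> N" for m
    using mul[of "m \<otimes> a" "h \<otimes> inv m \<otimes> inv h"] mul[OF m a] subgroup.m_closed[OF N m a] cN[OF invN[OF m]]
    by (simp add: \<eta>_def)
  have sum: "(\<Sum>m\<in>N. \<psi> (m \<otimes> a \<otimes> (h \<otimes> inv m \<otimes> inv h))) = \<psi> a * (\<Sum>m\<in>N. \<eta> m)"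
    unfolding sum_distrib_left by (intro sum.cong refl e)
  show ?thesis
  proof (cases "a \<otimes> h \<in> stab \<psi>")
    case True
    have "\<eta> m = 1" if m: "m \<in> N" for m
      using stab_iff[OF \<psi> a h] True invN[OF m] lin_char_inv(2)[OF lin N m] by (simp add: \<eta>_def)
    then show ?thesis using sum stab_char_eq[OF \<psi> a h True] by simp
  next
    case False
    then obtain m0 where m0: "m0 \<in> N" "\<psi> (h \<otimes> m0 \<otimes> inv h) \<noteq> \<psi> m0" using stab_iff[OF \<psi> a h] by blast
    \<comment> \<open>The inverse is taken because \<open>\<eta>\<close> evaluates \<psi> at the
      conjugate of the inverse of its argument; thus \<eta>(m1) compares \<psi> at m0 and at its
      conjugate.\<close>
    define m1 where "m1 = inv m0"
    have m1: "m1 \<in> N" using invN m0 by (simp add: m1_def)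
    have "\<eta> m1 \<noteq> 1"
    proof
      assume "\<eta> m1 = 1"
      then have "\<psi> (inv m0) * \<psi> (h \<otimes> m0 \<otimes> inv h) = 1" using m0 by (simp add: \<eta>_def m1_def)
      then have "\<psi> m0 * (\<psi> (inv m0) * \<psi> (h \<otimes> m0 \<otimes> inv h)) = \<psi> m0" by simp
      then show False using lin_char_inv(2)[OF lin N m0(1)] m0(2) by (simp flip: mult.assoc)
    qed
    moreover have "\<eta> (m1 \<otimes> m) = \<eta> m1 * \<eta> m" if m: "m \<in> N" for m
    proof -
      have "h \<otimes> inv (m1 \<otimes> m) \<otimes> inv h = (h \<otimes> inv m \<otimes> inv h) \<otimes> (h \<otimes> inv m1 \<otimes> inv h)"
        using h m m1 by (simp add: inv_mult_group m_assoc inv_mult_cancel)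
      then show ?thesis using mul[OF m1 m] mul[OF cN cN, OF invN invN, OF m m1] by (simp add: \<eta>_def)
    qed
    then have "(\<Sum>m\<in>N. \<eta> (m1 \<otimes> m)) = \<eta> m1 * (\<Sum>m\<in>N. \<eta> m)" unfolding sum_distrib_left by (intro sum.cong) auto
    moreover have "(\<Sum>m\<in>N. \<eta> (m1 \<otimes> m)) = (\<Sum>m\<in>N. \<eta> m)"
      by (rule sum.reindex_bij_witness[of _ "\<lambda>m. inv m1 \<otimes> m" "\<lambda>m. m1 \<otimes> m"])
        (use m1 invN[OF m1] subgroup.m_closed[OF N] in \<open>auto simp: inv_mult_cancel\<close>)
    ultimately have "(\<Sum>m\<in>N. \<eta> m) = 0" by (metis mult_cancel_right1)
    then show ?thesis using sum False by (simp add: stab_char_def)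
  qed
qed

text \<open>For y = a h the conjugate by m is u(m) h with u(m) in \<open>N\<close>, so it lies in
  \<open>M\<close> exactly when u(m) lies in M \<inter> N. Expanding that indicator by
  \<open>X_sum\<close> leaves the sums evaluated in \<open>twisted_sum\<close>. Outside
  \<open>L\<close> both sides vanish.\<close>

lemma conjugates_count:
  assumes y: "y \<in> carrier G"
  shows "(\<Sum>m\<in>N. if m \<otimes> y \<otimes> inv m \<in> M then 1 else (0 :: complex)) =
    of_nat (card (M \<inter> N)) * (\<Sum>\<psi>\<in>X. stab_char \<psi> y)"
proof (cases "y \<in> L")
  case False
  have "m \<otimes> y \<otimes> inv m \<notin> M" if m: "m \<in> N" for m
  proof
    assume "m \<otimes> y \<otimes> inv m \<in> M"
    then have "m \<otimes> y \<otimes> inv m \<in> L" using M_sub_L by blast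
    moreover have mL: "m \<in> L" using m N_sub_L by blast
    ultimately have "inv m \<otimes> (m \<otimes> y \<otimes> inv m) \<otimes> m \<in> L"
      using L by (simp add: subgroup.m_closed subgroup.m_inv_closed)
    moreover have "inv m \<otimes> (m \<otimes> y \<otimes> inv m) \<otimes> m = y" using m y by (simp add: m_assoc inv_mult_cancel)
    ultimately show False using False by simp
  qed
  moreover have "stab_char \<psi> y = 0" for \<psi> using False by (simp add: stab_char_def stab_def)
  ultimately show ?thesis by simp
next
  case True
  then obtain a h where a: "a \<in> N" and h: "h \<in> M" and y_eq: "y = a \<otimes> h" by (rule L_cases)
  define u where "u = (\<lambda>m. m \<otimes> a \<otimes> (h \<otimes> inv m \<otimes> inv h))"
  have cardN: "(of_nat (card N) :: complex) \<noteq> 0" using subgroup.finite_imp_card_positive[OF N fin] by simp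
  have uN: "u m \<in> N" if m: "m \<in> N" for m
    using conjN[of h "inv m"] h m a N by (simp add: u_def subgroup.m_closed subgroup.m_inv_closed)
  have "m \<otimes> y \<otimes> inv m \<in> M \<longleftrightarrow> u m \<in> M" if m: "m \<in> N" for m
  proof -
    have eq: "m \<otimes> y \<otimes> inv m = u m \<otimes> h" using m a h by (simp add: y_eq u_def m_assoc)
    moreover have "u m \<otimes> h \<in> M \<longleftrightarrow> u m \<in> M"
    proof
      assume "u m \<otimes> h \<in> M"
      then have "u m \<otimes> h \<otimes> inv h \<in> M" using h M by (simp add: subgroup.m_closed subgroup.m_inv_closed)
      then show "u m \<in> M" using h uN[OF m] by (simp add: m_assoc)
    qed (use h M in \<open>simp add: subgroup.m_closed\<close>)
    ultimately show ?thesis by simp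
  qed
  \<comment> \<open>The factor \<open>card N\<close> turns the indicator into the right-hand side of
    \<open>X_sum\<close>.\<close>
  then have "of_nat (card N) * (\<Sum>m\<in>N. if m \<otimes> y \<otimes> inv m \<in> M then 1 else (0 :: complex)) =
      (\<Sum>m\<in>N. if u m \<in> M \<inter> N then of_nat (card N) else 0)"
    unfolding sum_distrib_left using uN by (intro sum.cong) auto
  also have "\<dots> = (\<Sum>m\<in>N. (\<Sum>\<psi>\<in>X. \<psi> (u m)) * of_nat (card (M \<inter> N)))"
    using X_sum uN by (intro sum.cong) auto
  also have "\<dots> = of_nat (card (M \<inter> N)) * (\<Sum>m\<in>N. \<Sum>\<psi>\<in>X. \<psi> (u m))"
    by (simp add: sum_distrib_left mult.commute)
  also have "(\<Sum>m\<in>N. \<Sum>\<psi>\<in>X. \<psi> (u m)) = (\<Sum>\<psi>\<in>X. \<Sum>m\<in>N. \<psi> (u m))" by (rule sum.swap)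
  also have "\<dots> = (\<Sum>\<psi>\<in>X. of_nat (card N) * stab_char \<psi> y)"
    unfolding u_def y_eq using twisted_sum[OF _ a h] by (rule sum.cong[OF refl])
  also have "\<dots> = of_nat (card N) * (\<Sum>\<psi>\<in>X. stab_char \<psi> y)" by (simp add: sum_distrib_left)
  finally show ?thesis using cardN by (simp add: mult.left_commute)
qed

text \<open>Summing over all of \<open>X\<close> with weights \<open>card (stab \<psi>)\<close>, rather than over the orbits of \<open>N M\<close>
  on \<open>X\<close>, avoids choosing orbit representatives.\<close>

lemma Ind_decomposition:
  assumes \<chi>: "lin_char G (carrier G) \<chi>" and g: "g \<in> carrier G"
  shows "of_nat (card N * card M) * Ind G M (\<lambda>g. if g \<in> M then \<chi> g else 0) g =
    (\<Sum>\<psi>\<in>X. of_nat (card (M \<inter> N) * card (stab \<psi>)) * Ind G (stab \<psi>) (\<lambda>g. stab_char \<psi> g * \<chi> g) g)"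
proof -
  define f where "f = (\<lambda>g. if g \<in> M then \<chi> g else 0)"
  have cardpos: "(of_nat (card H) :: complex) \<noteq> 0" if "subgroup H G" for H
    using subgroup.finite_imp_card_positive[OF that fin] by simp
  have "of_nat (card N * card M) * Ind G M f g = of_nat (card N) * (\<Sum>x\<in>carrier G. f (x \<otimes> g \<otimes> inv x))"
    using g cardpos[OF M] by (simp add: Ind_def)
  also have "\<dots> = (\<Sum>m\<in>N. \<Sum>x\<in>carrier G. f (x \<otimes> g \<otimes> inv x))" by simp
  \<comment> \<open>Translating x by m leaves each inner sum unchanged. The factor
    \<open>card N\<close> thus pays for an average over conjugation by \<open>N\<close>, which
    \<open>conjugates_count\<close> evaluates.\<close>
  also have "\<dots> = (\<Sum>m\<in>N. \<Sum>x\<in>carrier G. f ((m \<otimes> x) \<otimes> g \<otimes> inv (m \<otimes> x)))"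
    using sum_left_translate[of _ "\<lambda>x. f (x \<otimes> g \<otimes> inv x)"] by simp
  also have "\<dots> = (\<Sum>x\<in>carrier G. \<Sum>m\<in>N. f ((m \<otimes> x) \<otimes> g \<otimes> inv (m \<otimes> x)))" by (rule sum.swap)
  also have "\<dots> = (\<Sum>x\<in>carrier G. \<Sum>\<psi>\<in>X. of_nat (card (M \<inter> N)) * (stab_char \<psi> (x \<otimes> g \<otimes> inv x) * \<chi> (x \<otimes> g \<otimes> inv x)))"
  proof (rule sum.cong[OF refl])
    fix x assume x: "x \<in> carrier G"
    define y where "y = x \<otimes> g \<otimes> inv x"
    have y: "y \<in> carrier G" using x g by (simp add: y_def)
    have "(\<Sum>m\<in>N. f ((m \<otimes> x) \<otimes> g \<otimes> inv (m \<otimes> x))) = (\<Sum>m\<in>N. (if m \<otimes> y \<otimes> inv m \<in> M then 1 else 0) * \<chi> y)"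
    proof (rule sum.cong[OF refl])
      fix m assume m: "m \<in> N"
      have "(m \<otimes> x) \<otimes> g \<otimes> inv (m \<otimes> x) = m \<otimes> y \<otimes> inv m"
        using m x g by (simp add: y_def m_assoc inv_mult_group)
      moreover have "\<chi> (m \<otimes> y \<otimes> inv m) = \<chi> y"
        using lin_char_conjugate[OF \<chi> subgroup_self] m y by simp
      ultimately show "f ((m \<otimes> x) \<otimes> g \<otimes> inv (m \<otimes> x)) = (if m \<otimes> y \<otimes> inv m \<in> M then 1 else 0) * \<chi> y"
        by (simp add: f_def)
    qed
    also have "\<dots> = of_nat (card (M \<inter> N)) * (\<Sum>\<psi>\<in>X. stab_char \<psi> y) * \<chi> y"
      unfolding sum_distrib_right[symmetric] conjugates_count[OF y] ..
    also have "\<dots> = (\<Sum>\<psi>\<in>X. of_nat (card (M \<inter> N)) * (stab_char \<psi> y * \<chi> y))"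
      by (simp add: sum_distrib_left sum_distrib_right mult.assoc)
    finally show "(\<Sum>m\<in>N. f ((m \<otimes> x) \<otimes> g \<otimes> inv (m \<otimes> x))) =
        (\<Sum>\<psi>\<in>X. of_nat (card (M \<inter> N)) * (stab_char \<psi> (x \<otimes> g \<otimes> inv x) * \<chi> (x \<otimes> g \<otimes> inv x)))"
      by (simp add: y_def)
  qed
  also have "\<dots> = (\<Sum>\<psi>\<in>X. \<Sum>x\<in>carrier G. of_nat (card (M \<inter> N)) * (stab_char \<psi> (x \<otimes> g \<otimes> inv x) * \<chi> (x \<otimes> g \<otimes> inv x)))"
    by (rule sum.swap)
  also have "\<dots> = (\<Sum>\<psi>\<in>X. of_nat (card (M \<inter> N) * card (stab \<psi>)) * Ind G (stab \<psi>) (\<lambda>g. stab_char \<psi> g * \<chi> g) g)"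
  proof (rule sum.cong[OF refl])
    fix \<psi> assume \<psi>: "\<psi> \<in> X"
    show "(\<Sum>x\<in>carrier G. of_nat (card (M \<inter> N)) * (stab_char \<psi> (x \<otimes> g \<otimes> inv x) * \<chi> (x \<otimes> g \<otimes> inv x))) =
        of_nat (card (M \<inter> N) * card (stab \<psi>)) * Ind G (stab \<psi>) (\<lambda>g. stab_char \<psi> g * \<chi> g) g"
      using g cardpos[OF stab_subgroup[OF \<psi>]] by (simp add: Ind_def flip: sum_distrib_left)
  qed
  finally show ?thesis by (simp add: f_def)
qed

text \<open>Hence the trivial character contributes to \<open>Ind_decomposition\<close> the
  character induced from all of \<open>L\<close>.\<close>

lemma stab_trivial: "stab (\<lambda>g. if g \<in> N then 1 else 0) = L"
  using conjN by (auto simp: stab_def)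

text \<open>This compares the weight of the trivial character in \<open>Ind_decomposition\<close>
  with the factor on its left-hand side.\<close>

lemma card_product_le: "card N * card M \<le> card (M \<inter> N) * card L"
proof -
  have "\<exists>a. a \<in> N \<and> (\<exists>h\<in>M. y = a \<otimes> h)" if "y \<in> L" for y using that by (auto simp: set_mult_def)
  then obtain \<alpha> where \<alpha>: "\<And>y. y \<in> L \<Longrightarrow> \<alpha> y \<in> N \<and> (\<exists>h\<in>M. y = \<alpha> y \<otimes> h)" by metis
  \<comment> \<open>\<open>\<alpha>\<close> picks an \<open>N\<close>-component of each element of
    \<open>L\<close>. Two \<open>N\<close>-components differ by an element of M \<inter> N;
    recording that element and the product determines a and then h.\<close>
  define f where "f = (\<lambda>(a, h). (inv (\<alpha> (a \<otimes> h)) \<otimes> a, a \<otimes> h))"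
  have "f ` (N \<times> M) \<subseteq> (M \<inter> N) \<times> L"
  proof (clarsimp simp: f_def)
    fix a h assume a: "a \<in> N" and h: "h \<in> M"
    obtain k where k: "k \<in> M" "a \<otimes> h = \<alpha> (a \<otimes> h) \<otimes> k" and N': "\<alpha> (a \<otimes> h) \<in> N" using \<alpha>[OF L_I[OF a h]] by blast
    have "inv (\<alpha> (a \<otimes> h)) \<otimes> a = inv (\<alpha> (a \<otimes> h)) \<otimes> (a \<otimes> h) \<otimes> inv h"
      using a h N' by (simp add: m_assoc)
    also have "inv (\<alpha> (a \<otimes> h)) \<otimes> (a \<otimes> h) = k" using k N' by (metis Mc Nc inv_mult_cancel(1))
    finally have "inv (\<alpha> (a \<otimes> h)) \<otimes> a \<in> M" using k h M by (simp add: subgroup.m_closed subgroup.m_inv_closed)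
    moreover have "inv (\<alpha> (a \<otimes> h)) \<otimes> a \<in> N" using N' a N by (simp add: subgroup.m_closed subgroup.m_inv_closed)
    ultimately show "inv \<alpha> (a \<otimes> h) \<otimes> a \<in> M \<and> inv \<alpha> (a \<otimes> h) \<otimes> a \<in> N \<and> a \<otimes> h \<in> L" using L_I[OF a h] by simp
  qed
  moreover have "inj_on f (N \<times> M)"
  proof (rule inj_onI, clarsimp simp: f_def)
    fix a h a' h' assume *: "a \<in> N" "h \<in> M" "a' \<in> N" "h' \<in> M" "a \<otimes> h = a' \<otimes> h'"
      "inv (\<alpha> (a' \<otimes> h')) \<otimes> a = inv (\<alpha> (a' \<otimes> h')) \<otimes> a'"
    have "\<alpha> (a' \<otimes> h') \<in> N" using \<alpha>[OF L_I] * by simp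
    then have "a = a'" using * by (metis Nc inv_mult_cancel(2))
    then show "a = a' \<and> h = h'" using * by (metis Nc Mc inv_mult_cancel(1))
  qed
  moreover have "finite ((M \<inter> N) \<times> L)"
    using finite_subset[OF subgroup.subset[OF L]] finite_subset[OF subgroup.subset[OF M]] by simp
  ultimately have "card (N \<times> M) \<le> card ((M \<inter> N) \<times> L)" by (metis card_inj_on_le)
  then show ?thesis by (simp add: card_cartesian_product)
qed

end

section \<open>Sums of characters\<close>

lemma sum_lessThan_add:
  fixes f :: "nat \<Rightarrow> 'c :: comm_monoid_add"
  shows "(\<Sum>i<m + n. f i) = (\<Sum>i<m. f i) + (\<Sum>i<n. f (m + i))"
  by (induction n) (auto simp: add.assoc)

lemma is_character_add:
  assumes "is_character G H \<phi>" "is_character G H \<psi>"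
  shows "is_character G H (\<lambda>g. \<phi> g + \<psi> g)"
proof -
  obtain n \<rho> where \<rho>: "is_rep G H n \<rho>" and \<phi>: "\<And>g. \<phi> g = (if g \<in> H then mat_trace (\<rho> g) else 0)"
    using assms(1) by (auto simp: is_character_def affords_def)
  obtain m \<sigma> where \<sigma>: "is_rep G H m \<sigma>" and \<psi>: "\<And>g. \<psi> g = (if g \<in> H then mat_trace (\<sigma> g) else 0)"
    using assms(2) by (auto simp: is_character_def affords_def)
  define \<tau> where "\<tau> = (\<lambda>h. four_block_mat (\<rho> h) (0\<^sub>m n m) (0\<^sub>m m n) (\<sigma> h))"
  have c: "\<rho> h \<in> carrier_mat n n" "\<sigma> h \<in> carrier_mat m m" if "h \<in> H" for h
    using \<rho> \<sigma> that by (auto simp: is_rep_def)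
  have "is_rep G H (n + m) \<tau>"
    unfolding is_rep_def
  proof (intro conjI ballI)
    show "\<tau> h \<in> carrier_mat (n + m) (n + m)" if "h \<in> H" for h
      using c[OF that] by (simp add: \<tau>_def)
    show "\<tau> \<one>\<^bsub>G\<^esub> = 1\<^sub>m (n + m)" using \<rho> \<sigma> by (simp add: \<tau>_def is_rep_def)
    fix g h assume gh: "g \<in> H" "h \<in> H"
    have "\<tau> g * \<tau> h = four_block_mat (\<rho> g * \<rho> h + 0\<^sub>m n m * 0\<^sub>m m n) (\<rho> g * 0\<^sub>m n m + 0\<^sub>m n m * \<sigma> h)
        (0\<^sub>m m n * \<rho> h + \<sigma> g * 0\<^sub>m m n) (0\<^sub>m m n * 0\<^sub>m n m + \<sigma> g * \<sigma> h)"
      unfolding \<tau>_def using c[OF gh(1)] c[OF gh(2)] by (intro mult_four_block_mat) auto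
    also have "\<dots> = four_block_mat (\<rho> g * \<rho> h) (0\<^sub>m n m) (0\<^sub>m m n) (\<sigma> g * \<sigma> h)"
      using c[OF gh(1)] c[OF gh(2)] by simp
    finally show "\<tau> (g \<otimes>\<^bsub>G\<^esub> h) = \<tau> g * \<tau> h" using \<rho> \<sigma> gh by (simp add: \<tau>_def is_rep_def)
  qed
  moreover have "mat_trace (\<tau> h) = mat_trace (\<rho> h) + mat_trace (\<sigma> h)" if "h \<in> H" for h
    using c[OF that] by (simp add: \<tau>_def mat_trace_def sum_lessThan_add)
  ultimately have "affords G H (n + m) \<tau> (\<lambda>g. \<phi> g + \<psi> g)"
    by (simp add: affords_def \<phi> \<psi>)
  then show ?thesis unfolding is_character_def by blast
qed

text \<open>Afforded by the representation of degree 0; it starts the inductions on sums and, with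
  additivity, forces \<open>n\<close> to vanish at 0.\<close>

lemma is_character_zero: "is_character G H (\<lambda>g. 0)"
proof -
  have "affords G H 0 (\<lambda>h. 1\<^sub>m 0) (\<lambda>g. 0)" by (simp add: affords_def is_rep_def)
  then show ?thesis unfolding is_character_def by blast
qed

lemma is_character_scale:
  assumes "is_character G H \<phi>"
  shows "is_character G H (\<lambda>g. of_nat k * \<phi> g)"
proof (induction k)
  case 0
  then show ?case using is_character_zero by simp
next
  case (Suc k)
  have "(\<lambda>g. of_nat (Suc k) * \<phi> g) = (\<lambda>g. \<phi> g + of_nat k * \<phi> g)" by (simp add: fun_eq_iff algebra_simps)
  then show ?case using is_character_add[OF assms Suc] by simp
qed

lemma is_character_sum:
  assumes "finite I" "\<And>i. i \<in> I \<Longrightarrow> is_character G H (\<phi> i)"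
  shows "is_character G H (\<lambda>g. \<Sum>i\<in>I. of_nat (a i) * \<phi> i g)"
  using assms
proof (induction I rule: finite_induct)
  case empty
  then show ?case using is_character_zero by simp
next
  case (insert i I)
  then have "is_character G H (\<lambda>g. of_nat (a i) * \<phi> i g + (\<Sum>i\<in>I. of_nat (a i) * \<phi> i g))"
    by (intro is_character_add is_character_scale) auto
  then show ?case using insert.hyps by simp
qed

lemma (in group) lin_char_restrict:
  assumes "lin_char G (carrier G) \<chi>" "subgroup H G"
  shows "lin_char G H (\<lambda>g. if g \<in> H then \<chi> g else 0)"
  using assms subgroup.mem_carrier[OF assms(2)] subgroup.one_closed[OF assms(2)] subgroup.m_closed[OF assms(2)]
  by (simp add: lin_char_def)

lemma (in group) lin_char_mult:
  assumes "lin_char G H \<phi>" "lin_char G (carrier G) \<chi>" "subgroup H G"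
  shows "lin_char G H (\<lambda>g. \<phi> g * \<chi> g)"
  using assms subgroup.mem_carrier[OF assms(3)] by (simp add: lin_char_def mult_ac)

section \<open>Artin--Heilbronn functionals\<close>

locale heilbronn = fin_group G for G (structure) +
  fixes n :: "'a set \<Rightarrow> ('a \<Rightarrow> complex) \<Rightarrow> int"
  assumes n_add: "\<And>H \<phi> \<psi>. subgroup H G \<Longrightarrow> is_character G H \<phi> \<Longrightarrow> is_character G H \<psi> \<Longrightarrow>
      n H (\<lambda>g. \<phi> g + \<psi> g) = n H \<phi> + n H \<psi>"
    and n_Ind: "\<And>H \<phi>. subgroup H G \<Longrightarrow> is_character G H \<phi> \<Longrightarrow> n (carrier G) (Ind G H \<phi>) = n H \<phi>"
    and n_nonneg: "\<And>H \<phi>. subgroup H G \<Longrightarrow> is_linear_character G H \<phi> \<Longrightarrow> 0 \<le> n H \<phi>"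
begin

lemma n_lin_nonneg:
  assumes "subgroup H G" "lin_char G H \<phi>"
  shows "0 \<le> n H \<phi>"
  using n_nonneg[OF assms(1)] is_linear_character_iff[of G H \<phi>] assms
  by (simp add: subgroup.one_closed subgroup.m_closed)

lemma n_zero: "subgroup H G \<Longrightarrow> n H (\<lambda>g. 0) = 0"
  using n_add[OF _ is_character_zero is_character_zero, of H] by simp

lemma n_scale:
  assumes H: "subgroup H G" and \<phi>: "is_character G H \<phi>"
  shows "n H (\<lambda>g. of_nat k * \<phi> g) = int k * n H \<phi>"
proof (induction k)
  case 0
  then show ?case using n_zero[OF H] by simp
next
  case (Suc k)
  have "(\<lambda>g. of_nat (Suc k) * \<phi> g) = (\<lambda>g. \<phi> g + of_nat k * \<phi> g)" by (simp add: fun_eq_iff algebra_simps)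
  then show ?case using n_add[OF H \<phi> is_character_scale[OF \<phi>]] Suc by (simp add: algebra_simps)
qed

lemma n_sum:
  assumes H: "subgroup H G" and "finite I" "\<And>i. i \<in> I \<Longrightarrow> is_character G H (\<phi> i)"
  shows "n H (\<lambda>g. \<Sum>i\<in>I. of_nat (a i) * \<phi> i g) = (\<Sum>i\<in>I. int (a i) * n H (\<phi> i))"
  using assms(2,3)
proof (induction I rule: finite_induct)
  case empty
  then show ?case using n_zero[OF H] by simp
next
  case (insert i I)
  then have "n H (\<lambda>g. of_nat (a i) * \<phi> i g + (\<Sum>i\<in>I. of_nat (a i) * \<phi> i g)) =
      n H (\<lambda>g. of_nat (a i) * \<phi> i g) + n H (\<lambda>g. \<Sum>i\<in>I. of_nat (a i) * \<phi> i g)"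
    by (intro n_add[OF H] is_character_scale is_character_sum) auto
  then show ?case using insert n_scale[OF H] by simp
qed

text \<open>Applying \<open>n\<close> to \<open>Ind_decomposition\<close> gives an identity of
  integers in which every term on the right is a positive weight times \<open>n\<close> of a linear
  character, hence nonnegative. Keeping only the trivial \<psi>, whose term belongs to
  \<open>N <#> M\<close>, gives the inequality.\<close>

lemma n_abelian_step:
  assumes M: "subgroup M G" and N: "N \<lhd> G"
    and comm: "\<And>x y. x \<in> N \<Longrightarrow> y \<in> N \<Longrightarrow> x \<otimes> y \<otimes> inv x \<otimes> inv y \<in> M"
    and \<chi>: "lin_char G (carrier G) \<chi>"
  shows "n (N <#> M) (\<lambda>g. if g \<in> N <#> M then \<chi> g else 0) \<le> n M (\<lambda>g. if g \<in> M then \<chi> g else 0)"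
proof -
  have Ns: "subgroup N G" by (rule normal_imp_subgroup[OF N])
  have K: "subgroup (M \<inter> N) G" by (rule subgroups_Inter_pair[OF M Ns])
  have commN: "x \<otimes> y \<otimes> inv x \<otimes> inv y \<in> M \<inter> N" if "x \<in> N" "y \<in> N" for x y
    using comm[OF that] that Ns by (simp add: subgroup.m_closed subgroup.m_inv_closed)
  define triv where "triv = (\<lambda>g. if g \<in> N then 1 else (0 :: complex))"
  from subgroup_quotient_dual[OF Ns K _ commN] obtain X where X: "finite X"
      "\<forall>\<psi>\<in>X. lin_char G N \<psi> \<and> (\<forall>u\<in>M \<inter> N. \<psi> u = 1)"
      "\<forall>u\<in>N. (\<Sum>\<psi>\<in>X. \<psi> u) * of_nat (card (M \<inter> N)) = (if u \<in> M \<inter> N then of_nat (card N) else 0)"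
      "triv \<in> X"
    unfolding triv_def by blast
  interpret S: abelian_step G M N X
    by (intro abelian_step.intro abelian_step_axioms.intro fin_group_axioms M N) (use X in auto)
  define f where "f = (\<lambda>g. if g \<in> M then \<chi> g else 0)"
  have f: "lin_char G M f" unfolding f_def by (rule lin_char_restrict[OF \<chi> M])
  define e where "e = (\<lambda>\<psi> g. S.stab_char \<psi> g * \<chi> g)"
  have e: "lin_char G (S.stab \<psi>) (e \<psi>)" if "\<psi> \<in> X" for \<psi>
    unfolding e_def by (rule lin_char_mult[OF S.stab_char_lin_char[OF that] \<chi> S.stab_subgroup[OF that]])
  have n_Ind_lin: "n (carrier G) (Ind G H \<phi>) = n H \<phi>" if "subgroup H G" "lin_char G H \<phi>" for H \<phi>
    using n_Ind[OF that(1) lin_char_is_character[OF that(2)]] .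
  have Ind_char: "is_character G (carrier G) (Ind G H \<phi>)" if "subgroup H G" "lin_char G H \<phi>" for H \<phi>
    by (rule Ind_linear_is_character[OF that(1) fin that(2)])
  have "(\<lambda>g. of_nat (card N * card M) * Ind G M f g) =
      (\<lambda>g. \<Sum>\<psi>\<in>X. of_nat (card (M \<inter> N) * card (S.stab \<psi>)) * Ind G (S.stab \<psi>) (e \<psi>) g)"
  proof
    fix g show "of_nat (card N * card M) * Ind G M f g =
      (\<Sum>\<psi>\<in>X. of_nat (card (M \<inter> N) * card (S.stab \<psi>)) * Ind G (S.stab \<psi>) (e \<psi>) g)"
    proof (cases "g \<in> carrier G")
      case True
      then show ?thesis using S.Ind_decomposition[OF \<chi> True] unfolding f_def e_def by simp
    qed (simp add: Ind_def)
  qed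
  then have "n (carrier G) (\<lambda>g. of_nat (card N * card M) * Ind G M f g) =
      n (carrier G) (\<lambda>g. \<Sum>\<psi>\<in>X. of_nat (card (M \<inter> N) * card (S.stab \<psi>)) * Ind G (S.stab \<psi>) (e \<psi>) g)"
    by simp
  also have "\<dots> = (\<Sum>\<psi>\<in>X. int (card (M \<inter> N) * card (S.stab \<psi>)) * n (carrier G) (Ind G (S.stab \<psi>) (e \<psi>)))"
    using Ind_char[OF S.stab_subgroup e] by (intro n_sum[OF subgroup_self X(1)])
  also have "\<dots> = (\<Sum>\<psi>\<in>X. int (card (M \<inter> N) * card (S.stab \<psi>)) * n (S.stab \<psi>) (e \<psi>))"
    using n_Ind_lin[OF S.stab_subgroup e] by simp
  finally have id: "int (card N * card M) * n M f =
      (\<Sum>\<psi>\<in>X. int (card (M \<inter> N) * card (S.stab \<psi>)) * n (S.stab \<psi>) (e \<psi>))"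
    unfolding n_scale[OF subgroup_self Ind_char[OF M f]] n_Ind_lin[OF M f] .
  have stab_triv: "S.stab triv = N <#> M" unfolding triv_def by (rule S.stab_trivial)
  have e_triv: "e triv = (\<lambda>g. if g \<in> N <#> M then \<chi> g else 0)"
  proof
    fix g show "e triv g = (if g \<in> N <#> M then \<chi> g else 0)"
    proof (cases "g \<in> N <#> M")
      case True
      then obtain a h where ah: "a \<in> N" "h \<in> M" "g = a \<otimes> h" by (rule S.L_cases)
      have "S.stab_char triv g = triv a"
        unfolding ah(3) by (rule S.stab_char_eq[OF X(4) ah(1,2)]) (use True ah stab_triv in simp)
      then show ?thesis using True ah by (simp add: e_def triv_def)
    qed (simp add: e_def S.stab_char_def stab_triv)
  qed
  \<comment> \<open>Nonnegativity of \<open>n\<close> at \<open>N <#> M\<close> is what allows the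
    weight to be enlarged by \<open>card_product_le\<close>.\<close>
  have "int (card N * card M) * n (N <#> M) (e triv) \<le> int (card (M \<inter> N) * card (N <#> M)) * n (N <#> M) (e triv)"
    using S.card_product_le n_lin_nonneg[OF S.L] e[OF X(4)] stab_triv
    by (intro mult_right_mono) (auto simp flip: of_nat_mult)
  also have "\<dots> = int (card (M \<inter> N) * card (S.stab triv)) * n (S.stab triv) (e triv)" by (simp add: stab_triv)
  also have "\<dots> \<le> (\<Sum>\<psi>\<in>X. int (card (M \<inter> N) * card (S.stab \<psi>)) * n (S.stab \<psi>) (e \<psi>))"
    using X(4,1) n_lin_nonneg[OF S.stab_subgroup e] by (intro member_le_sum) auto
  also have "\<dots> = int (card N * card M) * n M f" using id by simp
  finally have le: "int (card N * card M) * n (N <#> M) (e triv) \<le> int (card N * card M) * n M f" .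
  have "0 < int (card N * card M)"
    using subgroup.finite_imp_card_positive[OF M fin] subgroup.finite_imp_card_positive[OF Ns fin] by simp
  from mult_left_le_imp_le[OF le this] show ?thesis unfolding f_def e_triv .
qed

text \<open>Induction along the derived series, using \<open>n_abelian_step\<close> with
  \<open>N\<close> = \<open>D i\<close> and \<open>M\<close> = \<open>D (Suc i) <#> H\<close>.
  Commutators of \<open>D i\<close> lie in \<open>D (Suc i)\<close>, hence in \<open>M\<close>. The
  chain begins at the whole group and reaches \<open>H\<close> once the derived series is
  trivial.\<close>

lemma n_restrict_ge:
  assumes solv: "solvable G" and H: "subgroup H G" and \<chi>: "lin_char G (carrier G) \<chi>"
  shows "n (carrier G) \<chi> \<le> n H (\<lambda>g. if g \<in> H then \<chi> g else 0)"
proof -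
  define D where "D = (\<lambda>i. (derived G ^^ i) (carrier G))"
  have DSuc: "D (Suc i) = derived G (D i)" for i by (simp add: D_def)
  have Dnorm: "D i \<lhd> G" for i
  proof (induction i)
    case 0
    show ?case using normal_invI[OF subgroup_self] by (simp add: D_def)
  next
    case (Suc i)
    then show ?case unfolding DSuc by (rule derived_is_normal)
  qed
  have Dsub: "subgroup (D i) G" for i by (rule normal_imp_subgroup[OF Dnorm])
  define r where "r = (\<lambda>H g. if g \<in> H then \<chi> g else 0)"
  have ge: "n (carrier G) \<chi> \<le> n (D i <#> H) (r (D i <#> H))" for i
  proof (induction i)
    case 0
    have "carrier G <#> H = carrier G"
    proof
      show "carrier G <#> H \<subseteq> carrier G" using subgroup.subset[OF H] by (simp add: setmult_subset_G)
      show "carrier G \<subseteq> carrier G <#> H"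
      proof
        fix x assume "x \<in> carrier G"
        then have "x = x \<otimes> \<one>" "x \<in> carrier G" by auto
        then show "x \<in> carrier G <#> H" using subgroup.one_closed[OF H] unfolding set_mult_def by blast
      qed
    qed
    moreover have "r (carrier G) = \<chi>" using \<chi> by (auto simp: r_def lin_char_def)
    ultimately show ?case by (simp add: D_def)
  next
    case (Suc i)
    define M where "M = D (Suc i) <#> H"
    have M: "subgroup M G" unfolding M_def by (rule mult_norm_subgroup[OF Dnorm H])
    have DS: "D (Suc i) \<subseteq> D i" unfolding DSuc by (rule derived_incl[OF _ Dsub]) simp
    have DM: "D (Suc i) \<subseteq> M"
    proof
      fix x assume x: "x \<in> D (Suc i)"
      then have "x = x \<otimes> \<one>" using subgroup.mem_carrier[OF Dsub] by simp
      then show "x \<in> M" using x subgroup.one_closed[OF H] unfolding M_def set_mult_def by blast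
    qed
    have HM: "H \<subseteq> M"
    proof
      fix x assume x: "x \<in> H"
      then have "x = \<one> \<otimes> x" using subgroup.mem_carrier[OF H] by simp
      then show "x \<in> M" using x subgroup.one_closed[OF Dsub] unfolding M_def set_mult_def by blast
    qed
    \<comment> \<open>The factor \<open>D (Suc i)\<close> inside \<open>M\<close> is absorbed by the
      larger \<open>D i\<close>, so consecutive steps fit together.\<close>
    have "D i <#> M = D i <#> H"
    proof
      show "D i <#> H \<subseteq> D i <#> M" using HM unfolding set_mult_def by blast
      show "D i <#> M \<subseteq> D i <#> H"
      proof
        fix x assume "x \<in> D i <#> M"
        then obtain a b h where *: "a \<in> D i" "b \<in> D (Suc i)" "h \<in> H" "x = a \<otimes> (b \<otimes> h)"
          unfolding M_def set_mult_def by blast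
        then have "x = (a \<otimes> b) \<otimes> h" using subgroup.mem_carrier[OF Dsub] subgroup.mem_carrier[OF H] by (simp add: m_assoc)
        moreover have "a \<otimes> b \<in> D i" using * DS subgroup.m_closed[OF Dsub] by blast
        ultimately show "x \<in> D i <#> H" using *(3) unfolding set_mult_def by blast
      qed
    qed
    moreover have "x \<otimes> y \<otimes> inv x \<otimes> inv y \<in> M" if "x \<in> D i" "y \<in> D i" for x y
    proof -
      have "x \<otimes> y \<otimes> inv x \<otimes> inv y \<in> derived G (D i)"
        unfolding derived_def by (rule generate.incl) (use that in blast)
      then show ?thesis using DM DSuc by auto
    qed
    then have "n (D i <#> M) (r (D i <#> M)) \<le> n M (r M)"
      unfolding r_def by (rule n_abelian_step[OF M Dnorm _ \<chi>])
    ultimately show ?case using Suc unfolding M_def by simp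
  qed
  obtain k where "D k = {\<one>}" using solv solvable_iff_trivial_derived_seq by (auto simp: D_def)
  moreover have "{\<one>} <#> H = H" using subgroup.mem_carrier[OF H] by (force simp: set_mult_def)
  ultimately show ?thesis using ge[of k] by (simp add: r_def)
qed

end

section \<open>Restriction of theta to subgroups and the final estimate\<close>

lemma (in fin_group) cform_commute: "cform f h = cform h f"
proof -
  have "(\<Sum>g\<in>carrier G. f g * h (inv g)) = (\<Sum>g\<in>carrier G. h g * f (inv g))"
    by (rule sum.reindex_bij_witness[of _ "m_inv G" "m_inv G"]) (auto simp: mult.commute)
  then show ?thesis by (simp add: cform_def)
qed

lemma (in group) generate_singleton_commute:
  assumes g: "g \<in> carrier G" and "x \<in> generate G {g}" "y \<in> generate G {g}"
  shows "x \<otimes> y = y \<otimes> x"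
proof -
  obtain i j :: int where "x = g [^] i" "y = g [^] j" using assms generate_pow[OF g] by auto
  then show ?thesis using int_pow_mult[OF g, of i j] int_pow_mult[OF g, of j i] by (simp add: add.commute)
qed

context heilbronn
begin

definition theta :: "('a \<Rightarrow> complex) \<Rightarrow> 'a \<Rightarrow> complex" where
  "theta \<chi>\<^sub>0 g = (\<Sum>\<psi>\<in>Irr G - {\<chi>\<^sub>0}. of_int (n (carrier G) \<psi>) * \<psi> g)"

text \<open>Expanding the induced character as a sum of m(\<psi>) \<psi> makes n(C, \<phi>) the sum
  of m(\<psi>) n(G, \<psi>), and by reciprocity the same m(\<psi>) are the coefficients of \<phi> in
  the restrictions of the \<psi>. Both sides lose their \<chi>_0 term.\<close>

lemma theta_multiplicity_nonneg:
  assumes solv: "solvable G" and \<chi>: "lin_char G (carrier G) \<chi>\<^sub>0"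
    and C: "subgroup C G" and \<phi>: "lin_char G C \<phi>"
  shows "\<exists>k\<ge>0. (\<Sum>h\<in>C. \<phi> h * theta \<chi>\<^sub>0 (inv h)) / of_nat (card C) = of_int k"
proof -
  define r where "r = (\<lambda>g. if g \<in> C then \<chi>\<^sub>0 g else 0)"
  have \<chi>Irr: "\<chi>\<^sub>0 \<in> Irr G" by (rule lin_char_in_Irr[OF \<chi>])
  have Ind: "is_character G (carrier G) (Ind G C \<phi>)" by (rule Ind_linear_is_character[OF C fin \<phi>])
  obtain m where m: "Ind G C \<phi> = (\<lambda>g. \<Sum>\<psi>\<in>Irr G. of_nat (m \<psi>) * \<psi> g)"
    "\<And>\<psi>. \<psi> \<in> Irr G \<Longrightarrow> cform (Ind G C \<phi>) \<psi> = of_nat (m \<psi>)"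
    using character_expansion[OF Ind] by blast
  have "n C \<phi> = n (carrier G) (Ind G C \<phi>)" using n_Ind[OF C lin_char_is_character[OF \<phi>]] by simp
  also have "\<dots> = (\<Sum>\<psi>\<in>Irr G. int (m \<psi>) * n (carrier G) \<psi>)"
    unfolding m(1) using Irr_is_character by (intro n_sum[OF subgroup_self finite_Irr])
  also have "\<dots> = int (m \<chi>\<^sub>0) * n (carrier G) \<chi>\<^sub>0 + (\<Sum>\<psi>\<in>Irr G - {\<chi>\<^sub>0}. int (m \<psi>) * n (carrier G) \<psi>)"
    by (rule sum.remove[OF finite_Irr \<chi>Irr])
  finally have nC: "n C \<phi> = \<dots>" .
  have mult: "(\<Sum>h\<in>C. \<phi> h * \<psi> (inv h)) / of_nat (card C) = of_nat (m \<psi>)" if "\<psi> \<in> Irr G" for \<psi>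
    using frobenius_reciprocity[OF C \<phi> Irr_is_character[OF that]] m(2)[OF that] by simp
  have "(\<Sum>h\<in>C. \<phi> h * theta \<chi>\<^sub>0 (inv h)) / of_nat (card C) =
      (\<Sum>\<psi>\<in>Irr G - {\<chi>\<^sub>0}. of_int (n (carrier G) \<psi>) * ((\<Sum>h\<in>C. \<phi> h * \<psi> (inv h)) / of_nat (card C)))"
    unfolding theta_def sum_distrib_left sum_divide_distrib
    by (subst sum.swap) (simp add: mult_ac)
  also have "\<dots> = of_int (\<Sum>\<psi>\<in>Irr G - {\<chi>\<^sub>0}. int (m \<psi>) * n (carrier G) \<psi>)"
    using mult by (simp add: mult.commute)
  finally have eq: "(\<Sum>h\<in>C. \<phi> h * theta \<chi>\<^sub>0 (inv h)) / of_nat (card C) =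
      of_int (\<Sum>\<psi>\<in>Irr G - {\<chi>\<^sub>0}. int (m \<psi>) * n (carrier G) \<psi>)" .
  have r: "lin_char G C r" unfolding r_def by (rule lin_char_restrict[OF \<chi> C])
  interpret C: fin_group "G\<lparr>carrier := C\<rparr>" by (rule subgroup_fin_group[OF C])
  have lift: "\<theta> \<in> Irr (G\<lparr>carrier := C\<rparr>)" if "lin_char G C \<theta>" for \<theta>
    by (rule lin_char_in_Irr) (use that in \<open>simp add: lin_char_def\<close>)
  \<comment> \<open>The restriction of \<chi>_0 to \<open>C\<close> is again linear, hence
    irreducible, so its product with \<phi> is 0 or 1 by orthonormality on \<open>C\<close>.\<close>
  have "of_nat (m \<chi>\<^sub>0) = C.cform \<phi> r"
    unfolding C.cform_def mult[OF \<chi>Irr, symmetric]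
    using subgroup.m_inv_closed[OF C] by (simp add: m_inv_consistent[OF C] r_def)
  also have "\<dots> = (if \<phi> = r then 1 else 0)" using C.Irr_orthonormal[OF lift[OF \<phi>] lift[OF r]] .
  finally have m0: "m \<chi>\<^sub>0 = (if \<phi> = r then 1 else 0)" by (auto split: if_splits)
  \<comment> \<open>If \<phi> differs from the restriction of \<chi>_0, the sum equals n(C, \<phi>),
    covered by ACH3; otherwise n(G, \<chi>_0) is subtracted and \<open>n_restrict_ge\<close>
    applies.\<close>
  have "0 \<le> (\<Sum>\<psi>\<in>Irr G - {\<chi>\<^sub>0}. int (m \<psi>) * n (carrier G) \<psi>)"
    using nC m0 n_lin_nonneg[OF C \<phi>] n_restrict_ge[OF solv C \<chi>] by (auto simp: r_def split: if_splits)
  with eq show ?thesis by blast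
qed

text \<open>On the cyclic group generated by g, theta is a sum of linear characters with nonnegative
  integer coefficients. Their values at g have modulus 1 and their values at the identity are 1, so
  the triangle inequality suffices.\<close>

lemma theta_bound:
  assumes solv: "solvable G" and \<chi>: "lin_char G (carrier G) \<chi>\<^sub>0" and g: "g \<in> carrier G"
  shows "norm (theta \<chi>\<^sub>0 g) \<le> Re (theta \<chi>\<^sub>0 \<one>)"
proof -
  define C where "C = generate G {g}"
  have C: "subgroup C G" unfolding C_def using g by (intro generate_is_subgroup) simp
  have gC: "g \<in> C" unfolding C_def by (rule generate.incl) simp
  interpret C: fin_group "G\<lparr>carrier := C\<rparr>" by (rule subgroup_fin_group[OF C])
  have comm: "x \<otimes>\<^bsub>G\<lparr>carrier := C\<rparr>\<^esub> y = y \<otimes>\<^bsub>G\<lparr>carrier := C\<rparr>\<^esub> x"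
    if "x \<in> carrier (G\<lparr>carrier := C\<rparr>)" "y \<in> carrier (G\<lparr>carrier := C\<rparr>)" for x y
    using generate_singleton_commute[OF g] that by (simp add: C_def)
  define I where "I = Irr (G\<lparr>carrier := C\<rparr>)"
  have lin: "lin_char G C \<phi>" if "\<phi> \<in> I" for \<phi>
    using C.Irr_commutative_linear[OF comm] that by (simp add: I_def lin_char_def)
  have "\<exists>k\<ge>0. C.cform (theta \<chi>\<^sub>0) \<phi> = of_int k" if "\<phi> \<in> I" for \<phi>
  proof -
    have "C.cform (theta \<chi>\<^sub>0) \<phi> = (\<Sum>h\<in>C. \<phi> h * theta \<chi>\<^sub>0 (inv h)) / of_nat (card C)"
      unfolding C.cform_commute[of "theta \<chi>\<^sub>0"] by (simp add: C.cform_def m_inv_consistent[OF C])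
    then show ?thesis using theta_multiplicity_nonneg[OF solv \<chi> C lin[OF that]] by simp
  qed
  then obtain k where k: "\<And>\<phi>. \<phi> \<in> I \<Longrightarrow> 0 \<le> k \<phi> \<and> C.cform (theta \<chi>\<^sub>0) \<phi> = of_int (k \<phi>)" by metis
  have expand: "theta \<chi>\<^sub>0 c = (\<Sum>\<phi>\<in>I. of_int (k \<phi>) * \<phi> c)" if "c \<in> C" for c
    using C.commutative_expansion[OF comm, of c "theta \<chi>\<^sub>0"] that k by (simp add: I_def)
  have "theta \<chi>\<^sub>0 \<one> = (\<Sum>\<phi>\<in>I. of_int (k \<phi>))"
    unfolding expand[OF subgroup.one_closed[OF C]] using lin by (intro sum.cong) (auto simp: lin_char_def)
  moreover have "norm (theta \<chi>\<^sub>0 g) \<le> (\<Sum>\<phi>\<in>I. norm (of_int (k \<phi>) * \<phi> g))"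
    unfolding expand[OF gC] by (rule norm_sum)
  moreover have "\<dots> = (\<Sum>\<phi>\<in>I. of_int (k \<phi>))"
    using k lin_char_norm[OF C lin gC] by (intro sum.cong) (auto simp: norm_mult)
  ultimately show ?thesis by simp
qed

text \<open>Additivity gives n(G, Reg) as the sum of the degrees times n(G, \<psi>), and the term
  removed has degree 1.\<close>

lemma theta_one:
  assumes \<chi>: "lin_char G (carrier G) \<chi>\<^sub>0"
  shows "theta \<chi>\<^sub>0 \<one> = of_int (n (carrier G) (Reg G) - n (carrier G) \<chi>\<^sub>0)"
proof -
  have \<chi>Irr: "\<chi>\<^sub>0 \<in> Irr G" by (rule lin_char_in_Irr[OF \<chi>])
  have "\<exists>d :: nat. \<psi> \<one> = of_nat d" if "\<psi> \<in> Irr G" for \<psi> using Irr_one[OF that] by blast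
  then obtain d :: "('a \<Rightarrow> complex) \<Rightarrow> nat" where d: "\<And>\<psi>. \<psi> \<in> Irr G \<Longrightarrow> \<psi> \<one> = of_nat (d \<psi>)" by metis
  have "Reg G = (\<lambda>g. \<Sum>\<psi>\<in>Irr G. of_nat (d \<psi>) * \<psi> g)" unfolding Reg_def using d by simp
  then have "n (carrier G) (Reg G) = (\<Sum>\<psi>\<in>Irr G. int (d \<psi>) * n (carrier G) \<psi>)"
    using Irr_is_character by (simp add: n_sum[OF subgroup_self finite_Irr])
  then have "of_int (n (carrier G) (Reg G)) = (\<Sum>\<psi>\<in>Irr G. of_int (n (carrier G) \<psi>) * \<psi> \<one>)"
    using d by (simp add: mult.commute)
  also have "\<dots> = of_int (n (carrier G) \<chi>\<^sub>0) * \<chi>\<^sub>0 \<one> + theta \<chi>\<^sub>0 \<one>"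
    unfolding theta_def by (rule sum.remove[OF finite_Irr \<chi>Irr])
  finally show ?thesis using \<chi> by (simp add: lin_char_def)
qed

text \<open>\<open>cform\<close> is bilinear, so the integer coefficients come out as squares
  without conjugation.\<close>

lemma cform_theta:
  "cform (theta \<chi>\<^sub>0) (theta \<chi>\<^sub>0) = of_int (\<Sum>\<psi>\<in>Irr G - {\<chi>\<^sub>0}. (n (carrier G) \<psi>)\<^sup>2)"
proof -
  define J where "J = Irr G - {\<chi>\<^sub>0}"
  have J: "finite J" by (simp add: J_def)
  define t where "t = (\<lambda>g. \<Sum>\<psi>\<in>J. of_int (n (carrier G) \<psi>) * \<psi> g)"
  have "cform t t = (\<Sum>\<psi>\<in>J. \<Sum>\<xi>\<in>J. of_int (n (carrier G) \<psi>) * (of_int (n (carrier G) \<xi>) * cform \<psi> \<xi>))"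
    unfolding t_def by (simp add: cform_sum_left cform_sum_right cform_mult_left cform_mult_right sum_distrib_left)
  also have "\<dots> = (\<Sum>\<psi>\<in>J. \<Sum>\<xi>\<in>J. if \<xi> = \<psi> then of_int ((n (carrier G) \<psi>)\<^sup>2) else 0)"
    by (intro sum.cong refl) (auto simp: J_def Irr_orthonormal power2_eq_square)
  also have "\<dots> = of_int (\<Sum>\<psi>\<in>J. (n (carrier G) \<psi>)\<^sup>2)" using J by simp
  finally show ?thesis unfolding t_def J_def theta_def .
qed

text \<open>\<open>cform\<close> is a mean of products of values at g and at its inverse, and
  \<open>theta_bound\<close> applies to both factors, so every summand is at most the square of
  theta at the identity.\<close>

lemma sum_squares_le:
  assumes solv: "solvable G" and \<chi>: "lin_char G (carrier G) \<chi>\<^sub>0"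
  shows "(\<Sum>\<psi>\<in>Irr G - {\<chi>\<^sub>0}. (n (carrier G) \<psi>)\<^sup>2) \<le> (n (carrier G) (Reg G) - n (carrier G) \<chi>\<^sub>0)\<^sup>2"
proof -
  define S where "S = (\<Sum>\<psi>\<in>Irr G - {\<chi>\<^sub>0}. (n (carrier G) \<psi>)\<^sup>2)"
  define R where "R = n (carrier G) (Reg G) - n (carrier G) \<chi>\<^sub>0"
  define c where "c = real (card (carrier G))"
  have c: "c > 0" using card_pos by (simp add: c_def)
  have bound: "norm (theta \<chi>\<^sub>0 g) \<le> of_int R" if "g \<in> carrier G" for g
    using theta_bound[OF solv \<chi> that] theta_one[OF \<chi>] by (simp add: R_def)
  have "real_of_int S \<le> norm (cform (theta \<chi>\<^sub>0) (theta \<chi>\<^sub>0))"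
    unfolding cform_theta S_def[symmetric] by simp
  also have "\<dots> = norm (\<Sum>g\<in>carrier G. theta \<chi>\<^sub>0 g * theta \<chi>\<^sub>0 (inv g)) / c"
    by (simp add: cform_def norm_divide c_def)
  also have "\<dots> \<le> (\<Sum>g\<in>carrier G. (of_int R)\<^sup>2) / c"
  proof (intro divide_right_mono sum_norm_le)
    fix g assume g: "g \<in> carrier G"
    have "norm (theta \<chi>\<^sub>0 g * theta \<chi>\<^sub>0 (inv g)) \<le> of_int R * of_int R"
      \<comment> \<open>That \<open>R\<close> is nonnegative, as required to multiply the bounds,
        follows from the bound itself, since a norm is nonnegative.\<close>
      unfolding norm_mult using bound[OF g] bound[of "inv g"] g
      by (intro mult_mono order_trans[OF norm_ge_zero bound[OF g]]) auto
    then show "norm (theta \<chi>\<^sub>0 g * theta \<chi>\<^sub>0 (inv g)) \<le> (of_int R)\<^sup>2" by (simp add: power2_eq_square)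
  qed (use c in simp)
  also have "\<dots> = real_of_int (R\<^sup>2)" using c by (simp add: c_def)
  finally have "S \<le> R\<^sup>2" by linarith
  then show ?thesis by (simp add: S_def R_def)
qed

end

theorem theorem5p3p1:
  fixes G :: "('a, 'b) monoid_scheme"
    and n :: "'a set \<Rightarrow> ('a \<Rightarrow> complex) \<Rightarrow> int"
    and \<chi>\<^sub>0 :: "'a \<Rightarrow> complex"
  assumes "group G" and "finite (carrier G)" and "solvable G"
    and ACH1: "\<And>H \<phi>\<^sub>1 \<phi>\<^sub>2. subgroup H G \<Longrightarrow> is_character G H \<phi>\<^sub>1 \<Longrightarrow> is_character G H \<phi>\<^sub>2 \<Longrightarrow>
                 n H (\<lambda>g. \<phi>\<^sub>1 g + \<phi>\<^sub>2 g) = n H \<phi>\<^sub>1 + n H \<phi>\<^sub>2"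
    and ACH2: "\<And>H \<phi>. subgroup H G \<Longrightarrow> is_character G H \<phi> \<Longrightarrow> n (carrier G) (Ind G H \<phi>) = n H \<phi>"
    and ACH3: "\<And>H \<phi>. subgroup H G \<Longrightarrow> is_linear_character G H \<phi> \<Longrightarrow> n H \<phi> \<ge> 0"
    and "is_linear_character G (carrier G) \<chi>\<^sub>0"
  shows "(\<Sum>\<chi>\<in>Irr G - {\<chi>\<^sub>0}. (n (carrier G) \<chi>)\<^sup>2)
           \<le> (n (carrier G) (Reg G) - n (carrier G) \<chi>\<^sub>0)\<^sup>2"
proof -
  interpret heilbronn G n
    by (intro heilbronn.intro fin_group.intro fin_group_axioms.intro heilbronn_axioms.intro assms)
  have "lin_char G (carrier G) \<chi>\<^sub>0"
    using assms(7) is_linear_character_iff[of G "carrier G"] by simp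
  then show ?thesis by (rule sum_squares_le[OF assms(3)])
qed

end
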